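(* Let $0\le m<k\le n$ be integers and let $D\subset\mathbb{R}^n$ be a smooth bounded domain such that $S_{k-1}(II)>0$ on $\partial D$, where $II$ is the second fundamental form of $\partial D$. Then there exists a constant $C$, depending on $m$, $k$ and $D$, such that $$\big(J_m[u]\big)^{\frac1{m+1}}\le C\,\big(J_k[u]\big)^{\frac1{k+1}}$$ for any $k$-convex function $u$ with $u=0$ on $\partial D$.
   Context: For $\lambda\in\mathbb{R}^N$ and $0\le j\le N$, $S_j(\lambda)=\frac{j!(N-j)!}{N!}\sum_{i_1<\dots<i_j}\lambda_{i_1}\cdots\lambda_{i_j}$ is the normalized $j$-th elementary symmetric function ($S_0=1$). For a real symmetric matrix $A$ with vector of eigenvalues $\lambda(A)$, $S_j(A)=S_j(\lambda(A))$. $S_{k-1}(II)$ is $S_{k-1}$ evaluated at the $n-1$ eigenvalues (principal curvatures) of $II$, with the usual sign convention that $II$ is positive definite for a ball. Let $\Gamma_k=\{\lambda\in\mathbb{R}^n:S_j(\lambda)\ge0,\ j=1,\dots,k\}$. A real-valued function $u\in C^2(\bar D)$ is $k$-convex if $\lambda(\mathrm{Hess}(u))\in\Gamma_k$ at every point, where $\mathrm{Hess}(u)$ is the (real) Hessian matrix of $u$. For $u\in C^2(\bar D)$ and $0\le j\le n$, $J_j[u]=\int_D(-u)\,S_j(\mathrm{Hess}(u))$ (in particular $J_0[u]=\int_D(-u)$). *)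

theory Defs
  imports "HOL-Analysis.Analysis" "HOL-Library.Multiset"
begin

section \<open>Normalized elementary symmetric functions\<close>

text \<open>A vector in \<open>\<real>\<^sup>N\<close> is a list of length \<open>N\<close>: both \<open>N = n\<close> and \<open>N = n - 1\<close> are needed.\<close>

definition nsym :: "nat \<Rightarrow> real list \<Rightarrow> real" where
  "nsym j xs = fact j * fact (length xs - j) / fact (length xs) *
     (\<Sum>I | I \<subseteq> {..<length xs} \<and> card I = j. \<Prod>i\<in>I. xs ! i)"

definition Gamma_cone :: "nat \<Rightarrow> nat \<Rightarrow> real list set" where
  "Gamma_cone n k = {xs. length xs = n \<and> (\<forall>j\<in>{1..k}. nsym j xs \<ge> 0)}"

text \<open>
  Given the eigenspace \<open>E a\<close> for every real \<open>a\<close>, list the eigenvalues in increasing order,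
  repeated according to multiplicity.  The geometric multiplicity is used; all operators and
  forms below are symmetric, so it agrees with the algebraic one.  Only finitely many \<open>E a\<close>
  are nontrivial, so the abstraction to multisets is justified.
\<close>

definition eigenvalue_list :: "(real \<Rightarrow> 'a::euclidean_space set) \<Rightarrow> real list" where
  "eigenvalue_list E = sorted_list_of_multiset (Abs_multiset (\<lambda>a. dim (E a)))"

definition matrix_eigenvalues :: "real ^ 'n ^ 'n \<Rightarrow> real list" where
  "matrix_eigenvalues A = eigenvalue_list (\<lambda>a. {v. A *v v = a *\<^sub>R v})"


section \<open>Differentiability classes\<close>

definition partial_deriv :: "'n \<Rightarrow> (real ^ 'n \<Rightarrow> real) \<Rightarrow> real ^ 'n \<Rightarrow> real" where
  "partial_deriv i f x = frechet_derivative f (at x) (axis i 1)"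

definition grad :: "(real ^ 'n \<Rightarrow> real) \<Rightarrow> real ^ 'n \<Rightarrow> real ^ 'n" where
  "grad f x = (\<chi> i. partial_deriv i f x)"

definition hessian :: "(real ^ 'n \<Rightarrow> real) \<Rightarrow> real ^ 'n \<Rightarrow> real ^ 'n ^ 'n" where
  "hessian f x = (\<chi> i j. partial_deriv i (partial_deriv j f) x)"

text \<open>The sets \<open>U\<close> and \<open>D\<close> in the next definitions are meant to be open.\<close>

primrec Ck_on :: "nat \<Rightarrow> (real ^ 'n) set \<Rightarrow> (real ^ 'n \<Rightarrow> real) \<Rightarrow> bool" where
  "Ck_on 0 U f \<longleftrightarrow> continuous_on U f"
| "Ck_on (Suc k) U f \<longleftrightarrow>
     (\<forall>x\<in>U. f differentiable (at x)) \<and> (\<forall>i. Ck_on k U (partial_deriv i f))"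

definition smooth_on :: "(real ^ 'n) set \<Rightarrow> (real ^ 'n \<Rightarrow> real) \<Rightarrow> bool" where
  "smooth_on U f \<longleftrightarrow> (\<forall>k. Ck_on k U f)"

text \<open>
  All partial derivatives of order at most \<open>k\<close> (including order \<open>0\<close>) exist in \<open>D\<close> and extend
  continuously to the closure of \<open>D\<close>.
\<close>

primrec Ck_extendable :: "nat \<Rightarrow> (real ^ 'n) set \<Rightarrow> (real ^ 'n \<Rightarrow> real) \<Rightarrow> bool" where
  "Ck_extendable 0 D f \<longleftrightarrow> (\<exists>g. continuous_on (closure D) g \<and> (\<forall>x\<in>D. g x = f x))"
| "Ck_extendable (Suc k) D f \<longleftrightarrow>
     (\<exists>g. continuous_on (closure D) g \<and> (\<forall>x\<in>D. g x = f x)) \<and>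
     (\<forall>x\<in>D. f differentiable (at x)) \<and> (\<forall>i. Ck_extendable k D (partial_deriv i f))"

text \<open>
  The first conjunct makes the boundary values of \<open>u\<close> itself those of the continuous extension
  of its restriction to \<open>D\<close>.
\<close>

definition C2_closure :: "(real ^ 'n) set \<Rightarrow> (real ^ 'n \<Rightarrow> real) \<Rightarrow> bool" where
  "C2_closure D u \<longleftrightarrow> continuous_on (closure D) u \<and> Ck_extendable 2 D u"


section \<open>Smooth domains and the second fundamental form of the boundary\<close>

definition local_defining_function ::
    "(real ^ 'n) set \<Rightarrow> (real ^ 'n) set \<Rightarrow> (real ^ 'n \<Rightarrow> real) \<Rightarrow> bool" where
  "local_defining_function D U r \<longleftrightarrow>
     open U \<and> smooth_on U r \<and> (\<forall>x\<in>U. grad r x \<noteq> 0) \<and> D \<inter> U = {x\<in>U. r x < 0}"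

definition smooth_bounded_domain :: "(real ^ 'n) set \<Rightarrow> bool" where
  "smooth_bounded_domain D \<longleftrightarrow>
     D \<noteq> {} \<and> open D \<and> connected D \<and> bounded D \<and>
     (\<forall>p\<in>frontier D. \<exists>U r. p \<in> U \<and> local_defining_function D U r)"

text \<open>
  The normalized gradient at \<open>p\<close> is the same for all defining functions near \<open>p\<close>.
  Since \<open>D\<close> is where \<open>r\<close> is negative, it points out of \<open>D\<close>.
\<close>

definition outer_normal :: "(real ^ 'n) set \<Rightarrow> real ^ 'n \<Rightarrow> real ^ 'n" where
  "outer_normal D p =
     (THE v. \<exists>U r. p \<in> U \<and> local_defining_function D U r \<and> v = sgn (grad r p))"

definition boundary_tangent :: "(real ^ 'n) set \<Rightarrow> real ^ 'n \<Rightarrow> (real ^ 'n) set" where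
  "boundary_tangent D p = {v. v \<bullet> outer_normal D p = 0}"

text \<open>
  The derivative of the outer unit normal within the boundary is determined only on tangent
  vectors, the only arguments used below.  With the outer normal, \<open>II (v, w) = \<langle>d\<nu> v, w\<rangle>\<close>
  is positive definite for a ball.
\<close>

definition second_fundamental_form ::
    "(real ^ 'n) set \<Rightarrow> real ^ 'n \<Rightarrow> real ^ 'n \<Rightarrow> real ^ 'n \<Rightarrow> real" where
  "second_fundamental_form D p v w =
     frechet_derivative (outer_normal D) (at p within frontier D) v \<bullet> w"

definition principal_curvatures :: "(real ^ 'n) set \<Rightarrow> real ^ 'n \<Rightarrow> real list" where
  "principal_curvatures D p = eigenvalue_list
     (\<lambda>a. {v \<in> boundary_tangent D p.
            \<forall>w\<in>boundary_tangent D p. second_fundamental_form D p v w = a * (v \<bullet> w)})"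


section \<open>\<open>k\<close>-convex functions and Hessian integrals\<close>

definition k_convex :: "nat \<Rightarrow> (real ^ 'n) set \<Rightarrow> (real ^ 'n \<Rightarrow> real) \<Rightarrow> bool" where
  "k_convex k D u \<longleftrightarrow>
     C2_closure D u \<and> (\<forall>x\<in>D. matrix_eigenvalues (hessian u x) \<in> Gamma_cone CARD('n) k)"

definition hessian_integral :: "nat \<Rightarrow> (real ^ 'n) set \<Rightarrow> (real ^ 'n \<Rightarrow> real) \<Rightarrow> real" where
  "hessian_integral j D u =
     (LINT x:D|lborel. (- u x) * nsym j (matrix_eigenvalues (hessian u x)))"

end

theory Submission
  imports Defs "HOL-Complex_Analysis.Cauchy_Integral_Formula"
begin

text \<open>
  Suppose that there is a \<open>k\<close>-convex \<open>\<rho>\<close> with \<open>\<rho> = 0\<close> on the boundary and \<open>Hess \<rho> - c I \<in> \<Gamma>\<^sub>k\<close>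
  for some \<open>c > 0\<close>.  Since \<open>S\<^sub>k\<close> is monotone along \<open>\<Gamma>\<^sub>k\<close> (Garding), \<open>S\<^sub>k(Hess (u + \<rho>))\<close> dominates a
  multiple of \<open>S\<^sub>m(Hess u)\<close>, while integration by parts shows that \<open>J\<^sub>k\<close> is convex along segments of
  \<open>k\<close>-convex functions with zero boundary values.  Hence
  \<open>J\<^sub>m[u] \<le> C (J\<^sub>k[u] + J\<^sub>k[\<rho>])\<close>; replacing \<open>u\<close> by \<open>s u\<close> and optimizing in \<open>s\<close> gives the inequality.

  The hypothesis only says that \<open>S\<^sub>k\<^sub>-\<^sub>1(II) > 0\<close>, but a single nonzero \<open>k\<close>-convex \<open>u\<close> vanishing on
  the boundary forces \<open>II \<in> \<Gamma>\<^sub>k\<^sub>-\<^sub>1\<close>: there \<open>Hess u\<close> restricted to the tangent space is at most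
  \<open>(\<partial>u/\<partial>\<nu>) II\<close>, and \<open>\<partial>u/\<partial>\<nu> > 0\<close> by the Hopf lemma.  (If there is no such \<open>u\<close>, both sides are \<open>0\<close>.)
  So if \<open>r\<close> defines the domain, then \<open>exp (t r) - 1\<close> with \<open>t\<close> large has Hessian in the
  interior of \<open>\<Gamma>\<^sub>k\<close> near the boundary, and a smooth maximum with a small multiple of
  \<open>\<bar>x\<bar>\<^sup>2 - const\<close> gives \<open>\<rho>\<close>.
\<close>

text \<open>The functions are only of class C2, so the divergence-free structure of the linearized
  Hessian operator, whose pointwise form involves third derivatives, is used in integrated form. For
  a compactly supported C1 field \<open>\<Phi>\<close> the map \<open>x + s \<Phi> x\<close>
  permutes a box when \<open>s\<close> is small, so the integral of its Jacobian determinant does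
  not depend on \<open>s\<close> and its coefficients of positive degree vanish. Differentiating
  this along a family of cut-off gradients gives integration by parts in which only Hessians occur.

  The cone enters through the polynomials \<open>S\<^sub>k(B + t A)\<close> in \<open>t\<close>,
  with \<open>A\<close> and \<open>B\<close> in its interior. Their roots are real and negative,
  hence their coefficients are nonnegative, and this yields monotonicity, convexity of the cone and
  the sign of the linearized operator. It is proved by following roots through complex pencils,
  starting from the identity matrix, where the claim reduces to Gauss-Lucas.

  On the boundary, the derivatives of \<open>u\<close> are continuous extensions only, so the
  boundary arguments are one-sided.\<close>

section \<open>Sums of principal minors\<close>

text \<open>The sum of the principal minors of order \<open>k\<close>: for a symmetric matrix, the
  elementary symmetric function of the eigenvalues. As a polynomial in the entries it is continuous
  and differentiable, and it makes sense for complex matrices and for Jacobians that are not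
  symmetric.\<close>

definition msym :: "nat \<Rightarrow> 'a::comm_ring_1 ^ 'n ^ 'n \<Rightarrow> 'a" where
  "msym k A = (\<Sum>I | card I = k. \<Sum>p | p permutes I. of_int (sign p) * (\<Prod>i\<in>I. A $ i $ p i))"

definition id_plus :: "'a::comm_ring_1 \<Rightarrow> 'a ^ 'n ^ 'n \<Rightarrow> 'a ^ 'n ^ 'n" where
  "id_plus s A = (\<chi> i j. of_bool (i = j) + s * A $ i $ j)"

lemma prod_of_bool: "finite A \<Longrightarrow> (\<Prod>x\<in>A. of_bool (P x)) = (of_bool (\<forall>x\<in>A. P x) :: 'a::comm_semiring_1)"
  by (induction A rule: finite_induct) auto

lemma sum_card_split:
  fixes f :: "'n::finite set \<Rightarrow> 'b::comm_monoid_add"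
  shows "(\<Sum>I\<in>UNIV. f I) = (\<Sum>k\<le>CARD('n). \<Sum>I | card I = k. f I)"
proof -
  have "(\<Sum>I\<in>UNIV. f I) = (\<Sum>k\<in>card ` (UNIV :: 'n set set). \<Sum>I\<in>{I\<in>UNIV. card I = k}. f I)"
    using sum.image_gen[of "UNIV :: 'n set set" f card] by simp
  also have "\<dots> = (\<Sum>k\<le>CARD('n). \<Sum>I\<in>{I\<in>UNIV. card I = k}. f I)"
    by (rule sum.mono_neutral_left) (auto simp: card_mono intro!: sum.neutral)
  finally show ?thesis by simp
qed

text \<open>In each product over \<open>i\<close>, \<open>I\<close> is the set of factors that
  contribute the term with \<open>s\<close>. The remaining factors are Kronecker symbols, so only
  permutations fixing the complement of \<open>I\<close> survive, and these are the permutations of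
  \<open>I\<close>.\<close>

lemma det_id_plus:
  fixes A :: "'a::comm_ring_1 ^ 'n ^ 'n"
  shows "det (id_plus s A) = (\<Sum>k\<le>CARD('n). msym k A * s ^ k)"
proof -
  have *: "of_int (sign p) * (\<Prod>i\<in>UNIV. id_plus s A $ i $ p i) =
     (\<Sum>I\<in>UNIV. if p permutes I then of_int (sign p) * (\<Prod>i\<in>I. A $ i $ p i) * s ^ card I else 0)"
    if "p permutes UNIV" for p :: "'n \<Rightarrow> 'n"
  proof -
    have perm: "p permutes I \<longleftrightarrow> (\<forall>i\<in>-I. i = p i)" for I
      using that permutes_superset[OF that, of I] permutes_not_in[of p I]
      by (metis ComplI Compl_iff DiffE)
    have "(\<Prod>i\<in>UNIV. id_plus s A $ i $ p i) = (\<Prod>i\<in>UNIV. s * A $ i $ p i + of_bool (i = p i))"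
      by (simp add: id_plus_def add.commute)
    also have "\<dots> = (\<Sum>I\<in>UNIV. (\<Prod>i\<in>I. s * A $ i $ p i) * (\<Prod>i\<in>-I. of_bool (i = p i)))"
      by (subst prod_add) (simp_all add: Compl_eq_Diff_UNIV)
    also have "\<dots> = (\<Sum>I\<in>UNIV. (\<Prod>i\<in>I. s * A $ i $ p i) * of_bool (p permutes I))"
      unfolding perm by (simp add: prod_of_bool)
    also have "of_int (sign p) * \<dots> =
       (\<Sum>I\<in>UNIV. if p permutes I then of_int (sign p) * (\<Prod>i\<in>I. A $ i $ p i) * s ^ card I else 0)"
      unfolding sum_distrib_left by (intro sum.cong) (auto simp: prod.distrib mult_ac)
    finally show ?thesis .
  qed
  have "det (id_plus s A) = (\<Sum>p | p permutes UNIV. \<Sum>I\<in>UNIV.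
      if p permutes I then of_int (sign p) * (\<Prod>i\<in>I. A $ i $ p i) * s ^ card I else 0)"
    unfolding det_def by (intro sum.cong) (use * in auto)
  also have "\<dots> = (\<Sum>I\<in>UNIV. \<Sum>p | p permutes UNIV.
      if p permutes I then of_int (sign p) * (\<Prod>i\<in>I. A $ i $ p i) * s ^ card I else 0)"
    by (rule sum.swap)
  also have "\<dots> = (\<Sum>I\<in>UNIV. (\<Sum>p | p permutes I.
      of_int (sign p) * (\<Prod>i\<in>I. A $ i $ p i)) * s ^ card I)"
    unfolding sum_distrib_right
    by (intro sum.cong refl sum.mono_neutral_cong_right)
       (auto intro: permutes_subset simp: finite_permutations)
  also have "\<dots> = (\<Sum>k\<le>CARD('n). msym k A * s ^ k)"
    unfolding sum_card_split msym_def sum_distrib_right by (intro sum.cong) auto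
  finally show ?thesis .
qed

text \<open>Comparing coefficients reduces identities for \<open>msym\<close> to identities for
  \<open>det (id_plus s A)\<close>, where multiplicativity is available.\<close>

lemma msym_eq_coeff:
  fixes A :: "'a::{idom,real_normed_div_algebra} ^ 'n ^ 'n"
  assumes "\<And>s. det (id_plus s A) = (\<Sum>k\<le>CARD('n). c k * s ^ k)" "k \<le> CARD('n)"
  shows "msym k A = c k"
proof -
  have "\<forall>s. (\<Sum>k\<le>CARD('n). msym k A * s ^ k) = (\<Sum>k\<le>CARD('n). c k * s ^ k)"
    using assms(1) by (simp add: det_id_plus)
  then show ?thesis using assms(2) by (subst (asm) polyfun_eq_coeffs) auto
qed

lemma msym_gt_card: "CARD('n) < k \<Longrightarrow> msym k (A :: 'a::comm_ring_1 ^ 'n ^ 'n) = 0"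
proof -
  assume "CARD('n) < k"
  then have "{I :: 'n set. card I = k} = {}"
    by (metis (mono_tags, lifting) card_mono finite mem_Collect_eq not_less subset_UNIV empty_Collect_eq)
  then show ?thesis by (simp add: msym_def)
qed

lemma msym_0 [simp]: "msym 0 A = (1 :: 'a::comm_ring_1)"
  by (simp add: msym_def permutes_empty)

lemma msym_scale: "msym k (\<chi> i j. c * A $ i $ j) = c ^ k * msym k A"
  by (auto simp: msym_def sum_distrib_left prod.distrib mult_ac intro!: sum.cong)

lemma msym_cong_det:
  fixes A :: "'a::{idom,real_normed_div_algebra} ^ 'n ^ 'n" and B :: "'a ^ 'n ^ 'n"
  assumes "\<And>s. det (id_plus s A) = det (id_plus s B)"
  shows "msym k A = msym k B"
proof (cases "k \<le> CARD('n)")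
  case True
  then show ?thesis using assms by (intro msym_eq_coeff) (simp_all add: det_id_plus)
qed (simp add: msym_gt_card)

lemma msym_transpose:
  fixes A :: "'a::{idom,real_normed_div_algebra} ^ 'n ^ 'n"
  shows "msym k (transpose A) = msym k A"
proof (rule msym_cong_det)
  fix s
  have "id_plus s (transpose A) = transpose (id_plus s A)"
    by (auto simp: id_plus_def transpose_def vec_eq_iff)
  then show "det (id_plus s (transpose A)) = det (id_plus s A)" by simp
qed

lemma matrix_add_rdistrib: "(A + B) ** C = A ** C + B ** C"
  by (simp add: vec_eq_iff matrix_matrix_mult_def sum.distrib distrib_right)

lemma id_plus_similar:
  fixes A R Q :: "'a::comm_ring_1 ^ 'n ^ 'n"
  assumes "R ** Q = mat 1"
  shows "id_plus s (R ** A ** Q) = R ** id_plus s A ** Q"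
proof -
  have "id_plus s B = mat 1 + (\<chi> i j. s * B $ i $ j)" for B :: "'a ^ 'n ^ 'n"
    by (auto simp: id_plus_def vec_eq_iff mat_def)
  moreover have "(\<chi> i j. s * (R ** A ** Q) $ i $ j) = R ** (\<chi> i j. s * A $ i $ j) ** Q"
    by (auto simp: vec_eq_iff matrix_matrix_mult_def sum_distrib_left sum_distrib_right mult_ac)
  ultimately show ?thesis
    using assms by (simp add: matrix_add_ldistrib matrix_add_rdistrib)
qed

lemma msym_similar:
  fixes A R Q :: "'a::{idom,real_normed_div_algebra} ^ 'n ^ 'n"
  assumes "R ** Q = mat 1"
  shows "msym k (R ** A ** Q) = msym k A"
proof (rule msym_cong_det)
  fix s
  have "det R * det Q = 1" using assms by (metis det_I det_mul)
  then show "det (id_plus s (R ** A ** Q)) = det (id_plus s A)"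
    by (simp add: id_plus_similar[OF assms] det_mul mult_ac)
qed

subsection \<open>Elementary symmetric functions of lists\<close>

definition esym :: "nat \<Rightarrow> 'a::comm_ring_1 list \<Rightarrow> 'a" where
  "esym j xs = (\<Sum>I | I \<subseteq> {..<length xs} \<and> card I = j. \<Prod>i\<in>I. xs ! i)"

text \<open>The normalizing factor is positive and depends only on \<open>N\<close> and
  \<open>j\<close>, so it affects no sign and changes the inequality only by a constant.\<close>

lemma nsym_esym: "\<exists>c>0. \<forall>xs. length xs = N \<longrightarrow> nsym j xs = c * esym j xs"
  by (rule exI[of _ "fact j * fact (N - j) / fact N"]) (auto simp: nsym_def esym_def)

lemma prod_list_esym: "prod_list (map (\<lambda>x. 1 + x * s) xs) = (\<Sum>k\<le>length xs. esym k xs * s ^ k)"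
proof -
  have "prod_list (map (\<lambda>x. 1 + x * s) xs) = (\<Prod>i<length xs. xs ! i * s + 1)"
    by (subst prod.list_conv_set_nth) (simp add: atLeast0LessThan add.commute)
  also have "\<dots> = (\<Sum>I\<in>Pow {..<length xs}. (\<Prod>i\<in>I. xs ! i * s))"
    by (subst prod_add) auto
  also have "\<dots> = (\<Sum>k\<in>card ` Pow {..<length xs}. \<Sum>I\<in>{I\<in>Pow {..<length xs}. card I = k}. \<Prod>i\<in>I. xs ! i * s)"
    by (rule sum.image_gen) simp
  also have "\<dots> = (\<Sum>k\<le>length xs. \<Sum>I\<in>{I\<in>Pow {..<length xs}. card I = k}. \<Prod>i\<in>I. xs ! i * s)"
  proof (rule sum.mono_neutral_left)
    show "card ` Pow {..<length xs} \<subseteq> {..length xs}"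
      using card_mono[of "{..<length xs}"] by fastforce
  qed (auto intro!: sum.neutral)
  also have "\<dots> = (\<Sum>k\<le>length xs. esym k xs * s ^ k)"
    unfolding esym_def sum_distrib_right by (intro sum.cong) (auto simp: prod.distrib)
  finally show ?thesis .
qed

section \<open>Symmetric matrices\<close>

definition outer :: "real ^ 'n \<Rightarrow> real ^ 'n \<Rightarrow> real ^ 'n ^ 'n" where
  "outer a b = (\<chi> i j. a $ i * b $ j)"

lemma outer_mult: "outer a b *v w = (b \<bullet> w) *\<^sub>R a"
  by (auto simp: outer_def matrix_vector_mult_def vec_eq_iff inner_vec_def sum_distrib_left sum_distrib_right mult_ac)

lemma symmetric_dot:
  fixes A :: "real ^ 'n ^ 'n"
  assumes "transpose A = A"
  shows "(A *v v) \<bullet> w = v \<bullet> (A *v w)"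
  using assms by (metis dot_lmul_matrix vector_transpose_matrix)

lemma matrix_form_continuous: "continuous_on UNIV (\<lambda>v::real^'n. (A *v v) \<bullet> v)"
  by (intro continuous_intros linear_continuous_on) auto

text \<open>The first eigenvector maximizes the quadratic form on the unit sphere of the subspace;
  the others lie in its orthogonal complement.\<close>

lemma spectral_subspace:
  fixes A :: "real ^ 'n ^ 'n"
  assumes sym: "transpose A = A" and "subspace T"
  shows "\<exists>B lam. finite B \<and> B \<subseteq> T \<and> pairwise orthogonal B \<and> (\<forall>b\<in>B. norm b = 1) \<and> span B = T \<and>
           (\<forall>b\<in>B. \<forall>w\<in>T. (A *v b) \<bullet> w = lam b * (b \<bullet> w))"
  using assms(2)
proof (induction "dim T" arbitrary: T)
  case 0
  then have "T = {0}" using dim_eq_0[of T] subspace_0 by fastforce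
  then show ?case by (intro exI[of _ "{}"]) auto
next
  case (Suc d)
  define S where "S = T \<inter> sphere 0 1"
  have "compact S" unfolding S_def
    by (intro closed_Int_compact closed_subspace Suc.prems compact_sphere)
  moreover have "S \<noteq> {}"
  proof -
    obtain x where "x \<in> T" "x \<noteq> 0" using Suc.hyps(2) dim_eq_0[of T] by fastforce
    then have "x /\<^sub>R norm x \<in> S" using Suc.prems by (auto simp: S_def subspace_scale)
    then show ?thesis by auto
  qed
  ultimately obtain v where v: "v \<in> S" and max: "\<And>w. w \<in> S \<Longrightarrow> (A *v w) \<bullet> w \<le> (A *v v) \<bullet> v"
    using continuous_attains_sup[of S "\<lambda>v. (A *v v) \<bullet> v"]
      continuous_on_subset[OF matrix_form_continuous subset_UNIV, of S A] by blast
  define l where "l = (A *v v) \<bullet> v"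
  have vT: "v \<in> T" and nv: "norm v = 1" "v \<bullet> v = 1" using v by (auto simp: S_def norm_eq_1)
  have le: "(A *v w) \<bullet> w \<le> l * (w \<bullet> w)" if "w \<in> T" for w
  proof (cases "w = 0")
    case False
    have "w /\<^sub>R norm w \<in> S" using that False Suc.prems by (auto simp: S_def subspace_scale)
    from max[OF this] have "(A *v w) \<bullet> w / (norm w)\<^sup>2 \<le> l"
      by (simp add: l_def matrix_vector_mult_scaleR power2_eq_square divide_inverse mult_ac)
    then show ?thesis using False by (simp add: divide_le_eq power2_norm_eq_inner)
  qed auto
  have orth0: "(A *v v) \<bullet> w = 0" if w: "w \<in> T" "v \<bullet> w = 0" for w
  proof -
    define c where "c = (A *v v) \<bullet> w"
    \<comment> \<open>Maximality of \<open>v\<close> along the line \<open>v + t w\<close>: a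
      quadratic in \<open>t\<close> that is never positive and vanishes at \<open>0\<close> has no
      linear term.\<close>
    have ineq: "2 * t * c + t\<^sup>2 * ((A *v w) \<bullet> w - l * (w \<bullet> w)) \<le> 0" for t
    proof -
      have "v + t *\<^sub>R w \<in> T" using w vT Suc.prems by (simp add: subspace_add subspace_scale)
      from le[OF this] have "(A *v (v + t *\<^sub>R w)) \<bullet> (v + t *\<^sub>R w) \<le> l * ((v + t *\<^sub>R w) \<bullet> (v + t *\<^sub>R w))" .
      moreover have "(A *v w) \<bullet> v = c" using symmetric_dot[OF sym, of w v] by (simp add: c_def inner_commute)
      ultimately show ?thesis using w nv c_def l_def
        by (simp add: matrix_vector_right_distrib matrix_vector_mult_scaleR inner_add_left inner_add_right
            inner_commute[of w v] power2_eq_square algebra_simps)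
    qed
    have "c = 0"
    proof (rule ccontr)
      assume "c \<noteq> 0"
      define q where "q = (A *v w) \<bullet> w - l * (w \<bullet> w)"
      have "2 * t * c + t\<^sup>2 * q \<le> 0" for t using ineq[of t] by (simp add: q_def)
      \<comment> \<open>With this \<open>d\<close> the linear term dominates at
        \<open>t = c / d\<close>: the value is \<open>(c / d)\<^sup>2 * (2 * d + q)\<close>, which
        is positive.\<close>
      moreover define d where "d = \<bar>q\<bar> + 1"
      ultimately have "2 * (c / d) * c + (c / d)\<^sup>2 * q \<le> 0" by blast
      moreover have d: "d > 0" "2 * d + q > 0" by (auto simp: d_def)
      then have "2 * (c / d) * c + (c / d)\<^sup>2 * q = (c / d)\<^sup>2 * (2 * d + q)"
        by (simp add: field_simps power2_eq_square)
      moreover have "(c / d)\<^sup>2 * (2 * d + q) > 0" using d \<open>c \<noteq> 0\<close> by simp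
      ultimately show False by linarith
    qed
    then show ?thesis by (simp add: c_def)
  qed
  have eig: "(A *v v) \<bullet> w = l * (v \<bullet> w)" if "w \<in> T" for w
  proof -
    have "(A *v v) \<bullet> (w - (v \<bullet> w) *\<^sub>R v) = 0"
      using that vT nv Suc.prems by (intro orth0) (auto simp: subspace_diff subspace_scale inner_diff_right)
    then show ?thesis by (simp add: inner_diff_right l_def)
  qed
  define T' where "T' = {w\<in>T. v \<bullet> w = 0}"
  have sub': "subspace T'" using Suc.prems by (auto simp: T'_def subspace_def inner_add_right)
  have T: "T = span (insert v T')"
  proof
    show "T \<subseteq> span (insert v T')"
    proof
      fix w assume "w \<in> T"
      then have "w - (v \<bullet> w) *\<^sub>R v \<in> T'"
        using vT nv Suc.prems by (auto simp: T'_def subspace_diff subspace_scale inner_diff_right)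
      then show "w \<in> span (insert v T')" unfolding span_insert by (auto intro: span_base)
    qed
    show "span (insert v T') \<subseteq> T" using vT Suc.prems by (intro span_minimal) (auto simp: T'_def)
  qed
  have vn: "v \<notin> span T'" using sub' nv by (auto simp: T'_def span_eq_iff[THEN iffD2])
  have "dim T = dim (insert v T')" unfolding T by simp
  with vn Suc.hyps(2) have "d = dim T'" by (simp add: dim_insert)
  from Suc.hyps(1)[OF this sub'] obtain B lam where B: "finite B" "B \<subseteq> T'" "pairwise orthogonal B"
      "\<forall>b\<in>B. norm b = 1" "span B = T'" "\<forall>b\<in>B. \<forall>w\<in>T'. (A *v b) \<bullet> w = lam b * (b \<bullet> w)" by blast
  have vB: "v \<notin> B" using B(2) nv by (auto simp: T'_def)
  have "(A *v b) \<bullet> w = lam b * (b \<bullet> w)" if "b \<in> B" "w \<in> T" for b w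
  proof -
    have b: "b \<in> T'" using that B by auto
    have "(A *v b) \<bullet> v = 0" using eig[of b] b symmetric_dot[OF sym, of b v]
      by (simp add: T'_def inner_commute)
    moreover have "w - (v \<bullet> w) *\<^sub>R v \<in> T'"
      using that vT nv Suc.prems by (auto simp: T'_def subspace_diff subspace_scale inner_diff_right)
    then have "(A *v b) \<bullet> (w - (v \<bullet> w) *\<^sub>R v) = lam b * (b \<bullet> (w - (v \<bullet> w) *\<^sub>R v))" using B(6) that by blast
    ultimately show ?thesis using b by (simp add: inner_diff_right T'_def inner_commute)
  qed
  moreover have "span (insert v B) = T" unfolding T using B(5) by (metis (no_types) span_insert span_span)
  moreover have "pairwise orthogonal (insert v B)"
    using B(2,3) by (auto simp: pairwise_insert orthogonal_def T'_def inner_commute)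
  ultimately show ?case using B nv eig vB vT
    by (intro exI[of _ "insert v B"] exI[of _ "lam(v := l)"]) (auto simp: T'_def)
qed

lemma orthonormal_bij:
  fixes B :: "(real ^ 'n) set"
  assumes "finite B" "pairwise orthogonal B" "\<forall>b\<in>B. norm b = 1" "span B = UNIV"
  shows "\<exists>f. bij_betw f (UNIV :: 'n set) B"
proof -
  have "independent B" using assms by (intro pairwise_orthogonal_independent) auto
  then have "card B = CARD('n)" using dim_eq_card_independent[of B] assms(4) by (metis dim_UNIV dim_span DIM_cart DIM_real mult_1_right)
  then show ?thesis using assms(1) by (intro finite_same_card_bij) auto
qed

lemma orthonormal_frame:
  fixes f :: "'n::finite \<Rightarrow> real ^ 'n"
  assumes "\<And>i j. f i \<bullet> f j = of_bool (i = j)"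
  defines "Q \<equiv> \<chi> i j. f j $ i"
  shows "transpose Q ** Q = mat 1" "Q ** transpose Q = mat 1"
    "\<And>A. transpose Q ** A ** Q = (\<chi> i j. f i \<bullet> (A *v f j))"
proof -
  show 1: "transpose Q ** Q = mat 1"
    using assms(1) by (auto simp: vec_eq_iff matrix_matrix_mult_def transpose_def mat_def Q_def inner_vec_def)
  show "Q ** transpose Q = mat 1" using 1 by (simp add: matrix_left_right_inverse)
  fix A
  show "transpose Q ** A ** Q = (\<chi> i j. f i \<bullet> (A *v f j))"
    unfolding matrix_mul_assoc[symmetric]
    by (auto simp: vec_eq_iff matrix_matrix_mult_def transpose_def Q_def inner_vec_def matrix_vector_mult_def)
qed

lemma orthonormal_bij_inner:
  fixes B :: "(real ^ 'n) set"
  assumes "pairwise orthogonal B" "\<forall>b\<in>B. norm b = 1" "bij_betw f UNIV B"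
  shows "f i \<bullet> f j = of_bool (i = j)"
proof (cases "i = j")
  case True
  then show ?thesis using assms by (auto simp: bij_betw_def norm_eq_1[symmetric])
next
  case False
  then have "f i \<noteq> f j" using assms(3) by (auto simp: bij_betw_def dest: injD)
  then show ?thesis using assms False by (auto simp: bij_betw_def pairwise_def orthogonal_def)
qed

lemma det_id_plus_diagonal:
  fixes d :: "'n::finite \<Rightarrow> 'a::comm_ring_1"
  shows "det (id_plus s (\<chi> i j. if i = j then d i else 0)) = (\<Prod>i\<in>UNIV. 1 + d i * s)"
  by (subst det_diagonal) (auto simp: id_plus_def mult.commute)

lemma det_id_plus_eigenbasis:
  fixes A :: "real ^ 'n ^ 'n"
  assumes B: "finite B" "pairwise orthogonal B" "\<forall>b\<in>B. norm b = 1" "span B = UNIV"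
    and eig: "\<And>b. b \<in> B \<Longrightarrow> A *v b = lam b *\<^sub>R b"
  shows "det (id_plus s A) = (\<Prod>b\<in>B. 1 + lam b * s)"
proof -
  obtain f where f: "bij_betw f (UNIV :: 'n set) B" using orthonormal_bij[OF B] by blast
  note ff = orthonormal_bij_inner[OF B(2,3) f]
  define Q where "Q = (\<chi> i j. f j $ i)"
  note Q = orthonormal_frame[of f, OF ff, folded Q_def]
  have af: "A *v f j = lam (f j) *\<^sub>R f j" for j using eig[of "f j"] f by (auto simp: bij_betw_def)
  have "transpose Q ** A ** Q = (\<chi> i j. if i = j then lam (f i) else 0)"
    unfolding Q(3) af by (simp add: vec_eq_iff ff)
  then have "det (id_plus s (transpose Q ** A ** Q)) = (\<Prod>i\<in>UNIV. 1 + lam (f i) * s)"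
    by (simp add: det_id_plus_diagonal)
  moreover have "det (transpose Q) * det Q = 1" using Q(1) by (metis det_I det_mul)
  then have "det (id_plus s (transpose Q ** A ** Q)) = det (id_plus s A)"
    by (simp add: id_plus_similar[OF Q(1)] det_mul mult_ac)
  moreover have "(\<Prod>i\<in>UNIV. 1 + lam (f i) * s) = (\<Prod>b\<in>B. 1 + lam b * s)"
    using prod.reindex_bij_betw[OF f, of "\<lambda>b. 1 + lam b * s"] .
  ultimately show ?thesis by simp
qed

lemma symmetric_diagonalizable:
  fixes A :: "real ^ 'n ^ 'n"
  assumes "transpose A = A"
  obtains Q :: "real ^ 'n ^ 'n" and d :: "'n \<Rightarrow> real" where "transpose Q ** Q = mat 1" "Q ** transpose Q = mat 1"
    "A = Q ** (\<chi> i j. if i = j then d i else 0) ** transpose Q"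
proof -
  obtain B lam where B: "finite B" "pairwise orthogonal B" "\<forall>b\<in>B. norm b = 1" "span B = UNIV"
     and eig: "\<forall>b\<in>B. \<forall>w. (A *v b) \<bullet> w = lam b * (b \<bullet> w)"
    using spectral_subspace[OF assms, of UNIV] by auto
  obtain f where f: "bij_betw f (UNIV :: 'n set) B" using orthonormal_bij[OF B] by blast
  note ff = orthonormal_bij_inner[OF B(2,3) f]
  define Q where "Q = (\<chi> i j. f j $ i)"
  note Q = orthonormal_frame[of f, OF ff, folded Q_def]
  have af: "f i \<bullet> (A *v f j) = lam (f j) * of_bool (j = i)" for i j
  proof -
    have "f j \<in> B" using f by (auto simp: bij_betw_def)
    then show ?thesis using eig ff[of j i] by (simp add: inner_commute[of "f i"])
  qed
  have D: "transpose Q ** A ** Q = (\<chi> i j. if i = j then lam (f i) else 0)"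
    unfolding Q(3) af by (simp add: vec_eq_iff)
  have "A = (Q ** transpose Q) ** A ** (Q ** transpose Q)" using Q(2) by simp
  also have "\<dots> = Q ** (transpose Q ** A ** Q) ** transpose Q" by (simp add: matrix_mul_assoc)
  also note D
  finally show ?thesis by (rule that[OF Q(1,2)])
qed

text \<open>Stated for the form of \<open>A\<close> on a subspace, to cover both the Hessian on the
  whole space and the second fundamental form on the tangent space. Vectors for different values of
  \<open>a\<close> are orthogonal, so the space for \<open>a\<close> is spanned by the basis vectors
  with \<open>lam b = a\<close>; the dimensions are thus the counts of a finite multiset, and
  \<open>Abs_multiset\<close> is meaningful.\<close>

lemma eigenvalue_list_mset:
  fixes A :: "real ^ 'n ^ 'n"
  assumes B: "finite B" "B \<subseteq> T" "pairwise orthogonal B" "\<forall>b\<in>B. norm b = 1" "span B = T"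
    and eig: "\<forall>b\<in>B. \<forall>w\<in>T. (A *v b) \<bullet> w = lam b * (b \<bullet> w)" and sym: "transpose A = A"
  shows "mset (eigenvalue_list (\<lambda>a. {v\<in>T. \<forall>w\<in>T. (A *v v) \<bullet> w = a * (v \<bullet> w)})) = image_mset lam (mset_set B)"
proof -
  have indep: "independent B" using B(3,4) by (intro pairwise_orthogonal_independent) auto
  have "dim {v\<in>T. \<forall>w\<in>T. (A *v v) \<bullet> w = a * (v \<bullet> w)} = card {b\<in>B. lam b = a}" for a
  proof -
    have T: "subspace T" using B(5) by (metis subspace_span)
    have "{v\<in>T. \<forall>w\<in>T. (A *v v) \<bullet> w = a * (v \<bullet> w)} = span {b\<in>B. lam b = a}" (is "?E = _")
    proof
      have "subspace ?E" using T by (auto simp: subspace_def algebra_simps inner_add_left)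
      then show "span {b\<in>B. lam b = a} \<subseteq> ?E" using B eig by (intro span_minimal) auto
      show "?E \<subseteq> span {b\<in>B. lam b = a}"
      proof
        fix v assume v: "v \<in> ?E"
        have z: "b \<bullet> v = 0" if "b \<in> B" "lam b \<noteq> a" for b
        proof -
          have "a * (v \<bullet> b) = (A *v v) \<bullet> b" using v that B by auto
          also have "\<dots> = (A *v b) \<bullet> v" using symmetric_dot[OF sym, of v b] by (simp add: inner_commute)
          also have "\<dots> = lam b * (b \<bullet> v)" using eig that v by auto
          finally show ?thesis using that by (simp add: inner_commute)
        qed
        have "v = (\<Sum>b\<in>B. (b \<bullet> v) *\<^sub>R b)"
        proof -
          define r where "r = v - (\<Sum>b\<in>B. (b \<bullet> v) *\<^sub>R b)"
          have "r \<in> T" unfolding r_def using v B(2) T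
            by (auto intro!: subspace_diff subspace_sum subspace_scale)
          then have "r \<in> span B" by (simp add: B(5))
          moreover have "orthogonal r b" if b: "b \<in> B" for b
          proof -
            have "b \<bullet> (\<Sum>c\<in>B. (c \<bullet> v) *\<^sub>R c) = (\<Sum>c\<in>B. if c = b then c \<bullet> v else 0)"
              unfolding inner_sum_right using B(3,4) b
              by (intro sum.cong) (auto simp: pairwise_def orthogonal_def norm_eq_1)
            then have "b \<bullet> r = 0" unfolding r_def using b B(1) by (simp add: inner_diff_right)
            then show ?thesis by (simp add: orthogonal_def inner_commute)
          qed
          ultimately have "orthogonal r r" by (rule orthogonal_to_span)
          then show ?thesis by (simp add: orthogonal_self r_def)
        qed
        also have "\<dots> = (\<Sum>b\<in>{b\<in>B. lam b = a}. (b \<bullet> v) *\<^sub>R b)"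
          using z B(1) by (intro sum.mono_neutral_right) auto
        finally have "v = (\<Sum>b\<in>{b\<in>B. lam b = a}. (b \<bullet> v) *\<^sub>R b)" .
        then show "v \<in> span {b\<in>B. lam b = a}"
          by (metis (no_types, lifting) span_base span_scale span_sum)
      qed
    qed
    moreover have "independent {b\<in>B. lam b = a}" using indep by (rule independent_mono) auto
    ultimately show ?thesis by (simp add: dim_eq_card_independent)
  qed
  then have "(\<lambda>a. dim {v\<in>T. \<forall>w\<in>T. (A *v v) \<bullet> w = a * (v \<bullet> w)}) = count (image_mset lam (mset_set B))"
    using B(1) by (auto simp: fun_eq_iff count_image_mset' intro!: arg_cong[where f = card])
  then show ?thesis by (simp add: eigenvalue_list_def count_inverse)
qed

text \<open>The list may be shorter than the dimension: the \<open>n - 1\<close> principal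
  curvatures are compared with an \<open>n\<close> by \<open>n\<close> matrix whose additional
  eigenvalue \<open>0\<close> contributes only a factor \<open>1\<close>.\<close>

lemma esym_eq_msym:
  fixes A :: "real ^ 'n ^ 'n"
  assumes "length xs \<le> CARD('n)" "\<And>s. prod_list (map (\<lambda>x. 1 + x * s) xs) = det (id_plus s A)"
  shows "esym j xs = msym j A"
proof -
  have esym0: "esym k xs = 0" if "length xs < k" for k
  proof -
    have "card I \<le> length xs" if "I \<subseteq> {..<length xs}" for I
      using card_mono[OF _ that] by simp
    with that have "{I. I \<subseteq> {..<length xs} \<and> card I = k} = {}"
      by (metis (mono_tags, lifting) Collect_empty_eq not_le)
    then show ?thesis unfolding esym_def by (simp only: sum.empty)
  qed
  show ?thesis
  proof (cases "j \<le> CARD('n)")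
    case True
    have "det (id_plus s A) = (\<Sum>k\<le>CARD('n). esym k xs * s ^ k)" for s
      unfolding assms(2)[symmetric] prod_list_esym using assms(1) esym0
      by (intro sum.mono_neutral_left) auto
    then show ?thesis using msym_eq_coeff[of A "\<lambda>k. esym k xs"] True by simp
  next
    case False
    then show ?thesis using assms(1) by (simp add: msym_gt_card esym0)
  qed
qed

lemma prod_list_image_mset:
  fixes lam :: "'b \<Rightarrow> real"
  assumes "mset xs = image_mset lam (mset_set B)" "finite B"
  shows "prod_list (map (\<lambda>x. 1 + x * s) xs) = (\<Prod>b\<in>B. 1 + lam b * s)"
proof -
  have "prod_list (map (\<lambda>x. 1 + x * s) xs) = prod_mset (image_mset (\<lambda>x. 1 + x * s) (mset xs))"
    by (simp add: prod_mset_prod_list[symmetric])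
  also have "\<dots> = (\<Prod>b\<in>B. 1 + lam b * s)"
    by (simp add: assms(1) prod_unfold_prod_mset multiset.map_comp o_def)
  finally show ?thesis .
qed

lemma card_orthonormal:
  fixes B :: "(real ^ 'n) set"
  assumes "pairwise orthogonal B" "\<forall>b\<in>B. norm b = 1"
  shows "card B = dim (span B)"
proof -
  have "independent B" using assms by (intro pairwise_orthogonal_independent) auto
  then show ?thesis by (simp add: dim_eq_card_independent)
qed

lemma matrix_eigenvalues_esym:
  fixes A :: "real ^ 'n ^ 'n"
  assumes "transpose A = A"
  shows "length (matrix_eigenvalues A) = CARD('n)" "esym j (matrix_eigenvalues A) = msym j A"
proof -
  obtain B lam where B: "finite B" "B \<subseteq> UNIV" "pairwise orthogonal B" "\<forall>b\<in>B. norm b = 1" "span B = UNIV"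
     and eig: "\<forall>b\<in>B. \<forall>w\<in>UNIV. (A *v b) \<bullet> w = lam b * (b \<bullet> w)"
    using spectral_subspace[OF assms, of UNIV] by auto
  have E: "{v. A *v v = a *\<^sub>R v} = {v\<in>UNIV. \<forall>w\<in>UNIV. (A *v v) \<bullet> w = a * (v \<bullet> w)}" for a
  proof -
    have "A *v v = a *\<^sub>R v \<longleftrightarrow> (\<forall>w. (A *v v) \<bullet> w = a * (v \<bullet> w))" for v
      using vector_eq_rdot[of "A *v v" "a *\<^sub>R v"] by auto
    then show ?thesis by auto
  qed
  have m: "mset (matrix_eigenvalues A) = image_mset lam (mset_set B)"
    using eigenvalue_list_mset[OF B eig assms] unfolding matrix_eigenvalues_def E .
  have "length (matrix_eigenvalues A) = card B"
    using arg_cong[OF m, of size] by simp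
  also have "\<dots> = CARD('n)" using card_orthonormal[OF B(3,4)] B(5) by simp
  finally show len: "length (matrix_eigenvalues A) = CARD('n)" .
  have "A *v b = lam b *\<^sub>R b" if "b \<in> B" for b
    using eig that vector_eq_rdot[of "A *v b" "lam b *\<^sub>R b"] by auto
  from det_id_plus_eigenbasis[OF B(1,3,4,5) this]
  show "esym j (matrix_eigenvalues A) = msym j A"
    by (intro esym_eq_msym) (simp_all add: len prod_list_image_mset[OF m B(1)])
qed

section \<open>Compression of a matrix to a hyperplane\<close>

definition proj_mat :: "real ^ 'n \<Rightarrow> real ^ 'n ^ 'n" where
  "proj_mat N = mat 1 - outer N N"

text \<open>For a unit vector \<open>N\<close> this is the form of \<open>A\<close> on the
  orthogonal complement of \<open>N\<close>, extended by \<open>0\<close> along \<open>N\<close>.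
  The size stays the same, and the eigenvalue \<open>0\<close> leaves the elementary symmetric
  functions unchanged.\<close>

definition compress :: "real ^ 'n \<Rightarrow> real ^ 'n ^ 'n \<Rightarrow> real ^ 'n ^ 'n" where
  "compress N A = proj_mat N ** A ** proj_mat N"

lemma proj_mat_mult: "proj_mat N *v w = w - (N \<bullet> w) *\<^sub>R N"
  by (simp add: proj_mat_def matrix_vector_mult_diff_rdistrib outer_mult)

lemma transpose_diff: "transpose (A - B) = transpose A - transpose (B :: real ^ 'n ^ 'm)"
  by (simp add: transpose_def vec_eq_iff)

lemma transpose_add: "transpose (A + B) = transpose A + transpose (B :: real ^ 'n ^ 'm)"
  by (simp add: transpose_def vec_eq_iff)

lemma transpose_outer: "transpose (outer a b) = outer b a"
  by (simp add: outer_def transpose_def vec_eq_iff mult.commute)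

lemma transpose_proj_mat: "transpose (proj_mat N) = proj_mat N"
  by (simp add: proj_mat_def transpose_diff transpose_outer)

lemma transpose_compress: "transpose A = A \<Longrightarrow> transpose (compress N A) = compress N A"
  by (simp add: compress_def matrix_transpose_mul transpose_proj_mat matrix_mul_assoc)

lemma compress_mult: "compress N A *v w = proj_mat N *v (A *v (proj_mat N *v w))"
  by (simp add: compress_def matrix_vector_mul_assoc matrix_mul_assoc)

lemma compress_eigenvalues:
  fixes A :: "real ^ 'n ^ 'n"
  assumes sym: "transpose A = A" and N: "norm N = 1" and T: "T = {v. v \<bullet> N = 0}"
  shows "length (eigenvalue_list (\<lambda>a. {v\<in>T. \<forall>w\<in>T. (A *v v) \<bullet> w = a * (v \<bullet> w)})) = CARD('n) - 1"
    "esym j (eigenvalue_list (\<lambda>a. {v\<in>T. \<forall>w\<in>T. (A *v v) \<bullet> w = a * (v \<bullet> w)})) = msym j (compress N A)"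
proof -
  have subT: "subspace T" unfolding T by (auto simp: subspace_def inner_add_left)
  from spectral_subspace[OF sym this] obtain B lam where
    B: "finite B" "B \<subseteq> T" "pairwise orthogonal B" "\<forall>b\<in>B. norm b = 1" "span B = T"
     and eig: "\<forall>b\<in>B. \<forall>w\<in>T. (A *v b) \<bullet> w = lam b * (b \<bullet> w)" by blast
  have m: "mset (eigenvalue_list (\<lambda>a. {v\<in>T. \<forall>w\<in>T. (A *v v) \<bullet> w = a * (v \<bullet> w)})) = image_mset lam (mset_set B)"
    (is "mset ?xs = _")
    by (rule eigenvalue_list_mset[OF B eig sym])
  have NN: "N \<bullet> N = 1" using N by (simp add: norm_eq_1)
  then have NT: "N \<notin> T" by (simp add: T)
  then have NB: "N \<notin> B" using B(2) by auto
  have B': "finite (insert N B)" "pairwise orthogonal (insert N B)" "\<forall>b\<in>insert N B. norm b = 1"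
    using B N by (auto simp: pairwise_insert orthogonal_def T inner_commute)
  have sp: "span (insert N B) = UNIV"
  proof -
    have "w \<in> span (insert N B)" for w
    proof -
      have "w - (w \<bullet> N) *\<^sub>R N \<in> T" using NN by (simp add: T inner_diff_left)
      then show ?thesis unfolding span_insert B(5) by blast
    qed
    then show ?thesis by auto
  qed
  have cB: "card (insert N B) = CARD('n)" using card_orthonormal[OF B'(2,3)] sp by simp
  have len: "length ?xs = card B" using arg_cong[OF m, of size] by simp
  then show len': "length ?xs = CARD('n) - 1" using cB NB B(1) by simp
  \<comment> \<open>The normal completes the eigenbasis of \<open>T\<close>, with eigenvalue
    \<open>0\<close>.\<close>
  define lam' where "lam' = lam(N := 0)"
  have e: "compress N A *v b = lam' b *\<^sub>R b" if b: "b \<in> insert N B" for b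
  proof (cases "b = N")
    case True
    then show ?thesis using NN by (simp add: compress_mult proj_mat_mult lam'_def)
  next
    case False
    then have bB: "b \<in> B" using b by auto
    then have bT: "N \<bullet> b = 0" using B(2) by (auto simp: T inner_commute)
    \<comment> \<open>\<open>r\<close> lies in \<open>T\<close>, and the weak eigenvalue equation
      tested with \<open>r\<close> itself gives \<open>r \<bullet> r = 0\<close>.\<close>
    define r where "r = proj_mat N *v (A *v b) - lam b *\<^sub>R b"
    have "N \<bullet> r = 0" using NN bT by (simp add: r_def proj_mat_mult inner_diff_right)
    then have rT: "r \<in> T" by (simp add: T inner_commute)
    have "(A *v b) \<bullet> r = lam b * (b \<bullet> r)" using eig bB rT by auto
    moreover have req: "r = A *v b - (N \<bullet> (A *v b)) *\<^sub>R N - lam b *\<^sub>R b" by (simp add: r_def proj_mat_mult)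
    then have "r \<bullet> r = (A *v b) \<bullet> r - (N \<bullet> (A *v b)) * (N \<bullet> r) - lam b * (b \<bullet> r)"
      by (subst (1) req) (simp add: inner_diff_left)
    ultimately have "r \<bullet> r = 0" using rT by (simp add: T inner_commute)
    then show ?thesis using False bT by (simp add: r_def compress_mult proj_mat_mult lam'_def)
  qed
  have "(\<Prod>b\<in>insert N B. 1 + lam' b * s) = (\<Prod>b\<in>B. 1 + lam b * s)" for s
    using B(1) NB by (simp add: lam'_def) (intro prod.cong, auto)
  with det_id_plus_eigenbasis[OF B' sp e]
  show "esym j ?xs = msym j (compress N A)"
    by (intro esym_eq_msym) (simp_all add: len' prod_list_image_mset[OF m B(1)])
qed

subsection \<open>Rank-one perturbations\<close>

lemma matrix_diff_ldistrib: "A ** (B - C) = A ** B - A ** (C :: real ^ 'n ^ 'm)"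
  by (simp add: vec_eq_iff matrix_matrix_mult_def sum_subtractf right_diff_distrib)

lemma matrix_diff_rdistrib: "(A - B) ** C = A ** C - B ** (C :: real ^ 'n ^ 'm)"
  by (simp add: vec_eq_iff matrix_matrix_mult_def sum_subtractf left_diff_distrib)

lemma matrix_scaleR_left: "(t *\<^sub>R A) ** C = t *\<^sub>R (A ** (C :: real ^ 'n ^ 'm))"
  by (simp add: vec_eq_iff matrix_matrix_mult_def sum_distrib_left mult.assoc)

lemma matrix_scaleR_right: "A ** (t *\<^sub>R C) = t *\<^sub>R (A ** (C :: real ^ 'n ^ 'm))"
  by (simp add: vec_eq_iff matrix_matrix_mult_def sum_distrib_left mult.left_commute)

lemma outer_mult_left: "M ** outer a b = outer (M *v a) b"
  unfolding outer_def vec_eq_iff matrix_matrix_mult_def matrix_vector_mult_def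
  by (simp add: sum_distrib_right mult.assoc)

lemma outer_mult_right: "outer a b ** M = outer a (transpose M *v b)"
  unfolding outer_def vec_eq_iff matrix_matrix_mult_def matrix_vector_mult_def transpose_def
  by (auto simp: sum_distrib_left intro!: sum.cong)

text \<open>Minors are affine in the diagonal entry at \<open>i0\<close>: a minor containing
  \<open>i0\<close> changes by \<open>t\<close> times the minor with that row and column deleted.
  Zeroing the row and the column removes from \<open>msym k\<close> exactly the minors that contain
  \<open>i0\<close>.\<close>

lemma msym_add_axis:
  fixes A :: "real ^ 'n ^ 'n"
  shows "msym (Suc k) (A + t *\<^sub>R outer (axis i0 1) (axis i0 1)) =
    msym (Suc k) A + t * msym k (\<chi> i j. if i = i0 \<or> j = i0 then 0 else A $ i $ j)" (is "msym _ ?B = _ + t * msym k ?C")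
proof -
  define Bm where "Bm = ?B"
  have B: "Bm $ i $ j = A $ i $ j + (if i = i0 \<and> j = i0 then t else 0)" for i j
    unfolding Bm_def by (auto simp: outer_def axis_def)
  define F where "F I = (\<Sum>p | p permutes I. of_int (sign p) * (\<Prod>i\<in>I. A $ i $ p i))" for I
  have 1: "(\<Sum>p | p permutes I. of_int (sign p) * (\<Prod>i\<in>I. Bm $ i $ p i)) =
      F I + (if i0 \<in> I then t * F (I - {i0}) else 0)" for I
  proof (cases "i0 \<in> I")
    case False
    have "(\<Prod>i\<in>I. Bm $ i $ p i) = (\<Prod>i\<in>I. A $ i $ p i)" for p
      unfolding B using False by (intro prod.cong) auto
    then show ?thesis using False by (simp only: F_def) simp
  next
    case True
    have *: "(\<Prod>i\<in>I. Bm $ i $ p i) = (\<Prod>i\<in>I. A $ i $ p i) +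
        (if p i0 = i0 then t * (\<Prod>i\<in>I - {i0}. A $ i $ p i) else 0)" for p
    proof -
      have "(\<Prod>i\<in>I - {i0}. Bm $ i $ p i) = (\<Prod>i\<in>I - {i0}. A $ i $ p i)"
        unfolding B by (intro prod.cong) auto
      then show ?thesis
        using prod.remove[of I i0 "\<lambda>i. Bm $ i $ p i"] prod.remove[of I i0 "\<lambda>i. A $ i $ p i"] True
        by (simp add: B distrib_right)
    qed
    have "(\<Sum>p | p permutes I. of_int (sign p) * (\<Prod>i\<in>I. Bm $ i $ p i)) =
        F I + (\<Sum>p | p permutes I. if p i0 = i0 then t * (of_int (sign p) * (\<Prod>i\<in>I - {i0}. A $ i $ p i)) else 0)"
      unfolding * F_def sum.distrib[symmetric] by (intro sum.cong) (auto simp: distrib_left)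
    also have "(\<Sum>p | p permutes I. if p i0 = i0 then t * (of_int (sign p) * (\<Prod>i\<in>I - {i0}. A $ i $ p i)) else 0)
       = (\<Sum>p | p permutes (I - {i0}). t * (of_int (sign p) * (\<Prod>i\<in>I - {i0}. A $ i $ p i)))"
    proof (rule sum.mono_neutral_cong_right)
      show "finite {p. p permutes I}" by (simp add: finite_permutations)
      show "{p. p permutes I - {i0}} \<subseteq> {p. p permutes I}" by (auto intro: permutes_subset)
      show "\<forall>p\<in>{p. p permutes I} - {p. p permutes I - {i0}}.
          (if p i0 = i0 then t * (of_int (sign p) * (\<Prod>i\<in>I - {i0}. A $ i $ p i)) else 0) = 0"
        by (auto intro: permutes_superset)
    qed (auto simp: permutes_not_in)
    finally show ?thesis using True by (simp add: F_def sum_distrib_left)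
  qed
  have "msym (Suc k) Bm = msym (Suc k) A + (\<Sum>I | card I = Suc k. if i0 \<in> I then t * F (I - {i0}) else 0)"
    unfolding msym_def 1 sum.distrib by (simp add: F_def)
  also have "(\<Sum>I | card I = Suc k. if i0 \<in> I then t * F (I - {i0}) else 0) =
      (\<Sum>I | card I = k \<and> i0 \<notin> I. t * F I)"
  proof -
    have "(\<Sum>I | card I = Suc k. if i0 \<in> I then t * F (I - {i0}) else 0) =
        (\<Sum>I | card I = Suc k \<and> i0 \<in> I. t * F (I - {i0}))"
      by (intro sum.mono_neutral_cong_right) auto
    also have "\<dots> = (\<Sum>I | card I = k \<and> i0 \<notin> I. t * F I)"
      by (rule sum.reindex_bij_witness[where i = "insert i0" and j = "\<lambda>I. I - {i0}"]) (auto simp: insert_absorb)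
    finally show ?thesis .
  qed
  also have "\<dots> = t * msym k ?C"
  proof -
    have "F I = (\<Sum>p | p permutes I. of_int (sign p) * (\<Prod>i\<in>I. ?C $ i $ p i))" if "i0 \<notin> I" for I
      unfolding F_def
    proof (intro sum.cong refl arg_cong2[where f = "(*)"] prod.cong)
      fix p i assume "p \<in> {p. p permutes I}" "i \<in> I"
      then show "A $ i $ p i = ?C $ i $ p i" using that permutes_in_image[of p I i] by auto
    qed
    moreover have "(\<Sum>p | p permutes I. of_int (sign p) * (\<Prod>i\<in>I. ?C $ i $ p i)) = 0" if "i0 \<in> I" for I
    proof (intro sum.neutral ballI)
      fix p
      have "(\<Prod>i\<in>I. ?C $ i $ p i) = 0" using that by (intro prod_zero) auto
      then show "of_int (sign p) * (\<Prod>i\<in>I. ?C $ i $ p i) = 0" by simp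
    qed
    ultimately have "msym k ?C = (\<Sum>I | card I = k \<and> i0 \<notin> I. F I)"
      unfolding msym_def by (intro sum.mono_neutral_cong_right) auto
    then show ?thesis by (simp add: sum_distrib_left)
  qed
  finally show ?thesis by (simp add: Bm_def)
qed

text \<open>A rotation taking a coordinate vector to \<open>N\<close> reduces this to the diagonal
  case. The formula links order \<open>k + 1\<close> of the matrix with order \<open>k\<close> on a
  hyperplane: it yields both the cone condition for restrictions and positivity after adding a large
  multiple of the normal projection.\<close>

lemma msym_add_rank_one:
  fixes A :: "real ^ 'n ^ 'n"
  assumes N: "norm N = 1"
  shows "msym (Suc k) (A + t *\<^sub>R outer N N) = msym (Suc k) A + t * msym k (compress N A)"
proof -
  define i0 :: 'n where "i0 = undefined"
  define e :: "real ^ 'n" where "e = axis i0 1"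
  obtain f where f: "orthogonal_transformation f" "f e = N"
    using orthogonal_transformation_exists[of e N] N by (auto simp: e_def)
  define Q where "Q = matrix f"
  have Qe: "Q *v e = N" using f by (simp add: Q_def orthogonal_transformation_linear)
  have Q: "transpose Q ** Q = mat 1" "Q ** transpose Q = mat 1"
    using f(1) by (auto simp: Q_def orthogonal_transformation_matrix orthogonal_matrix_def)
  have "transpose Q *v N = e" unfolding Qe[symmetric] matrix_vector_mul_assoc Q by simp
  then have QN: "N v* Q = e" by simp
  define A' where "A' = transpose Q ** A ** Q"
  have QP: "transpose Q ** proj_mat N ** Q = proj_mat e"
    by (simp add: proj_mat_def matrix_diff_ldistrib matrix_diff_rdistrib outer_mult_left outer_mult_right QN Q)
  have "transpose Q ** (A + t *\<^sub>R outer N N) ** Q = A' + t *\<^sub>R outer e e"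
    by (simp add: A'_def matrix_add_ldistrib matrix_add_rdistrib outer_mult_left outer_mult_right QN
        matrix_scaleR_left matrix_scaleR_right)
  then have "msym (Suc k) (A + t *\<^sub>R outer N N) = msym (Suc k) (A' + t *\<^sub>R outer e e)"
    using msym_similar[OF Q(1)] by metis
  also have "\<dots> = msym (Suc k) A' + t * msym k (\<chi> i j. if i = i0 \<or> j = i0 then 0 else A' $ i $ j)"
    unfolding e_def by (rule msym_add_axis)
  also have "(\<chi> i j. if i = i0 \<or> j = i0 then 0 else A' $ i $ j) = compress e A'"
  proof -
    have pe: "proj_mat e = (\<chi> i j. if i = j \<and> i \<noteq> i0 then 1 else 0)"
      by (auto simp: proj_mat_def outer_def e_def axis_def mat_def vec_eq_iff)
    have 1: "(proj_mat e ** M) $ i $ j = (if i = i0 then 0 else M $ i $ j)" for i j and M :: "real ^ 'n ^ 'n"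
    proof -
      have "(proj_mat e ** M) $ i $ j = (\<Sum>l\<in>UNIV. if l = i then (if i = i0 then 0 else M $ i $ j) else 0)"
        unfolding pe matrix_matrix_mult_def vec_lambda_beta by (intro sum.cong) auto
      then show ?thesis by simp
    qed
    have 2: "(M ** proj_mat e) $ i $ j = (if j = i0 then 0 else M $ i $ j)" for i j and M :: "real ^ 'n ^ 'n"
    proof -
      have "(M ** proj_mat e) $ i $ j = (\<Sum>l\<in>UNIV. if l = j then (if j = i0 then 0 else M $ i $ j) else 0)"
        unfolding pe matrix_matrix_mult_def vec_lambda_beta by (intro sum.cong) auto
      then show ?thesis by simp
    qed
    show ?thesis by (auto simp: vec_eq_iff compress_def 1 2)
  qed
  also have "msym k (compress e A') = msym k (transpose Q ** compress N A ** Q)"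
  proof -
    have "transpose Q ** compress N A ** Q =
       transpose Q ** proj_mat N ** (Q ** transpose Q) ** A ** (Q ** transpose Q) ** proj_mat N ** Q"
      by (simp add: Q compress_def matrix_mul_assoc)
    also have "\<dots> = (transpose Q ** proj_mat N ** Q) ** A' ** (transpose Q ** proj_mat N ** Q)"
      by (simp add: A'_def matrix_mul_assoc)
    finally show ?thesis by (simp add: QP compress_def)
  qed
  also have "\<dots> = msym k (compress N A)" by (rule msym_similar[OF Q(1)])
  also have "msym (Suc k) A' = msym (Suc k) A" unfolding A'_def by (rule msym_similar[OF Q(1)])
  finally show ?thesis .
qed

section \<open>Hyperbolicity\<close>

subsection \<open>Polynomials with roots in a half plane\<close>

lemma complex_poly_root:
  fixes p :: "complex poly"
  assumes "0 < degree p"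
  obtains z where "poly p z = 0"
proof -
  have "degree p \<in> {1..degree p}" "coeff p (degree p) \<noteq> 0" using assms by auto
  then show ?thesis
    using that fundamental_theorem_of_algebra[of "coeff p" "degree p"] unfolding poly_altdef by blast
qed

definition lower_roots :: "complex poly \<Rightarrow> bool" where
  "lower_roots p \<longleftrightarrow> p \<noteq> 0 \<and> (\<forall>z. poly p z = 0 \<longrightarrow> Im z < 0)"

lemma lower_roots_induct [consumes 1, case_names const step]:
  fixes p :: "complex poly"
  assumes "lower_roots p"
    and const: "\<And>c. c \<noteq> 0 \<Longrightarrow> P [:c:]"
    and step: "\<And>r q. Im r < 0 \<Longrightarrow> lower_roots q \<Longrightarrow> P q \<Longrightarrow> P ([:- r, 1:] * q)"
  shows "P p"
  using assms(1)
proof (induction "degree p" arbitrary: p)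
  case 0
  then show ?case using const by (metis degree_eq_zeroE lower_roots_def pCons_0_0)
next
  case (Suc d)
  then obtain r where r: "poly p r = 0" using complex_poly_root[of p] by auto
  then obtain q where q: "p = [:- r, 1:] * q" by (auto simp: poly_eq_0_iff_dvd elim: dvdE)
  have q0: "q \<noteq> 0" using Suc.prems q by (auto simp: lower_roots_def)
  then have "degree p = Suc (degree q)" unfolding q by (subst degree_mult_eq) auto
  then have dq: "d = degree q" using Suc.hyps(2) by simp
  have lq: "lower_roots q" using Suc.prems q0 by (auto simp: lower_roots_def q)
  have "Im r < 0" using Suc.prems r by (auto simp: lower_roots_def)
  then show ?case unfolding q by (rule step[OF _ lq Suc.hyps(1)[OF dq lq]])
qed

text \<open>The logarithmic derivative is the sum of \<open>1 / (z - r)\<close> over the roots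
  \<open>r\<close>, and each summand has negative imaginary part because \<open>z\<close> lies above
  \<open>r\<close>.\<close>

lemma Gauss_Lucas_half_plane:
  fixes p :: "complex poly"
  assumes "lower_roots p" "0 < degree p" "0 \<le> Im z"
  shows "Im (poly (pderiv p) z / poly p z) < 0"
  using assms(1,2)
proof (induction p rule: lower_roots_induct)
  case (step r q)
  have zr: "z - r \<noteq> 0" "0 < Im (z - r)" using step(1) assms(3) by auto
  have qz: "poly q z \<noteq> 0" using step(2) assms(3) by (force simp: lower_roots_def)
  have "poly (pderiv ([:- r, 1:] * q)) z / poly ([:- r, 1:] * q) z =
      1 / (z - r) + poly (pderiv q) z / poly q z"
    unfolding pderiv_mult using zr(1) qz by (simp add: pderiv_pCons field_simps)
  moreover have "Im (1 / (z - r)) < 0" using zr by (auto simp: Im_divide intro!: divide_neg_pos add_nonneg_pos)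
  moreover have "Im (poly (pderiv q) z / poly q z) \<le> 0"
  proof (cases "degree q = 0")
    case True
    then have "pderiv q = 0" by (simp add: pderiv_eq_0_iff)
    then show ?thesis by simp
  next
    case False
    then show ?thesis using step.IH by simp
  qed
  ultimately show ?case by simp
qed auto

text \<open>By Gauss-Lucas the derivatives again have their roots in the open lower half plane, so
  none of them vanishes at \<open>0\<close>; up to factorials these values are the
  coefficients.\<close>

lemma coeff_nonzero_half_plane:
  fixes p :: "complex poly"
  assumes "lower_roots p" "j \<le> degree p"
  shows "coeff p j \<noteq> 0"
  using assms
proof (induction j arbitrary: p)
  case 0
  have "poly p 0 \<noteq> 0" using 0 by (auto simp: lower_roots_def)
  then show ?case by (simp add: poly_0_coeff_0)
next
  case (Suc j)
  have d: "0 < degree p" using Suc.prems by simp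
  then have "pderiv p \<noteq> 0" by (simp add: pderiv_eq_0_iff)
  moreover have "Im z < 0" if "poly (pderiv p) z = 0" for z
    using Gauss_Lucas_half_plane[OF Suc.prems(1) d, of z] that by force
  ultimately have "coeff (pderiv p) j \<noteq> 0"
    using Suc.prems(2) by (intro Suc.IH) (auto simp: degree_pderiv lower_roots_def)
  then show ?case by (simp add: coeff_pderiv)
qed

text \<open>Every root is at distance at least \<open>Im t\<close> from \<open>t\<close>. The bound
  depends on \<open>p\<close> only through its degree and leading coefficient, so it survives the
  limit in \<open>root_homotopy\<close>.\<close>

lemma norm_poly_half_plane:
  fixes p :: "complex poly"
  assumes "lower_roots p" "0 \<le> Im t"
  shows "norm (lead_coeff p) * Im t ^ degree p \<le> norm (poly p t)"
  using assms(1)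
proof (induction p rule: lower_roots_induct)
  case (step r q)
  have "Im t \<le> norm (t - r)" using abs_Im_le_cmod[of "t - r"] step(1) by simp
  then have "Im t * (norm (lead_coeff q) * Im t ^ degree q) \<le> norm (t - r) * norm (poly q t)"
    using step.IH assms(2) by (intro mult_mono) auto
  moreover have "q \<noteq> 0" using step(2) by (simp add: lower_roots_def)
  then have "degree ([:- r, 1:] * q) = Suc (degree q)" by (subst degree_mult_eq) auto
  moreover have "lead_coeff ([:- r, 1:] * q) = lead_coeff q" unfolding lead_coeff_mult by simp
  moreover have "norm (poly ([:- r, 1:] * q) t) = norm (t - r) * norm (poly q t)"
    unfolding poly_mult norm_mult by simp
  ultimately show ?case by (simp only: power_Suc mult.assoc mult.left_commute mult.commute)
qed auto

text \<open>Induction on the degree: a factor \<open>[:a, 1:]\<close> with \<open>a > 0\<close>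
  preserves positivity of all coefficients.\<close>

lemma coeff_pos_of_negative_roots:
  fixes f :: "real poly"
  assumes "0 < lead_coeff f" "\<And>z. poly (map_poly complex_of_real f) z = 0 \<Longrightarrow> z \<in> \<real> \<and> Re z < 0" "i \<le> degree f"
  shows "0 < coeff f i"
  using assms
proof (induction "degree f" arbitrary: f i)
  case 0
  then show ?case by auto
next
  case (Suc d)
  let ?F = "map_poly complex_of_real f"
  have "degree ?F = degree f" by (intro degree_map_poly) auto
  then obtain z where z: "poly ?F z = 0" using Suc.hyps(2) complex_poly_root[of ?F] by auto
  define a where "a = - Re z"
  have a: "a > 0" "z = complex_of_real (- a)" using Suc.prems(2)[OF z] by (auto simp: a_def elim: Reals_cases)
  have of_real_poly: "poly (map_poly complex_of_real g) (complex_of_real x) = complex_of_real (poly g x)" for g x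
    by (induction g) (auto simp: map_poly_pCons)
  have "poly f (- a) = 0" using z unfolding a(2) of_real_poly by simp
  then obtain g where g: "f = [:a, 1:] * g" by (auto simp: poly_eq_0_iff_dvd elim: dvdE)
  have g0: "g \<noteq> 0" using Suc.prems g by auto
  have deg: "degree f = Suc (degree g)" unfolding g using g0 by (subst degree_mult_eq) auto
  have lead: "lead_coeff f = lead_coeff g" unfolding g lead_coeff_mult by simp
  have "map_poly complex_of_real f = map_poly complex_of_real [:a, 1:] * map_poly complex_of_real g"
    unfolding g by (rule poly_eqI) (simp add: coeff_map_poly map_poly_pCons coeff_pCons split: nat.split)
  then have "poly ?F z = 0" if "poly (map_poly complex_of_real g) z = 0" for z
    using that by (metis mult_zero_right poly_mult)
  then have rg: "z \<in> \<real> \<and> Re z < 0" if "poly (map_poly complex_of_real g) z = 0" for z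
    using Suc.prems(2) that by blast
  have "d = degree g" using deg Suc.hyps(2) by simp
  moreover have "0 < lead_coeff g" using lead Suc.prems(1) by metis
  ultimately have pos: "0 < coeff g i" if "i \<le> degree g" for i
    using Suc.hyps(1) rg that by blast
  have "coeff f i = a * coeff g i + (case i of 0 \<Rightarrow> 0 | Suc j \<Rightarrow> coeff g j)"
    unfolding g by (auto simp: coeff_pCons split: nat.split)
  moreover have "i \<le> Suc (degree g)" using Suc.prems(3) deg by simp
  ultimately show ?case
  proof (cases "i = Suc (degree g)")
    case True
    then show ?thesis using \<open>coeff f i = _\<close> pos[of "degree g"] by (simp add: coeff_eq_0)
  next
    case False
    then have "i \<le> degree g" using \<open>i \<le> Suc _\<close> by simp
    then have "0 < a * coeff g i" "0 \<le> (case i of 0 \<Rightarrow> 0 | Suc j \<Rightarrow> coeff g j)"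
      using pos[of i] a(1) pos[of "i - 1"] by (auto split: nat.split)
    then show ?thesis using \<open>coeff f i = _\<close> by linarith
  qed
qed

subsection \<open>Complex pencils\<close>

definition mscale :: "'a::comm_ring_1 \<Rightarrow> 'a ^ 'n ^ 'n \<Rightarrow> 'a ^ 'n ^ 'n" where
  "mscale z M = (\<chi> i j. z * M $ i $ j)"

definition cmat :: "real ^ 'n ^ 'n \<Rightarrow> complex ^ 'n ^ 'n" where
  "cmat A = (\<chi> i j. complex_of_real (A $ i $ j))"

text \<open>The complex matrix \<open>X + \<i> Y\<close>.\<close>

definition cpair :: "real ^ 'n ^ 'n \<Rightarrow> real ^ 'n ^ 'n \<Rightarrow> complex ^ 'n ^ 'n" where
  "cpair X Y = cmat X + mscale \<i> (cmat Y)"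

lemma mscale_nth [simp]: "mscale z M $ i $ j = z * M $ i $ j"
  by (simp add: mscale_def)

lemma cmat_nth [simp]: "cmat A $ i $ j = complex_of_real (A $ i $ j)"
  by (simp add: cmat_def)

lemma cpair_nth [simp]: "cpair X Y $ i $ j = Complex (X $ i $ j) (Y $ i $ j)"
  by (simp add: cpair_def complex_eq_iff)

lemma msym_mscale: "msym k (mscale c A) = c ^ k * msym k A"
  unfolding mscale_def by (rule msym_scale)

lemma msym_scaleR: "msym k (c *\<^sub>R A) = c ^ k * msym k (A :: real ^ 'n ^ 'n)"
proof -
  have "c *\<^sub>R A = mscale c A" by (simp add: vec_eq_iff)
  then show ?thesis by (simp add: msym_mscale)
qed

lemma msym_cmat: "msym k (cmat A) = complex_of_real (msym k A)"
  by (simp add: msym_def)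

lemma msym_cnj: "msym k (\<chi> i j. cnj (M $ i $ j)) = cnj (msym k M)"
  by (simp add: msym_def)

lemma continuous_on_msym:
  fixes f :: "'b::topological_space \<Rightarrow> 'a::{comm_ring_1,real_normed_field} ^ 'n ^ 'n"
  assumes "continuous_on S f"
  shows "continuous_on S (\<lambda>x. msym k (f x))"
  unfolding msym_def by (intro continuous_intros assms)

lemma continuous_on_mscale:
  fixes f :: "'b::topological_space \<Rightarrow> 'a::{comm_ring_1,real_normed_field} ^ 'n ^ 'n"
  assumes "continuous_on S c" "continuous_on S f"
  shows "continuous_on S (\<lambda>x. mscale (c x) (f x))"
  unfolding mscale_def by (intro continuous_intros assms)

lemma prod_linear_poly:
  fixes a b :: "'i \<Rightarrow> 'a::comm_ring_1"
  assumes "finite I"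
  shows "degree (\<Prod>i\<in>I. [:a i, b i:]) \<le> card I \<and> coeff (\<Prod>i\<in>I. [:a i, b i:]) (card I) = (\<Prod>i\<in>I. b i)"
  using assms
proof (induction I rule: finite_induct)
  case (insert x F)
  let ?q = "\<Prod>i\<in>F. [:a i, b i:]"
  have "degree ([:a x, b x:] * ?q) \<le> Suc (card F)"
    using insert.IH degree_mult_le[of "[:a x, b x:]" ?q] by (auto intro: order_trans)
  moreover have "coeff ([:a x, b x:] * ?q) (Suc (card F)) = b x * coeff ?q (card F)"
    using insert.IH by (simp add: coeff_eq_0)
  ultimately show ?case using insert by simp
qed auto

lemma msym_pencil_poly:
  fixes A B :: "'a::{comm_ring_1} ^ 'n ^ 'n"
  obtains p where "\<And>t. poly p t = msym k (A + mscale t B)" "degree p \<le> k" "coeff p k = msym k B"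
proof -
  define p where "p = (\<Sum>I | card I = k. \<Sum>q | q permutes I. smult (of_int (sign q)) (\<Prod>i\<in>I. [:A $ i $ q i, B $ i $ q i:]))"
  have "poly p t = msym k (A + mscale t B)" for t
    by (simp add: p_def msym_def poly_sum poly_prod mult.commute)
  moreover have "degree p \<le> k"
    unfolding p_def using prod_linear_poly[of _ "\<lambda>i. A $ i $ _ i" "\<lambda>i. B $ i $ _ i"]
    by (intro degree_sum_le) (auto intro!: degree_sum_le order_trans[OF degree_smult_le] simp: finite_permutations)
  moreover have "coeff p k = msym k B"
    unfolding p_def msym_def coeff_sum coeff_smult
    by (intro sum.cong refl arg_cong2[where f = "(*)"]) (auto simp: prod_linear_poly)
  ultimately show ?thesis using that by blast
qed

text \<open>Roots move continuously, so without real roots they cannot leave the lower half plane.\<close>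

lemma root_homotopy:
  fixes Z :: "real \<Rightarrow> complex ^ 'n ^ 'n"
  assumes cont: "continuous_on {0..1} Z" and B: "msym k B \<noteq> 0"
    and nreal: "\<And>d t. d \<in> {0..1} \<Longrightarrow> msym k (Z d + mscale (complex_of_real t) B) \<noteq> 0"
    and init: "\<And>t. msym k (Z 0 + mscale t B) = 0 \<Longrightarrow> Im t < 0"
    and root: "msym k (Z 1 + mscale t B) = 0"
  shows "Im t < 0"
proof (rule ccontr)
  assume t: "\<not> Im t < 0"
  define G where "G = (\<lambda>(d, s). msym k (mscale s (Z d) + B))"
  define g where "g = (\<lambda>(d, t). msym k (Z d + mscale t B))"
  have contG: "continuous_on ({0..1} \<times> UNIV) G"
    unfolding G_def case_prod_unfold
    by (intro continuous_on_msym continuous_on_add continuous_on_mscale continuous_on_const continuous_on_snd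
        continuous_on_id continuous_on_compose2[OF cont continuous_on_fst]) auto
  have contg: "continuous_on ({0..1} \<times> UNIV) g"
    unfolding g_def case_prod_unfold
    by (intro continuous_on_msym continuous_on_add continuous_on_mscale continuous_on_const continuous_on_snd
        continuous_on_id continuous_on_compose2[OF cont continuous_on_fst]) auto
  \<comment> \<open>Roots near infinity correspond, under \<open>s = 1 / t\<close>, to zeros of
    \<open>G\<close> near \<open>s = 0\<close>, where \<open>G\<close> is \<open>msym k B\<close>.
    Compactness keeps such zeros away from \<open>0\<close> uniformly in \<open>d\<close>, so the
    roots stay bounded.\<close>
  have "\<exists>e>0. \<forall>d\<in>{0..1}. \<forall>s. norm s < e \<longrightarrow> G (d, s) \<noteq> 0"
  proof -
    define K where "K = {x \<in> {0..1} \<times> cball 0 1. G x = 0}"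
    have "continuous_on ({0..1} \<times> cball 0 1) G" using contG by (rule continuous_on_subset) auto
    then have "closed K" unfolding K_def
      by (intro continuous_closed_preimage_constant closed_Times) auto
    moreover have "bounded K" unfolding K_def
      by (rule bounded_subset[of "{0..1} \<times> cball 0 1"]) (auto intro: bounded_Times)
    ultimately have "compact K" by (simp add: compact_eq_bounded_closed)
    show ?thesis
    proof (cases "K = {}")
      case True
      then show ?thesis by (intro exI[of _ 1]) (auto simp: K_def)
    next
      case False
      obtain x where x: "x \<in> K" "\<And>y. y \<in> K \<Longrightarrow> norm (snd x) \<le> norm (snd y)"
        using continuous_attains_inf[OF \<open>compact K\<close> False, of "\<lambda>y. norm (snd y)"]
          continuous_on_norm[OF continuous_on_snd[OF continuous_on_id]] by blast
      have "mscale 0 M + B = B" for M by (simp add: vec_eq_iff)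
      then have "snd x \<noteq> 0" using x(1) B by (auto simp: K_def G_def case_prod_unfold)
      moreover have "min 1 (norm (snd x)) \<le> norm s" if "d \<in> {0..1}" "G (d, s) = 0" for d s
        using x(2)[of "(d, s)"] that by (cases "norm s \<le> 1") (auto simp: K_def)
      ultimately show ?thesis by (intro exI[of _ "min 1 (norm (snd x))"]) force
    qed
  qed
  then obtain e where e: "e > 0" "\<And>d s. d \<in> {0..1} \<Longrightarrow> norm s < e \<Longrightarrow> G (d, s) \<noteq> 0" by blast
  have bound: "norm t \<le> 1 / e" if "d \<in> {0..1}" "g (d, t) = 0" for d t
  proof (rule ccontr)
    assume "\<not> norm t \<le> 1 / e"
    then have nt: "1 / e < norm t" by simp
    moreover have "0 < 1 / e" using e(1) by simp
    ultimately have "0 < norm t" by linarith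
    with nt e(1) have t: "norm (1 / t) < e" "t \<noteq> 0" by (auto simp: norm_divide divide_simps mult.commute)
    have "Z d + mscale t B = mscale t (mscale (1 / t) (Z d) + B)" using t(2) by (simp add: vec_eq_iff distrib_left)
    then have "g (d, t) = t ^ k * G (d, 1 / t)" by (simp add: g_def G_def msym_mscale)
    then show False using that t e(2)[OF that(1) t(1)] by simp
  qed
  \<comment> \<open>The roots in the closed upper half plane form a compact set; its point with the
    smallest parameter is the first moment at which a root gets there.\<close>
  define S where "S = {x \<in> {0..1} \<times> (cball 0 (1 / e) \<inter> {z. 0 \<le> Im z}). g x = 0}"
  have closedIm: "closed {z. 0 \<le> Im z}" by (intro closed_Collect_le continuous_intros)
  have "continuous_on ({0..1} \<times> (cball 0 (1 / e) \<inter> {z. 0 \<le> Im z})) g"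
    using contg by (rule continuous_on_subset) auto
  then have "closed S" unfolding S_def
    by (intro continuous_closed_preimage_constant closed_Times closed_Int closedIm) auto
  moreover have "bounded S" unfolding S_def
    by (rule bounded_subset[of "{0..1} \<times> cball 0 (1 / e)"]) (auto intro: bounded_Times)
  ultimately have "compact S" by (simp add: compact_eq_bounded_closed)
  moreover have "(1, t) \<in> S" using t root bound[of 1 t] by (auto simp: S_def g_def)
  ultimately obtain x where x: "x \<in> S" "\<And>y. y \<in> S \<Longrightarrow> fst x \<le> fst y"
    using continuous_attains_inf[of S fst] by (force intro: continuous_intros)
  define d0 t0 where "d0 = fst x" and "t0 = snd x"
  have x': "d0 \<in> {0..1}" "g (d0, t0) = 0" "0 \<le> Im t0" using x(1) by (auto simp: S_def d0_def t0_def)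
  have "Im t0 \<noteq> 0"
  proof
    assume "Im t0 = 0"
    then have "t0 = complex_of_real (Re t0)" by (simp add: complex_eq_iff)
    then show False using nreal[OF x'(1), of "Re t0"] x'(2) by (simp add: g_def)
  qed
  then have im: "0 < Im t0" using x'(3) by simp
  have "d0 \<noteq> 0" using init[of t0] x' by (auto simp: g_def)
  then have d0: "0 < d0" "d0 \<le> 1" using x'(1) by auto
  define c where "c = norm (msym k B) * Im t0 ^ k"
  have c: "c > 0" using B im by (simp add: c_def)
  \<comment> \<open>Before \<open>d0\<close> all roots are below the real axis, so the value at
    \<open>t0\<close> is bounded below by the same \<open>c\<close>; by continuity it cannot vanish
    at \<open>d0\<close>.\<close>
  have low: "c \<le> norm (g (d, t0))" if d: "0 \<le> d" "d < d0" for d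
  proof -
    obtain p where p: "\<And>t. poly p t = msym k (Z d + mscale t B)" "degree p \<le> k" "coeff p k = msym k B"
      using msym_pencil_poly[where k = k and A = "Z d" and B = B] by blast
    have deg: "degree p = k" using p(2,3) B le_degree[of p k] by auto
    have lower: "Im z < 0" if "poly p z = 0" for z
    proof (rule ccontr)
      assume "\<not> Im z < 0"
      moreover have "g (d, z) = 0" using that p(1) by (simp add: g_def)
      ultimately have "(d, z) \<in> S" using bound[of d z] d d0 by (auto simp: S_def)
      then show False using x(2)[of "(d, z)"] d by (simp add: d0_def)
    qed
    have "p \<noteq> 0" using B p(3) by auto
    with lower have "norm (lead_coeff p) * Im t0 ^ degree p \<le> norm (poly p t0)"
      using im by (intro norm_poly_half_plane) (auto simp: lower_roots_def)
    then show ?thesis by (simp add: deg p c_def g_def)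
  qed
  have "continuous_on {0..1} (\<lambda>d. norm (g (d, t0)))"
    by (intro continuous_on_norm continuous_on_compose2[OF contg] continuous_intros) auto
  then obtain \<delta> where \<delta>: "\<delta> > 0" "\<And>d. d \<in> {0..1} \<Longrightarrow> dist d d0 < \<delta> \<Longrightarrow> dist (norm (g (d, t0))) (norm (g (d0, t0))) < c"
    using x'(1) c unfolding continuous_on_iff by metis
  define d where "d = max 0 (d0 - \<delta> / 2)"
  have "0 \<le> d" "d < d0" "dist d d0 < \<delta>" "d \<in> {0..1}" using d0 \<delta>(1) by (auto simp: d_def dist_real_def max_def)
  with low[of d] \<delta>(2)[of d] x'(2) show False by simp
qed

subsection \<open>Garding cones\<close>

text \<open>\<open>open_cone\<close> and \<open>closed_cone\<close> are the sets of symmetric matrices whose eigenvalue vector lies in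
  the interior of \<open>\<Gamma>\<^sub>k\<close> and in \<open>\<Gamma>\<^sub>k\<close>.\<close>

definition open_cone :: "nat \<Rightarrow> (real ^ 'n ^ 'n) set" where
  "open_cone k = {A. transpose A = A \<and> (\<forall>j\<in>{1..k}. 0 < msym j A)}"

definition closed_cone :: "nat \<Rightarrow> (real ^ 'n ^ 'n) set" where
  "closed_cone k = {A. transpose A = A \<and> (\<forall>j\<in>{1..k}. 0 \<le> msym j A)}"

lemma msym_diagonal:
  fixes d :: "'n::finite \<Rightarrow> 'a::{idom,real_normed_div_algebra}"
  shows "msym k (\<chi> i j. if i = j then d i else 0) = (\<Sum>I | card I = k. \<Prod>i\<in>I. d i)"
proof -
  have "{I :: 'n set. card I = k} = {}" if "CARD('n) < k"
    using that by (metis (mono_tags, lifting) card_mono finite mem_Collect_eq not_less subset_UNIV empty_Collect_eq)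
  moreover have "msym k (\<chi> i j. if i = j then d i else 0) = (\<Sum>I | card I = k. \<Prod>i\<in>I. d i)" if "k \<le> CARD('n)"
  proof (rule msym_eq_coeff[OF _ that])
    fix s
    have "det (id_plus s (\<chi> i j. if i = j then d i else 0)) = (\<Prod>i\<in>UNIV. d i * s + 1)"
      by (simp add: det_id_plus_diagonal add.commute)
    also have "\<dots> = (\<Sum>I\<in>UNIV. \<Prod>i\<in>I. d i * s)" by (subst prod_add) auto
    also have "\<dots> = (\<Sum>k\<le>CARD('n). (\<Sum>I | card I = k. \<Prod>i\<in>I. d i) * s ^ k)"
      unfolding sum_card_split sum_distrib_right by (intro sum.cong) (auto simp: prod.distrib)
    finally show "det (id_plus s (\<chi> i j. if i = j then d i else 0)) =
        (\<Sum>k\<le>CARD('n). (\<Sum>I | card I = k. \<Prod>i\<in>I. d i) * s ^ k)" .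
  qed
  ultimately show ?thesis by (cases "k \<le> CARD('n)") (auto simp: msym_gt_card)
qed

lemma sum_diff_binomial_reindex:
  fixes m :: "nat \<Rightarrow> real"
  shows "(\<Sum>i\<le>n. m i * s ^ i * (1 + e * s) ^ (n - i)) =
    (\<Sum>j\<le>n. (\<Sum>i\<le>j. real ((n - i) choose (j - i)) * e ^ (j - i) * m i) * s ^ j)"
proof -
  have "(\<Sum>i\<le>n. m i * s ^ i * (1 + e * s) ^ (n - i)) =
      (\<Sum>i\<le>n. \<Sum>l\<le>n - i. m i * s ^ i * (real ((n - i) choose l) * (e * s) ^ l))"
    using binomial_ring[of "e * s" 1] by (simp add: add.commute sum_distrib_left)
  also have "\<dots> = (\<Sum>(i, l)\<in>{(i, j). i + j \<le> n}. m i * s ^ i * (real ((n - i) choose l) * (e * s) ^ l))"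
    by (subst sum.Sigma) (auto intro!: sum.cong)
  also have "\<dots> = (\<Sum>j\<le>n. \<Sum>i\<le>j. m i * s ^ i * (real ((n - i) choose (j - i)) * (e * s) ^ (j - i)))"
    by (rule sum.triangle_reindex_eq)
  also have "\<dots> = (\<Sum>j\<le>n. (\<Sum>i\<le>j. real ((n - i) choose (j - i)) * e ^ (j - i) * m i) * s ^ j)"
    unfolding sum_distrib_right
  proof (intro sum.cong refl)
    fix j i :: nat assume "i \<in> {..j}"
    then have "s ^ j = s ^ i * s ^ (j - i)" by (simp add: power_add[symmetric])
    then show "m i * s ^ i * (real ((n - i) choose (j - i)) * (e * s) ^ (j - i)) =
        real ((n - i) choose (j - i)) * e ^ (j - i) * m i * s ^ j"
      by (simp add: power_mult_distrib)
  qed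
  finally show ?thesis .
qed

text \<open>In an eigenbasis the determinant is the product of the factors
  \<open>d i * s + (1 + e * s)\<close>; expanding according to the set of factors that contribute
  \<open>d i\<close> gives the binomial weights.\<close>

lemma msym_shift:
  fixes A :: "real ^ 'n ^ 'n"
  assumes sym: "transpose A = A" and j: "j \<le> CARD('n)"
  shows "msym j (A + e *\<^sub>R mat 1) = (\<Sum>i\<le>j. real ((CARD('n) - i) choose (j - i)) * e ^ (j - i) * msym i A)"
proof -
  obtain Q :: "real ^ 'n ^ 'n" and d where Q: "transpose Q ** Q = mat 1" "Q ** transpose Q = mat 1"
    and A: "A = Q ** (\<chi> i j. if i = j then d i else 0) ** transpose Q"
    using symmetric_diagonalizable[OF sym] by blast
  have "A + e *\<^sub>R mat 1 = Q ** ((\<chi> i j. if i = j then d i else 0) + e *\<^sub>R mat 1) ** transpose Q"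
    by (simp add: A matrix_add_ldistrib matrix_add_rdistrib matrix_scaleR_left matrix_scaleR_right Q)
  also have "(\<chi> i j. if i = j then d i else 0) + e *\<^sub>R mat 1 = (\<chi> i j. if i = j then d i + e else 0)"
    by (simp add: vec_eq_iff mat_def)
  finally have Ae: "A + e *\<^sub>R mat 1 = Q ** (\<chi> i j. if i = j then d i + e else 0) ** transpose Q" .
  show ?thesis
  proof (rule msym_eq_coeff[OF _ j])
    fix s
    have "(\<Sum>k\<le>CARD('n). msym k (A + e *\<^sub>R mat 1) * s ^ k) =
      (\<Sum>k\<le>CARD('n). msym k (\<chi> i j. if i = j then d i + e else (0 :: real)) * s ^ k)"
      unfolding Ae by (simp add: msym_similar[OF Q(2)])
    then have "det (id_plus s (A + e *\<^sub>R mat 1)) = (\<Prod>i\<in>UNIV. d i * s + (1 + e * s))"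
      unfolding det_id_plus[symmetric] by (simp add: det_id_plus_diagonal algebra_simps)
    also have "\<dots> = (\<Sum>I\<in>UNIV. (\<Prod>i\<in>I. d i * s) * (\<Prod>i\<in>UNIV - I. 1 + e * s))"
      by (subst prod_add) auto
    also have "\<dots> = (\<Sum>k\<le>CARD('n). (\<Sum>I | card I = k. \<Prod>i\<in>I. d i) * s ^ k * (1 + e * s) ^ (CARD('n) - k))"
      unfolding sum_card_split sum_distrib_right
      by (intro sum.cong) (auto simp: prod.distrib card_Diff_subset)
    also have "\<dots> = (\<Sum>k\<le>CARD('n). msym k A * s ^ k * (1 + e * s) ^ (CARD('n) - k))"
      unfolding A by (simp add: msym_similar[OF Q(2)] msym_diagonal)
    finally show "det (id_plus s (A + e *\<^sub>R mat 1)) =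
      (\<Sum>j\<le>CARD('n). (\<Sum>i\<le>j. real ((CARD('n) - i) choose (j - i)) * e ^ (j - i) * msym i A) * s ^ j)"
      by (simp add: sum_diff_binomial_reindex)
  qed
qed

text \<open>On the cone all terms of the binomial expansion are nonnegative, so each is a lower
  bound. The term \<open>i = 0\<close> gives strict positivity, and \<open>i = m\<close> is what
  later compares order \<open>k\<close> with order \<open>m\<close>.\<close>

lemma msym_shift_lower_bound:
  fixes A :: "real ^ 'n ^ 'n"
  assumes A: "A \<in> closed_cone j" and j: "j \<le> CARD('n)" and "0 \<le> e" "i \<le> j"
  shows "real ((CARD('n) - i) choose (j - i)) * e ^ (j - i) * msym i A \<le> msym j (A + e *\<^sub>R mat 1)"
proof -
  have "0 \<le> msym l A" if "l \<le> j" for l using A that by (cases "l = 0") (auto simp: closed_cone_def)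
  then have "0 \<le> real ((CARD('n) - l) choose (j - l)) * e ^ (j - l) * msym l A" if "l \<le> j" for l
    using assms that by simp
  moreover have "transpose A = A" using A by (simp add: closed_cone_def)
  ultimately show ?thesis
    unfolding msym_shift[OF \<open>transpose A = A\<close> j] using assms(4)
    by (intro member_le_sum[of i "{..j}" "\<lambda>l. real ((CARD('n) - l) choose (j - l)) * e ^ (j - l) * msym l A"]) auto
qed

lemma closed_cone_mono: "j \<le> k \<Longrightarrow> closed_cone k \<subseteq> closed_cone j"
  by (auto simp: closed_cone_def)

lemma open_cone_subset_closed: "open_cone k \<subseteq> closed_cone k"
  by (auto simp: open_cone_def closed_cone_def less_imp_le)

lemma transpose_scaleR_mat: "transpose (e *\<^sub>R mat 1 :: real ^ 'n ^ 'n) = e *\<^sub>R mat 1"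
  by (simp add: transpose_scalar)

lemma closed_cone_shift:
  fixes A :: "real ^ 'n ^ 'n"
  assumes "A \<in> closed_cone k" "k \<le> CARD('n)" "0 < e"
  shows "A + e *\<^sub>R mat 1 \<in> open_cone k"
proof -
  have "0 < msym j (A + e *\<^sub>R mat 1)" if "j \<in> {1..k}" for j
  proof -
    have "A \<in> closed_cone j" "j \<le> CARD('n)" using that assms closed_cone_mono[of j k] by auto
    from msym_shift_lower_bound[OF this, of e 0] assms(3)
    have "real (CARD('n) choose j) * e ^ j \<le> msym j (A + e *\<^sub>R mat 1)" by simp
    moreover have "0 < real (CARD('n) choose j) * e ^ j" using \<open>j \<le> CARD('n)\<close> assms(3) by simp
    ultimately show ?thesis by linarith
  qed
  then show ?thesis using assms(1) by (auto simp: open_cone_def closed_cone_def transpose_add transpose_scaleR_mat)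
qed

lemma open_cone_shift_nonneg:
  fixes A :: "real ^ 'n ^ 'n"
  assumes "A \<in> open_cone k" "k \<le> CARD('n)" "0 \<le> e"
  shows "A + e *\<^sub>R mat 1 \<in> open_cone k"
  using assms closed_cone_shift[of A k e] open_cone_subset_closed by (cases "e = 0") auto

lemma open_cone_absorb:
  fixes A :: "real ^ 'n ^ 'n"
  assumes "A \<in> open_cone k"
  obtains e where "0 < e" "A - e *\<^sub>R mat 1 \<in> open_cone k"
proof -
  have "\<forall>\<^sub>F e in at_right 0. 0 < msym j (A - e *\<^sub>R mat 1)" if "j \<in> {1..k}" for j
  proof -
    have "continuous_on UNIV (\<lambda>e. msym j (A - e *\<^sub>R mat 1))"
      by (intro continuous_on_msym continuous_intros)
    then have "isCont (\<lambda>e. msym j (A - e *\<^sub>R mat 1)) 0"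
      by (simp add: continuous_on_eq_continuous_at)
    then have "((\<lambda>e. msym j (A - e *\<^sub>R mat 1)) \<longlongrightarrow> msym j A) (at 0)"
      by (simp add: isCont_def)
    then have "((\<lambda>e. msym j (A - e *\<^sub>R mat 1)) \<longlongrightarrow> msym j A) (at_right 0)"
      by (auto intro: filterlim_mono at_le)
    then show ?thesis using assms that by (intro order_tendstoD) (auto simp: open_cone_def)
  qed
  then have "\<forall>\<^sub>F e in at_right 0. \<forall>j\<in>{1..k}. 0 < msym j (A - e *\<^sub>R mat 1)"
    by (intro eventually_ball_finite) auto
  then have "\<forall>\<^sub>F e in at_right (0::real). 0 < e \<and> (\<forall>j\<in>{1..k}. 0 < msym j (A - e *\<^sub>R mat 1))"
    using eventually_at_right_less[of 0] by eventually_elim auto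
  then obtain e where "0 < e" "\<forall>j\<in>{1..k}. 0 < msym j (A - e *\<^sub>R mat 1)"
    by (metis (no_types, lifting) eventually_happens trivial_limit_at_right_real)
  then show ?thesis using that assms by (auto simp: open_cone_def transpose_diff transpose_scaleR_mat)
qed

text \<open>Hyperbolicity in the direction of the identity. The value is a coefficient of the
  product of the \<open>w + \<mu> i\<close>, whose roots have imaginary part \<open>- Im z\<close>;
  for \<open>0 < Im z\<close> no coefficient vanishes, and the other half plane follows by
  conjugation.\<close>

lemma msym_complex_shift_nonzero:
  fixes X :: "real ^ 'n ^ 'n"
  assumes sym: "transpose X = X" and k: "k \<le> CARD('n)" and z: "Im z \<noteq> 0"
  shows "msym k (cmat X + mscale z (mat 1)) \<noteq> 0"
proof -
  have upper: "msym k (cmat X + mscale z (mat 1)) \<noteq> 0" if z: "0 < Im z" for z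
  proof -
    obtain Q :: "real ^ 'n ^ 'n" and d where Q: "transpose Q ** Q = mat 1" "Q ** transpose Q = mat 1"
      and X: "X = Q ** (\<chi> i j. if i = j then d i else 0) ** transpose Q"
      using symmetric_diagonalizable[OF sym] by blast
    have cmat_mult: "cmat (A ** B) = cmat A ** cmat B" for A B :: "real ^ 'n ^ 'n"
      by (simp add: vec_eq_iff matrix_matrix_mult_def)
    have cmat_1: "cmat (mat 1 :: real ^ 'n ^ 'n) = mat 1" by (simp add: vec_eq_iff mat_def)
    have cQ: "cmat Q ** cmat (transpose Q) = mat 1" unfolding cmat_mult[symmetric] Q by (rule cmat_1)
    define \<mu> where "\<mu> i = complex_of_real (d i) + z" for i
    have ms: "mscale z (A ** B) = A ** mscale z B" for A B :: "complex ^ 'n ^ 'n"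
      by (simp add: vec_eq_iff matrix_matrix_mult_def sum_distrib_left mult_ac)
    have ms2: "mscale z (A ** B) = mscale z A ** B" for A B :: "complex ^ 'n ^ 'n"
      by (simp add: vec_eq_iff matrix_matrix_mult_def sum_distrib_left mult_ac)
    have "cmat X + mscale z (mat 1) = cmat Q ** (cmat (\<chi> i j. if i = j then d i else 0) + mscale z (mat 1)) ** cmat (transpose Q)"
    proof -
      have "mscale z (mat 1) = cmat Q ** mscale z (mat 1) ** cmat (transpose Q)"
        unfolding ms[symmetric] ms2[symmetric] matrix_mul_rid cQ ..
      then show ?thesis unfolding X cmat_mult by (simp add: matrix_add_ldistrib matrix_add_rdistrib)
    qed
    also have "cmat (\<chi> i j. if i = j then d i else 0) + mscale z (mat 1) = (\<chi> i j. if i = j then \<mu> i else 0)"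
      by (simp add: vec_eq_iff mat_def \<mu>_def)
    finally have eq: "msym k (cmat X + mscale z (mat 1)) = msym k (\<chi> i j. if i = j then \<mu> i else 0)"
      by (simp add: msym_similar[OF cQ])
    define f where "f = (\<Prod>i\<in>UNIV. [:\<mu> i, 1:])"
    have f0: "f \<noteq> 0" unfolding f_def by simp
    have "lower_roots f" unfolding lower_roots_def
    proof (intro conjI allI impI f0)
      fix w assume "poly f w = 0"
      then have "\<exists>i. w + \<mu> i = 0" by (auto simp: f_def poly_prod add.commute)
      then obtain i where "w = - \<mu> i" by (auto simp: eq_neg_iff_add_eq_0)
      then show "Im w < 0" using z by (simp add: \<mu>_def)
    qed
    moreover have deg: "degree f = CARD('n)" unfolding f_def by (subst degree_prod_sum_eq) auto
    ultimately have "coeff f (CARD('n) - k) \<noteq> 0" by (intro coeff_nonzero_half_plane) auto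
    moreover have "poly f w = (\<Sum>l\<le>CARD('n). (\<Sum>I | card I = l. \<Prod>i\<in>I. \<mu> i) * w ^ (CARD('n) - l))" for w
    proof -
      have "poly f w = (\<Prod>i\<in>UNIV. \<mu> i + w)" by (simp add: f_def poly_prod)
      also have "\<dots> = (\<Sum>I\<in>UNIV. (\<Prod>i\<in>I. \<mu> i) * w ^ card (UNIV - I))" by (subst prod_add) auto
      also have "\<dots> = (\<Sum>l\<le>CARD('n). (\<Sum>I | card I = l. \<Prod>i\<in>I. \<mu> i) * w ^ (CARD('n) - l))"
        unfolding sum_card_split sum_distrib_right by (intro sum.cong) (auto simp: card_Diff_subset)
      finally show ?thesis .
    qed
    then have "poly f w = poly (\<Sum>l\<le>CARD('n). monom (\<Sum>I | card I = l. \<Prod>i\<in>I. \<mu> i) (CARD('n) - l)) w" for w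
      by (simp add: poly_sum poly_monom)
    then have "f = (\<Sum>l\<le>CARD('n). monom (\<Sum>I | card I = l. \<Prod>i\<in>I. \<mu> i) (CARD('n) - l))"
      by (intro poly_eq_poly_eq_iff[THEN iffD1]) auto
    then have "coeff f (CARD('n) - k) = (\<Sum>l\<le>CARD('n). if l = k then (\<Sum>I | card I = l. \<Prod>i\<in>I. \<mu> i) else 0)"
      using k by (simp only: coeff_sum coeff_monom) (intro sum.cong, auto)
    ultimately show ?thesis using k by (simp add: eq msym_diagonal)
  qed
  show ?thesis
  proof (cases "0 < Im z")
    case False
    have "(\<chi> i j. cnj ((cmat X + mscale z (mat 1)) $ i $ j)) = cmat X + mscale (cnj z) (mat 1)"
      by (simp add: vec_eq_iff mat_def)
    then have "cnj (msym k (cmat X + mscale z (mat 1))) = msym k (cmat X + mscale (cnj z) (mat 1))"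
      by (metis msym_cnj)
    moreover have "msym k (cmat X + mscale (cnj z) (mat 1)) \<noteq> 0" using False z by (intro upper) auto
    ultimately show ?thesis by auto
  qed (rule upper)
qed

lemma cpair_axis_nonzero:
  fixes X :: "real ^ 'n ^ 'n"
  assumes "transpose X = X" "k \<le> CARD('n)" "s \<noteq> 0"
  shows "msym k (cpair X (s *\<^sub>R mat 1)) \<noteq> 0"
proof -
  have "cpair X (s *\<^sub>R mat 1) = cmat X + mscale (\<i> * complex_of_real s) (mat 1)"
    by (simp add: vec_eq_iff complex_eq_iff mat_def)
  then show ?thesis using msym_complex_shift_nonzero[OF assms(1,2), of "\<i> * complex_of_real s"] assms(3) by simp
qed

text \<open>The matrix is \<open>t\<close> times \<open>cmat B + mscale w (mat 1)\<close> with
  \<open>t * w = \<i> * s\<close>. Hyperbolicity makes \<open>w\<close> real, and the cone condition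
  on \<open>B\<close> makes it negative, which puts \<open>t\<close> on the negative imaginary
  axis.\<close>

lemma pencil_init_roots:
  fixes B :: "real ^ 'n ^ 'n"
  assumes B: "B \<in> open_cone k" and k: "k \<le> CARD('n)" and s: "0 < s"
    and root: "msym k (cpair 0 (s *\<^sub>R mat 1) + mscale t (cmat B)) = 0"
  shows "Im t < 0"
proof -
  have t0: "t \<noteq> 0"
  proof
    assume "t = 0"
    then have "cpair 0 (s *\<^sub>R mat 1) + mscale t (cmat B) = cpair 0 (s *\<^sub>R mat 1)" by (simp add: vec_eq_iff)
    then have "msym k (cpair (0 :: real ^ 'n ^ 'n) (s *\<^sub>R mat 1)) = 0" using root by simp
    moreover have "transpose (0 :: real ^ 'n ^ 'n) = 0" by (simp add: transpose_def vec_eq_iff)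
    ultimately show False using cpair_axis_nonzero[of "0 :: real ^ 'n ^ 'n" k s] k s by simp
  qed
  define w where "w = \<i> * complex_of_real s / t"
  have tw: "t * w = \<i> * complex_of_real s" using t0 by (simp add: w_def)
  have "cpair 0 (s *\<^sub>R mat 1) + mscale t (cmat B) = mscale t (cmat B + mscale w (mat 1))"
    by (auto simp: vec_eq_iff mat_def distrib_left tw Complex_eq)
  then have *: "msym k (cmat B + mscale w (mat 1)) = 0" using root t0 by (simp add: msym_mscale)
  have "transpose B = B" using B by (simp add: open_cone_def)
  then have "Im w = 0" using msym_complex_shift_nonzero[of B k w] * k by blast
  then have w: "w = complex_of_real (Re w)" by (simp add: complex_eq_iff)
  have "Re w < 0"
  proof (rule ccontr)
    assume "\<not> Re w < 0"
    then have "B + Re w *\<^sub>R mat 1 \<in> open_cone k" using B k by (intro open_cone_shift_nonneg) auto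
    then have "0 < msym k (B + Re w *\<^sub>R mat 1)" by (cases "k = 0") (auto simp: open_cone_def)
    moreover have "cmat (B + Re w *\<^sub>R mat 1) = cmat B + mscale w (mat 1)"
      using w by (simp add: vec_eq_iff mat_def)
    ultimately show False using * msym_cmat[of k "B + Re w *\<^sub>R mat 1"] by simp
  qed
  moreover have "Im t * Re w = s" using arg_cong[OF tw, of Im] \<open>Im w = 0\<close> by simp
  ultimately show ?thesis using s by (metis linorder_not_less mult_nonneg_nonpos2 not_less_iff_gr_or_eq mult.commute less_imp_le)
qed

lemma transpose_scale_add: "transpose A = A \<Longrightarrow> transpose B = B \<Longrightarrow> transpose (c *\<^sub>R A + d *\<^sub>R B) = c *\<^sub>R A + d *\<^sub>R (B :: real ^ 'n ^ 'n)"
  by (simp add: transpose_add transpose_scalar)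

lemma continuous_on_cpair:
  assumes "continuous_on S X" "continuous_on S Y"
  shows "continuous_on S (\<lambda>x. cpair (X x) (Y x))"
  unfolding cpair_def cmat_def mscale_def by (intro continuous_intros assms)

text \<open>Roots are followed from the pair \<open>0\<close>, \<open>s I\<close> to the pair
  \<open>X\<close>, \<open>s I + Y\<close>. At a real \<open>t\<close> the term \<open>t B\<close>
  is absorbed by the symmetric real part, so \<open>nz\<close> excludes real roots on the
  way.\<close>

lemma pencil_roots:
  fixes B X Y :: "real ^ 'n ^ 'n"
  assumes B: "B \<in> open_cone k" and k: "k \<le> CARD('n)" and s: "0 < s" and X: "transpose X = X"
    and nz: "\<And>X d. transpose X = X \<Longrightarrow> 0 \<le> d \<Longrightarrow> msym k (cpair X (s *\<^sub>R mat 1 + d *\<^sub>R Y)) \<noteq> 0"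
    and root: "msym k (cpair X (s *\<^sub>R mat 1 + Y) + mscale t (cmat B)) = 0"
  shows "Im t < 0"
proof (rule root_homotopy[where B = "cmat B" and k = k and Z = "\<lambda>d. cpair (d *\<^sub>R X) (s *\<^sub>R mat 1 + d *\<^sub>R Y)"])
  show "continuous_on {0..1} (\<lambda>d. cpair (d *\<^sub>R X) (s *\<^sub>R mat 1 + d *\<^sub>R Y))"
    by (intro continuous_on_cpair continuous_intros)
  have "0 < msym k B" using B by (cases "k = 0") (auto simp: open_cone_def)
  then show "msym k (cmat B) \<noteq> 0" by (simp add: msym_cmat)
  fix d t :: real assume d: "d \<in> {0..1}"
  have "cpair (d *\<^sub>R X) (s *\<^sub>R mat 1 + d *\<^sub>R Y) + mscale (complex_of_real t) (cmat B) =
      cpair (d *\<^sub>R X + t *\<^sub>R B) (s *\<^sub>R mat 1 + d *\<^sub>R Y)"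
    by (simp add: vec_eq_iff complex_eq_iff)
  moreover have "transpose (d *\<^sub>R X + t *\<^sub>R B) = d *\<^sub>R X + t *\<^sub>R B"
    using X B by (intro transpose_scale_add) (auto simp: open_cone_def)
  ultimately show "msym k (cpair (d *\<^sub>R X) (s *\<^sub>R mat 1 + d *\<^sub>R Y) + mscale (complex_of_real t) (cmat B)) \<noteq> 0"
    using nz d by simp
qed (use pencil_init_roots[OF B k s] root in auto)

text \<open>From here the admissible imaginary parts grow: first \<open>s I\<close>, then
  \<open>s I + c A\<close>, then \<open>c A + d B\<close>. Adding \<open>\<i> c A\<close> amounts to
  asking whether \<open>\<i> c\<close> is a root of the pencil in direction \<open>A\<close>, but
  all roots lie strictly below the real axis.\<close>

lemma cpair_one_nonzero:
  fixes A X :: "real ^ 'n ^ 'n"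
  assumes A: "A \<in> open_cone k" and k: "k \<le> CARD('n)" and s: "0 < s" and X: "transpose X = X" and c: "0 \<le> c"
  shows "msym k (cpair X (s *\<^sub>R mat 1 + c *\<^sub>R A)) \<noteq> 0"
proof
  assume "msym k (cpair X (s *\<^sub>R mat 1 + c *\<^sub>R A)) = 0"
  moreover have "cpair X (s *\<^sub>R mat 1 + c *\<^sub>R A) = cpair X (s *\<^sub>R mat 1 + 0) + mscale (\<i> * complex_of_real c) (cmat A)"
    by (simp add: vec_eq_iff complex_eq_iff)
  ultimately have "msym k (cpair X (s *\<^sub>R mat 1 + 0) + mscale (\<i> * complex_of_real c) (cmat A)) = 0" by simp
  from pencil_roots[OF A k s X _ this] cpair_axis_nonzero[OF _ k, of _ s] s c show False by auto
qed

text \<open>The interior point \<open>A\<close> dominates a small multiple of the identity, so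
  \<open>c A = c e I + c (A - e I)\<close> has the form treated before, and \<open>B\<close> is the
  direction of the new pencil.\<close>

lemma cpair_two_nonzero:
  fixes A B X :: "real ^ 'n ^ 'n"
  assumes A: "A \<in> open_cone k" and B: "B \<in> open_cone k" and k: "k \<le> CARD('n)"
    and X: "transpose X = X" and c: "0 < c" "0 \<le> d"
  shows "msym k (cpair X (c *\<^sub>R A + d *\<^sub>R B)) \<noteq> 0"
proof
  assume 0: "msym k (cpair X (c *\<^sub>R A + d *\<^sub>R B)) = 0"
  obtain e where e: "0 < e" "A - e *\<^sub>R mat 1 \<in> open_cone k" using open_cone_absorb[OF A] by blast
  define A' where "A' = A - e *\<^sub>R mat 1"
  have "cpair X (c *\<^sub>R A + d *\<^sub>R B) = cpair X ((c * e) *\<^sub>R mat 1 + c *\<^sub>R A') + mscale (\<i> * complex_of_real d) (cmat B)"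
    by (simp add: vec_eq_iff complex_eq_iff A'_def algebra_simps)
  with 0 have root: "msym k (cpair X ((c * e) *\<^sub>R mat 1 + c *\<^sub>R A') + mscale (\<i> * complex_of_real d) (cmat B)) = 0" by simp
  have ce: "0 < c * e" using c e by simp
  have "msym k (cpair X ((c * e) *\<^sub>R mat 1 + d' *\<^sub>R (c *\<^sub>R A'))) \<noteq> 0"
    if "transpose X = X" "0 \<le> d'" for X :: "real ^ 'n ^ 'n" and d'
    using cpair_one_nonzero[OF e(2)[folded A'_def] k ce that(1), of "d' * c"] that(2) c by simp
  then have "Im (\<i> * complex_of_real d) < 0" by (rule pencil_roots[OF B k ce X _ root])
  then show False using c by simp
qed

text \<open>A root off the real axis, or its conjugate, would give a singular matrix whose imaginary
  part is a positive multiple of \<open>A\<close>; a nonnegative root would give one that is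
  \<open>\<i>\<close> times \<open>B + z A\<close>. Here singular means \<open>msym k = 0\<close>,
  and \<open>cpair_two_nonzero\<close> excludes both.\<close>

lemma pencil_roots_negative:
  fixes A B :: "real ^ 'n ^ 'n"
  assumes A: "A \<in> open_cone k" and B: "B \<in> open_cone k" and k: "k \<le> CARD('n)"
    and root: "msym k (cmat B + mscale z (cmat A)) = 0"
  shows "z \<in> \<real> \<and> Re z < 0"
proof -
  have sym: "transpose A = A" "transpose B = B" using A B by (auto simp: open_cone_def)
  have tr: "transpose (B + t *\<^sub>R A) = B + t *\<^sub>R A" for t using sym by (simp add: transpose_add transpose_scalar)
  have up: "msym k (cmat B + mscale z (cmat A)) \<noteq> 0" if "0 < Im z" for z
  proof -
    have "cmat B + mscale z (cmat A) = cpair (B + Re z *\<^sub>R A) (Im z *\<^sub>R A + 0 *\<^sub>R B)"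
      by (simp add: vec_eq_iff complex_eq_iff)
    then show ?thesis using cpair_two_nonzero[OF A B k tr, of "Im z" 0 "Re z"] that by simp
  qed
  have "Im z = 0"
  proof (rule ccontr)
    assume "Im z \<noteq> 0"
    moreover have "(\<chi> i j. cnj ((cmat B + mscale z (cmat A)) $ i $ j)) = cmat B + mscale (cnj z) (cmat A)"
      by (simp add: vec_eq_iff)
    then have "msym k (cmat B + mscale (cnj z) (cmat A)) = 0" using root msym_cnj[of k "cmat B + mscale z (cmat A)"] by simp
    ultimately show False using up[of z] up[of "cnj z"] root by (cases "0 < Im z") auto
  qed
  moreover have "Re z < 0"
  proof (rule ccontr)
    assume "\<not> Re z < 0"
    then have "msym k (cpair 0 (1 *\<^sub>R B + Re z *\<^sub>R A)) \<noteq> 0"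
      by (intro cpair_two_nonzero[OF B A k]) (auto simp: transpose_def vec_eq_iff)
    moreover have "cpair 0 (1 *\<^sub>R B + Re z *\<^sub>R A) = mscale \<i> (cmat B + mscale z (cmat A))"
      using \<open>Im z = 0\<close> by (simp add: vec_eq_iff complex_eq_iff)
    ultimately show False using root by (simp add: msym_mscale)
  qed
  ultimately show ?thesis by (simp add: complex_is_Real_iff)
qed

text \<open>Both sides are polynomials in \<open>z\<close> that agree on the real line.\<close>

lemma map_poly_msym_pencil:
  fixes A B :: "real ^ 'n ^ 'n"
  assumes "\<And>t. poly f t = msym k (B + mscale t A)"
  shows "poly (map_poly complex_of_real f) z = msym k (cmat B + mscale z (cmat A))"
proof -
  obtain p where p: "\<And>t. poly p t = msym k (cmat B + mscale t (cmat A))"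
    using msym_pencil_poly[where k = k and A = "cmat B" and B = "cmat A"] by blast
  have of_real_poly: "poly (map_poly complex_of_real f) (complex_of_real x) = complex_of_real (poly f x)" for x
    by (induction f) (auto simp: map_poly_pCons)
  have "poly (map_poly complex_of_real f) (complex_of_real x) = poly p (complex_of_real x)" for x
  proof -
    have "cmat (B + mscale x A) = cmat B + mscale (complex_of_real x) (cmat A)" by (simp add: vec_eq_iff)
    then show ?thesis unfolding of_real_poly p assms by (metis msym_cmat)
  qed
  then have "range complex_of_real \<subseteq> {z. poly (map_poly complex_of_real f - p) z = 0}" by auto
  moreover have "infinite (range complex_of_real)"
    using infinite_UNIV_char_0 by (auto dest: finite_imageD simp: inj_on_def)
  ultimately have "map_poly complex_of_real f - p = 0" using poly_roots_finite finite_subset by blast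
  then show ?thesis using p by simp
qed

text \<open>As a polynomial in \<open>t\<close>, \<open>msym k (B + t A)\<close> has only negative
  roots and a positive leading coefficient, so its coefficients are nonnegative and its value at
  \<open>1\<close> is at least its value at \<open>0\<close>.\<close>

lemma open_cone_msym_add:
  fixes A B :: "real ^ 'n ^ 'n"
  assumes A: "A \<in> open_cone k" and B: "B \<in> open_cone k" and k: "k \<le> CARD('n)"
  shows "msym k B \<le> msym k (B + A)"
proof -
  obtain f where f: "\<And>t. poly f t = msym k (B + mscale t A)" "degree f \<le> k" "coeff f k = msym k A"
    using msym_pencil_poly[where k = k and A = B and B = A] by blast
  have "0 < msym k A" using A by (cases "k = 0") (auto simp: open_cone_def)
  moreover from this have "k \<le> degree f" using f(3) by (intro le_degree) simp
  ultimately have lead: "0 < lead_coeff f" using f(2,3) by (simp add: le_antisym)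
  have pos: "0 \<le> coeff f i" for i
  proof (cases "i \<le> degree f")
    case True
    then have "0 < coeff f i"
      using pencil_roots_negative[OF A B k] map_poly_msym_pencil[OF f(1)]
      by (intro coeff_pos_of_negative_roots[OF lead]) auto
    then show ?thesis by simp
  qed (simp add: coeff_eq_0)
  have "msym k B = coeff f 0"
    using f(1)[of 0] by (simp add: poly_0_coeff_0 mscale_def zero_vec_def[symmetric])
  also have "\<dots> \<le> (\<Sum>i\<le>degree f. coeff f i)" using pos by (intro member_le_sum) auto
  also have "\<dots> = poly f 1" by (simp add: poly_altdef)
  also have "\<dots> = msym k (B + A)" using f(1)[of 1] by (simp add: mscale_def)
  finally show ?thesis .
qed

text \<open>Shifting both matrices by \<open>e I\<close> moves them into the open cone, and the
  inequality passes to the limit.\<close>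

lemma closed_cone_msym_add:
  fixes A B :: "real ^ 'n ^ 'n"
  assumes A: "A \<in> closed_cone k" and B: "B \<in> closed_cone k" and k: "k \<le> CARD('n)"
  shows "msym k B \<le> msym k (B + A)"
proof (rule tendsto_le[of "at_right 0"])
  have "continuous_on UNIV (\<lambda>e. msym k (B + e *\<^sub>R mat 1))"
    by (intro continuous_on_msym continuous_intros)
  then show "((\<lambda>e. msym k (B + e *\<^sub>R mat 1)) \<longlongrightarrow> msym k B) (at_right 0)"
    unfolding continuous_on_eq_continuous_at[OF open_UNIV] isCont_def
    by (rule ballE[of _ _ 0]) (auto intro: filterlim_mono at_le)
  have "continuous_on UNIV (\<lambda>e. msym k ((B + e *\<^sub>R mat 1) + (A + e *\<^sub>R mat 1)))"
    by (intro continuous_on_msym continuous_intros)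
  then show "((\<lambda>e. msym k ((B + e *\<^sub>R mat 1) + (A + e *\<^sub>R mat 1))) \<longlongrightarrow> msym k (B + A)) (at_right 0)"
    unfolding continuous_on_eq_continuous_at[OF open_UNIV] isCont_def
    by (rule ballE[of _ _ 0]) (auto intro: filterlim_mono at_le)
  show "\<forall>\<^sub>F e in at_right 0. msym k (B + e *\<^sub>R mat 1) \<le> msym k ((B + e *\<^sub>R mat 1) + (A + e *\<^sub>R mat 1))"
    using eventually_at_right_less[of 0]
  proof eventually_elim
    case (elim e)
    then show ?case using closed_cone_shift[OF A k] closed_cone_shift[OF B k] by (intro open_cone_msym_add[OF _ _ k]) auto
  qed
qed auto

lemma closed_cone_add:
  fixes A B :: "real ^ 'n ^ 'n"
  assumes "A \<in> closed_cone k" "B \<in> closed_cone k" "k \<le> CARD('n)"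
  shows "A + B \<in> closed_cone k"
proof -
  have "0 \<le> msym j (A + B)" if "j \<in> {1..k}" for j
  proof -
    have "A \<in> closed_cone j" "B \<in> closed_cone j" "j \<le> CARD('n)" using that assms closed_cone_mono[of j k] by auto
    from closed_cone_msym_add[OF this(2,1,3)] \<open>A \<in> closed_cone j\<close> show ?thesis
      using that by (auto simp: closed_cone_def intro: order_trans)
  qed
  then show ?thesis using assms by (auto simp: closed_cone_def transpose_add)
qed

lemma closed_cone_scale: "A \<in> closed_cone k \<Longrightarrow> 0 \<le> c \<Longrightarrow> c *\<^sub>R A \<in> closed_cone k"
  by (auto simp: closed_cone_def msym_scaleR transpose_scalar)

lemma psd_closed_cone:
  fixes A :: "real ^ 'n ^ 'n"
  assumes sym: "transpose A = A" and psd: "\<And>v. 0 \<le> (A *v v) \<bullet> v"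
  shows "A \<in> closed_cone k"
proof -
  obtain Q :: "real ^ 'n ^ 'n" and d where Q: "transpose Q ** Q = mat 1" "Q ** transpose Q = mat 1"
    and A: "A = Q ** (\<chi> i j. if i = j then d i else 0) ** transpose Q"
    using symmetric_diagonalizable[OF sym] by blast
  have d: "0 \<le> d i" for i
  proof -
    have "A *v (Q *v axis i 1) = Q *v ((\<chi> i j. if i = j then d i else 0) *v ((transpose Q ** Q) *v axis i 1))"
      by (simp add: A matrix_vector_mul_assoc matrix_mul_assoc)
    also have "(\<chi> i j. if i = j then d i else 0) *v ((transpose Q ** Q) *v axis i 1) = d i *\<^sub>R axis i 1"
      unfolding Q matrix_vector_mul_lid by (auto simp: vec_eq_iff matrix_vector_mult_def axis_def if_distrib[of "\<lambda>x. _ * x"] cong: if_cong)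
    finally have "A *v (Q *v axis i 1) = d i *\<^sub>R (Q *v axis i 1)" by (simp add: matrix_vector_mult_scaleR)
    moreover have "(Q *v axis i 1) \<bullet> (Q *v axis i 1) = axis i 1 \<bullet> ((transpose Q ** Q) *v axis i (1::real))"
      by (metis dot_lmul_matrix matrix_vector_mul_assoc vector_transpose_matrix transpose_transpose)
    ultimately show ?thesis using psd[of "Q *v axis i 1"] by (simp add: Q inner_axis_axis)
  qed
  have "0 \<le> msym j A" for j
    unfolding A using d by (simp add: msym_similar[OF Q(2)] msym_diagonal sum_nonneg prod_nonneg)
  then show ?thesis using sym by (simp add: closed_cone_def)
qed

text \<open>The polynomial \<open>msym k (X + t I)\<close> is real-rooted and has no root
  \<open>t \<ge> 0\<close>, since there it is at least \<open>msym k X\<close>. Its coefficients,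
  positive multiples of the \<open>msym i X\<close>, are then all positive. This is what turns a
  hypothesis on the single order \<open>k - 1\<close> into membership in the interior of the
  cone.\<close>

lemma closed_cone_open:
  fixes X :: "real ^ 'n ^ 'n"
  assumes X: "X \<in> closed_cone k" and pos: "0 < msym k X" and k: "k \<le> CARD('n)"
  shows "X \<in> open_cone k"
proof -
  have sym: "transpose X = X" using X by (simp add: closed_cone_def)
  define f where "f = (\<Sum>i\<le>k. monom (real ((CARD('n) - i) choose (k - i)) * msym i X) (k - i))"
  have pf: "poly f t = msym k (X + mscale t (mat 1))" for t
  proof -
    have "X + mscale t (mat 1) = X + t *\<^sub>R mat 1" by (simp add: vec_eq_iff)
    then show ?thesis by (simp add: msym_shift[OF sym k] f_def poly_sum poly_monom mult_ac)
  qed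
  have coeff: "coeff f (k - i) = real ((CARD('n) - i) choose (k - i)) * msym i X" if "i \<le> k" for i
  proof -
    have "coeff f (k - i) = (\<Sum>l\<le>k. if l = i then real ((CARD('n) - l) choose (k - l)) * msym l X else 0)"
      unfolding f_def coeff_sum coeff_monom using that by (intro sum.cong) auto
    then show ?thesis using that by simp
  qed
  have "degree f \<le> k" unfolding f_def by (intro degree_sum_le) (auto intro: order_trans[OF degree_monom_le])
  moreover have ck: "0 < coeff f k" using coeff[of 0] k by simp
  ultimately have deg: "degree f = k" using le_degree[of f k] by simp
  have "0 < coeff f i" if "i \<le> k" for i
  proof (rule coeff_pos_of_negative_roots)
    fix z assume "poly (map_poly complex_of_real f) z = 0"
    then have root: "msym k (cmat X + mscale z (cmat (mat 1))) = 0" unfolding map_poly_msym_pencil[OF pf] .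
    moreover have "cmat (mat 1 :: real ^ 'n ^ 'n) = mat 1" by (simp add: vec_eq_iff mat_def)
    ultimately have z: "Im z = 0" using msym_complex_shift_nonzero[OF sym k] by metis
    have "cmat X + mscale z (cmat (mat 1)) = cmat (X + Re z *\<^sub>R mat 1)"
      using z by (simp add: vec_eq_iff complex_eq_iff)
    then have "msym k (X + Re z *\<^sub>R mat 1) = 0" using root msym_cmat[of k "X + Re z *\<^sub>R mat 1"] by simp
    then have "Re z < 0" using msym_shift_lower_bound[OF X k, of "Re z" k] pos by (cases "0 \<le> Re z") auto
    then show "z \<in> \<real> \<and> Re z < 0" using z by (simp add: complex_is_Real_iff)
  qed (use deg ck that in auto)
  then have "0 < msym i X" if "i \<le> k" for i
    using coeff[OF that] by (metis diff_le_self of_nat_0_le_iff zero_less_mult_iff not_less)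
  then show ?thesis using sym by (simp add: open_cone_def)
qed

section \<open>Null Lagrangians\<close>

text \<open>The change of variables theorem of the library needs a well-ordered index type;
  \<open>'a wo\<close> is a copy of \<open>'a\<close> with an arbitrary well-order.\<close>

typedef 'a wo = "UNIV :: 'a set" morphisms unwo Wo ..

lemma bij_unwo: "bij unwo"
  by (metis (mono_tags) UNIV_I Wo_inverse bijI' unwo_inject)

instance wo :: (finite) finite
proof
  have "finite (unwo -` UNIV :: 'a wo set)"
    using bij_unwo by (intro finite_vimageI) (auto simp: bij_def)
  then show "finite (UNIV :: 'a wo set)" by simp
qed

definition wo_index :: "'a::finite wo \<Rightarrow> nat" where
  "wo_index x = (SOME f. inj f) (unwo x)"

lemma inj_wo_index: "inj (wo_index :: 'a::finite wo \<Rightarrow> nat)"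
proof -
  obtain f :: "'a \<Rightarrow> nat" where "inj f"
    using finite_imp_inj_to_nat_seg[OF finite[of "UNIV :: 'a set"]] by blast
  then have "inj (SOME f :: 'a \<Rightarrow> nat. inj f)" by (rule someI[where P = inj])
  then show ?thesis
    by (intro injI) (simp add: wo_index_def inj_eq unwo_inject)
qed

instantiation wo :: (finite) wellorder
begin

definition less_eq_wo :: "'a wo \<Rightarrow> 'a wo \<Rightarrow> bool" where "x \<le> y \<longleftrightarrow> wo_index x \<le> wo_index y"
definition less_wo :: "'a wo \<Rightarrow> 'a wo \<Rightarrow> bool" where "x < y \<longleftrightarrow> wo_index x < wo_index y"

instance
proof
  fix x y z :: "'a wo" and P
  show "x < y \<longleftrightarrow> x \<le> y \<and> \<not> y \<le> x" by (auto simp: less_eq_wo_def less_wo_def)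
  show "x \<le> x" by (simp add: less_eq_wo_def)
  show "x \<le> y \<Longrightarrow> y \<le> z \<Longrightarrow> x \<le> z" by (simp add: less_eq_wo_def)
  show "x \<le> y \<Longrightarrow> y \<le> x \<Longrightarrow> x = y" using inj_wo_index by (auto simp: less_eq_wo_def inj_def)
  show "x \<le> y \<or> y \<le> x" by (auto simp: less_eq_wo_def)
  show "(\<And>x. (\<And>y. y < x \<Longrightarrow> P y) \<Longrightarrow> P x) \<Longrightarrow> P x"
    unfolding less_wo_def by (induction x rule: measure_induct_rule[of wo_index]) blast
qed

end

lemma det_reindex:
  fixes A :: "'a::comm_ring_1 ^ 'n ^ 'n" and f :: "'m::finite \<Rightarrow> 'n"
  assumes f: "bij f"
  shows "det (\<chi> i j. A $ f i $ f j) = det A"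
proof -
  have inv: "bij (inv f)" "\<And>x. f (inv f x) = x" "\<And>x. inv f (f x) = x"
    using f by (auto simp: bij_imp_bij_inv bij_is_inj bij_is_surj surj_f_inv_f)
  have "(\<Sum>p | p permutes (UNIV :: 'm set). of_int (sign p) * (\<Prod>i\<in>UNIV. A $ f i $ f (p i))) =
     (\<Sum>q | q permutes (UNIV :: 'n set). of_int (sign q) * (\<Prod>i\<in>UNIV. A $ i $ q i))"
  proof (rule sum.reindex_bij_witness[of _ "\<lambda>q. inv f \<circ> q \<circ> f" "\<lambda>p. f \<circ> p \<circ> inv f"])
    fix p assume "p \<in> {p. p permutes (UNIV :: 'm set)}"
    then have p: "p permutes UNIV" by simp
    then have "bij (f \<circ> p \<circ> inv f)" using f inv(1) by (intro bij_comp permutes_bij)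
    then show "f \<circ> p \<circ> inv f \<in> {q. q permutes UNIV}" by (auto intro: bij_imp_permutes)
    have "map_permutation UNIV f p = f \<circ> p \<circ> inv f"
      using f by (auto simp: map_permutation_def restrict_id_def bij_def fun_eq_iff)
    then have s: "sign (f \<circ> p \<circ> inv f) = sign p"
      using sign_map_permutation[of f UNIV p] p f by (simp add: bij_def)
    have "(\<Prod>i\<in>UNIV. A $ i $ (f \<circ> p \<circ> inv f) i) = (\<Prod>i\<in>UNIV. A $ f i $ f (p i))"
      using prod.reindex_bij_betw[OF f, of "\<lambda>i. A $ i $ (f \<circ> p \<circ> inv f) i"] by (simp add: inv)
    then show "of_int (sign (f \<circ> p \<circ> inv f)) * (\<Prod>i\<in>UNIV. A $ i $ (f \<circ> p \<circ> inv f) i) =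
        of_int (sign p) * (\<Prod>i\<in>UNIV. A $ f i $ f (p i))" by (simp only: s)
  next
    fix q assume "q \<in> {q. q permutes (UNIV :: 'n set)}"
    then have "bij (inv f \<circ> q \<circ> f)" using f inv(1) by (intro bij_comp permutes_bij) auto
    then show "inv f \<circ> q \<circ> f \<in> {q. q permutes UNIV}" by (auto intro: bij_imp_permutes)
  qed (auto simp: fun_eq_iff inv)
  then show ?thesis by (simp add: det_def)
qed

lemma msym_reindex:
  fixes A :: "real ^ 'n ^ 'n" and f :: "'m::finite \<Rightarrow> 'n"
  assumes f: "bij f"
  shows "msym k (\<chi> i j. A $ f i $ f j) = msym k A"
proof -
  have card: "CARD('m) = CARD('n)" using f by (metis bij_betw_same_card)
  show ?thesis
  proof (cases "k \<le> CARD('n)")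
    case True
    show ?thesis
    proof (rule msym_eq_coeff)
      fix s
      have "id_plus s (\<chi> i j. A $ f i $ f j) = (\<chi> i j. id_plus s A $ f i $ f j)"
        using f by (auto simp: vec_eq_iff id_plus_def bij_def inj_eq)
      then show "det (id_plus s (\<chi> i j. A $ f i $ f j)) = (\<Sum>k\<le>CARD('m). msym k A * s ^ k)"
        by (simp add: det_reindex[OF f] det_id_plus card)
    qed (simp add: True card)
  qed (simp add: msym_gt_card card)
qed

lemma id_plus_mult: "id_plus s A *v h = h + s *\<^sub>R (A *v (h :: real ^ 'n))"
proof -
  have "id_plus s A = mat 1 + s *\<^sub>R A" by (simp add: vec_eq_iff id_plus_def mat_def)
  then show ?thesis by (simp add: matrix_vector_mult_add_rdistrib scaleR_matrix_vector_assoc)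
qed

text \<open>For small \<open>s > 0\<close> the map \<open>x + s \<Phi> x\<close> is a diffeomorphism of the box onto itself, so the integral of
  its Jacobian determinant, a polynomial in \<open>s\<close>, is constant.\<close>

lemma integral_det_id_plus:
  fixes \<Phi> :: "real ^ 'm::{finite,wellorder} \<Rightarrow> real ^ 'm::_" and J :: "real ^ 'm::_ \<Rightarrow> real ^ 'm::_ ^ 'm::_"
  assumes der: "\<And>x. (\<Phi> has_derivative (\<lambda>h. J x *v h)) (at x)"
    and cont: "continuous_on UNIV J"
    and supp: "\<And>x. x \<notin> cbox a b \<Longrightarrow> \<Phi> x = 0" "\<And>x. x \<notin> cbox a b \<Longrightarrow> J x = 0"
  shows "\<exists>s0>0. \<forall>s\<in>{0<..<s0}. integral (cbox a b) (\<lambda>x. det (id_plus s (J x))) = measure lebesgue (cbox a b)"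
proof -
  have contQ: "continuous_on (cbox a b) J" using cont continuous_on_subset by blast
  then have "bounded (J ` cbox a b)" by (intro compact_imp_bounded compact_continuous_image) auto
  then obtain C where C: "\<And>x. x \<in> cbox a b \<Longrightarrow> norm (J x) \<le> C" by (auto simp: bounded_iff)
  define K where "K = real (CARD('m)) * real (CARD('m)) * max C 0"
  have on: "onorm (\<lambda>h. J x *v h) \<le> K" for x
  proof -
    have "norm (J x) \<le> max C 0" using C supp(2)[of x] by (cases "x \<in> cbox a b") (auto simp: le_max_iff_disj)
    then have "\<bar>J x $ i $ j\<bar> \<le> max C 0" for i j
      by (meson component_le_norm_cart Finite_Cartesian_Product.norm_nth_le order_trans)
    then show ?thesis unfolding K_def by (rule onorm_le_matrix_component)
  qed
  have lip: "norm (\<Phi> x - \<Phi> y) \<le> K * norm (x - y)" for x y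
    using differentiable_bound[OF convex_UNIV, of \<Phi> "\<lambda>x h. J x *v h" K x y] der on by auto
  have K0: "0 \<le> K" by (simp add: K_def)
  have "continuous_on (cbox a b) (\<lambda>x. \<Sum>k\<le>CARD('m). \<bar>msym k (J x)\<bar>)"
    by (intro continuous_intros continuous_on_msym contQ)
  then have "bounded ((\<lambda>x. \<Sum>k\<le>CARD('m). \<bar>msym k (J x)\<bar>) ` cbox a b)"
    by (intro compact_imp_bounded compact_continuous_image) auto
  then obtain M where M: "\<And>x. x \<in> cbox a b \<Longrightarrow> (\<Sum>k\<le>CARD('m). \<bar>msym k (J x)\<bar>) \<le> M"
    by (auto simp: bounded_iff)
  \<comment> \<open>The three bounds give \<open>s ^ k \<le> s\<close> for \<open>k \<ge> 1\<close>,
    a Lipschitz constant at most \<open>1 / 2\<close> for \<open>s \<Phi>\<close>, and a positive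
    Jacobian determinant.\<close>
  define s0 where "s0 = min 1 (min (1 / (2 * (K + 1))) (1 / (\<bar>M\<bar> + 1)))"
  have "0 < s0" using K0 by (auto simp: s0_def)
  moreover have "integral (cbox a b) (\<lambda>x. det (id_plus s (J x))) = measure lebesgue (cbox a b)"
    if s: "s \<in> {0<..<s0}" for s
  proof -
    have s': "0 < s" "s < 1" "s * K \<le> 1 / 2" "s * M < 1"
    proof -
      show "0 < s" "s < 1" using s by (auto simp: s0_def)
      have "s * (K + 1) \<le> 1 / (2 * (K + 1)) * (K + 1)" using s K0 by (intro mult_right_mono) (auto simp: s0_def)
      also have "\<dots> = 1 / 2" using K0 by (simp add: divide_simps)
      finally have "s * (K + 1) \<le> 1 / 2" .
      moreover have "s * K \<le> s * (K + 1)" using \<open>0 < s\<close> by simp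
      ultimately show "s * K \<le> 1 / 2" by linarith
      have "s * (\<bar>M\<bar> + 1) < 1 / (\<bar>M\<bar> + 1) * (\<bar>M\<bar> + 1)" using s by (intro mult_strict_right_mono) (auto simp: s0_def)
      moreover have "\<bar>M\<bar> + 1 \<noteq> 0" by linarith
      ultimately have "s * (\<bar>M\<bar> + 1) < 1" by simp
      moreover have "s * M \<le> s * (\<bar>M\<bar> + 1)" using \<open>0 < s\<close> by (intro mult_left_mono) auto
      ultimately show "s * M < 1" by linarith
    qed
    define g where "g x = x + s *\<^sub>R \<Phi> x" for x
    have half: "norm (s *\<^sub>R \<Phi> x - s *\<^sub>R \<Phi> y) \<le> 1 / 2 * norm (x - y)" for x y
    proof -
      have "norm (s *\<^sub>R \<Phi> x - s *\<^sub>R \<Phi> y) = s * norm (\<Phi> x - \<Phi> y)"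
        using s'(1) by (simp add: scaleR_diff_right[symmetric])
      also have "\<dots> \<le> s * (K * norm (x - y))" using lip s'(1) by (intro mult_left_mono) auto
      also have "\<dots> = s * K * norm (x - y)" by simp
      also have "\<dots> \<le> 1 / 2 * norm (x - y)" using s'(3) by (intro mult_right_mono) auto
      finally show ?thesis .
    qed
    have inj: "inj g"
    proof (rule injI)
      fix x y assume "g x = g y"
      then have "x - y = - (s *\<^sub>R \<Phi> x - s *\<^sub>R \<Phi> y)" by (simp add: g_def algebra_simps)
      then have "norm (x - y) \<le> 1 / 2 * norm (x - y)" using half[of x y] by (metis norm_minus_cancel)
      then show "x = y" by simp
    qed
    have out: "g x = x" if "x \<notin> cbox a b" for x using supp(1)[OF that] by (simp add: g_def)
    \<comment> \<open>Outside the box \<open>g\<close> is the identity, so injectivity keeps the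
      image of the box inside it; preimages are fixed points of the contraction
      \<open>y - s \<Phi> x\<close>.\<close>
    have "g ` cbox a b = cbox a b"
    proof
      show "g ` cbox a b \<subseteq> cbox a b"
      proof (clarify, rule ccontr)
        fix x assume "x \<in> cbox a b" "g x \<notin> cbox a b"
        then have "g (g x) = g x" using out by simp
        then have "g x = x" using inj by (simp add: inj_eq)
        then show False using \<open>x \<in> _\<close> \<open>g x \<notin> _\<close> by simp
      qed
      show "cbox a b \<subseteq> g ` cbox a b"
      proof
        fix y assume y: "y \<in> cbox a b"
        have "\<exists>!x. y - s *\<^sub>R \<Phi> x = x"
        proof (rule banach_fix_type[of "1/2"])
          show "\<forall>x x'. dist (y - s *\<^sub>R \<Phi> x) (y - s *\<^sub>R \<Phi> x') \<le> 1 / 2 * dist x x'"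
            using half by (auto simp: dist_norm norm_minus_commute)
        qed auto
        then obtain x where "y - s *\<^sub>R \<Phi> x = x" by blast
        then have x: "g x = y" by (simp add: g_def algebra_simps)
        then have "x \<in> cbox a b" using out y by metis
        then show "y \<in> g ` cbox a b" using x by blast
      qed
    qed
    moreover have derg: "(g has_derivative (\<lambda>h. id_plus s (J x) *v h)) (at x within cbox a b)" for x
      unfolding g_def[abs_def] id_plus_mult
      by (intro has_derivative_add has_derivative_ident has_derivative_scaleR_right has_derivative_at_withinI[OF der])
    moreover have contdet: "continuous_on (cbox a b) (\<lambda>x. det (id_plus s (J x)))"
      unfolding det_id_plus by (intro continuous_intros continuous_on_msym contQ)
    moreover have pos: "0 < det (id_plus s (J x))" if "x \<in> cbox a b" for x
    proof -
      have "\<bar>\<Sum>k\<in>{1..CARD('m)}. msym k (J x) * s ^ k\<bar> \<le> (\<Sum>k\<in>{1..CARD('m)}. \<bar>msym k (J x)\<bar> * s)"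
      proof (intro order_trans[OF sum_abs] sum_mono)
        fix k assume "k \<in> {1..CARD('m)}"
        then have "s ^ k \<le> s ^ 1" using s' by (intro power_decreasing) auto
        then show "\<bar>msym k (J x) * s ^ k\<bar> \<le> \<bar>msym k (J x)\<bar> * s"
          using s'(1) by (simp add: abs_mult mult_left_mono)
      qed
      also have "\<dots> \<le> s * (\<Sum>k\<le>CARD('m). \<bar>msym k (J x)\<bar>)"
        unfolding sum_distrib_right[symmetric] mult.commute[of s]
        using s'(1) by (intro mult_right_mono sum_mono2) auto
      also have "\<dots> \<le> s * M" using M[OF that] s'(1) by (intro mult_left_mono) auto
      finally have "- 1 < (\<Sum>k\<in>{1..CARD('m)}. msym k (J x) * s ^ k)" using s'(4) by linarith
      moreover have "{..CARD('m)} = insert 0 {1..CARD('m)}" by auto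
      then have "det (id_plus s (J x)) = 1 + (\<Sum>k\<in>{1..CARD('m)}. msym k (J x) * s ^ k)"
        unfolding det_id_plus by simp
      ultimately show ?thesis by linarith
    qed
    moreover have "matrix (\<lambda>h. id_plus s (J x) *v h) = id_plus s (J x)" for x
      by (rule matrix_of_matrix_vector_mul)
    moreover have "(\<lambda>x. \<bar>det (id_plus s (J x))\<bar>) integrable_on cbox a b"
      using contdet by (intro integrable_continuous continuous_on_rabs)
    ultimately have "measure lebesgue (cbox a b) = integral (cbox a b) (\<lambda>x. \<bar>det (id_plus s (J x))\<bar>)"
      using measure_differentiable_image_eq[of "cbox a b" g "\<lambda>x h. id_plus s (J x) *v h"] inj
      by (simp add: inj_on_subset)
    also have "\<dots> = integral (cbox a b) (\<lambda>x. det (id_plus s (J x)))"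
      using pos by (intro Henstock_Kurzweil_Integration.integral_cong) (auto simp: less_imp_le)
    finally show ?thesis ..
  qed
  ultimately show ?thesis by blast
qed

text \<open>The integral of the Jacobian determinant is a polynomial in \<open>s\<close> that is
  constant on an interval, so its coefficients of positive degree vanish.\<close>

lemma integral_msym_wo:
  fixes \<Phi> :: "real ^ 'm::{finite,wellorder} \<Rightarrow> real ^ 'm::_" and J :: "real ^ 'm::_ \<Rightarrow> real ^ 'm::_ ^ 'm::_"
  assumes der: "\<And>x. (\<Phi> has_derivative (\<lambda>h. J x *v h)) (at x)"
    and cont: "continuous_on UNIV J"
    and supp: "\<And>x. x \<notin> cbox a b \<Longrightarrow> \<Phi> x = 0" "\<And>x. x \<notin> cbox a b \<Longrightarrow> J x = 0"
    and k: "1 \<le> k"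
  shows "integral (cbox a b) (\<lambda>x. msym k (J x)) = 0"
proof (cases "k \<le> CARD('m)")
  case True
  obtain s0 where s0: "0 < s0"
    "\<And>s. s \<in> {0<..<s0} \<Longrightarrow> integral (cbox a b) (\<lambda>x. det (id_plus s (J x))) = measure lebesgue (cbox a b)"
    using integral_det_id_plus[OF der cont supp] by blast
  define c where "c k = integral (cbox a b) (\<lambda>x. msym k (J x))" for k
  have contQ: "continuous_on (cbox a b) J" using cont continuous_on_subset by blast
  have int: "(\<lambda>x. msym k (J x)) integrable_on cbox a b" for k
    by (intro integrable_continuous continuous_on_msym contQ)
  define p where "p = (\<Sum>k\<in>{1..CARD('m)}. monom (c k) k)"
  have "poly p s = 0" if s: "s \<in> {0<..<s0}" for s
  proof -
    have "measure lebesgue (cbox a b) = (\<Sum>k\<le>CARD('m). c k * s ^ k)"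
      unfolding s0(2)[OF s, symmetric] det_id_plus c_def
      using int by (subst integral_sum) (auto intro!: integrable_on_mult_left)
    also have "{..CARD('m)} = insert 0 {1..CARD('m)}" by auto
    also have "(\<Sum>k\<in>insert 0 {1..CARD('m)}. c k * s ^ k) = c 0 + poly p s"
      by (simp add: p_def poly_sum poly_monom)
    also have "c 0 = measure lebesgue (cbox a b)"
      unfolding c_def by (simp add: lmeasure_integral)
    finally show ?thesis by simp
  qed
  then have "{0<..<s0} \<subseteq> {s. poly p s = 0}" by auto
  moreover have "infinite {0<..<s0}" using s0(1) by simp
  ultimately have "p = 0" using poly_roots_finite finite_subset by blast
  then have "coeff p k = 0" by simp
  moreover have "coeff p k = (\<Sum>l\<in>{1..CARD('m)}. if l = k then c l else 0)"
    unfolding p_def coeff_sum coeff_monom ..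
  ultimately show ?thesis using k True by (simp add: c_def)
qed (simp add: msym_gt_card)

section \<open>Transfer to an arbitrary finite index type\<close>

definition to_wo :: "real ^ 'n \<Rightarrow> real ^ ('n wo)" where "to_wo x = (\<chi> i. x $ unwo i)"
definition of_wo :: "real ^ ('n wo) \<Rightarrow> real ^ 'n" where "of_wo y = (\<chi> i. y $ Wo i)"

lemma wo_simps [simp]: "unwo (Wo i) = i" "Wo (unwo i') = i'"
  by (simp_all add: Wo_inverse unwo_inverse)

lemma bounded_linear_to_wo: "bounded_linear to_wo"
  unfolding linear_conv_bounded_linear[symmetric] by (auto simp: to_wo_def vec_eq_iff intro!: linearI)

lemma bounded_linear_of_wo: "bounded_linear of_wo"
  unfolding linear_conv_bounded_linear[symmetric] by (auto simp: of_wo_def vec_eq_iff intro!: linearI)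

lemma of_wo_in_cbox: "of_wo y \<in> cbox l u \<longleftrightarrow> y \<in> cbox (to_wo l) (to_wo u)"
  unfolding mem_box_cart of_wo_def to_wo_def by simp (metis wo_simps)

lemma of_wo_in_box: "of_wo y \<in> box l u \<longleftrightarrow> y \<in> box (to_wo l) (to_wo u)"
  unfolding mem_box_cart of_wo_def to_wo_def by simp (metis wo_simps)

lemma emeasure_lborel_box_cart:
  fixes l u :: "real ^ 'n"
  assumes "\<And>i. l $ i \<le> u $ i"
  shows "emeasure lborel (box l u) = ennreal (\<Prod>i\<in>UNIV. u $ i - l $ i)"
proof -
  have "cbox l u \<noteq> {}" using assms by (auto simp: interval_eq_empty_cart not_less)
  then have "measure lborel (cbox l u) = (\<Prod>i\<in>UNIV. u $ i - l $ i)" by (rule content_cbox_cart)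
  moreover have "l \<bullet> b \<le> u \<bullet> b" if "b \<in> Basis" for b
    using that assms by (auto simp: Basis_vec_def inner_axis)
  then have "emeasure lborel (box l u) = emeasure lborel (cbox l u)" by simp
  moreover have "emeasure lborel (cbox l u) = ennreal (measure lborel (cbox l u))"
    using emeasure_lborel_cbox_finite[of l u] by (intro emeasure_eq_ennreal_measure) auto
  ultimately show ?thesis by metis
qed

lemma lborel_of_wo: "distr lborel borel of_wo = (lborel :: (real ^ 'n) measure)"
proof (rule lborel_eqI[symmetric])
  have meas: "of_wo \<in> borel_measurable borel"
    using bounded_linear_of_wo by (intro borel_measurable_continuous_onI linear_continuous_on)
  fix l u :: "real ^ 'n" assume le: "\<And>b. b \<in> Basis \<Longrightarrow> l \<bullet> b \<le> u \<bullet> b"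
  have le': "l $ i \<le> u $ i" for i using le[of "axis i 1"] by (simp add: inner_axis)
  have "emeasure (distr lborel borel of_wo) (box l u) = emeasure lborel (box (to_wo l) (to_wo u))"
    using meas by (subst emeasure_distr) (auto simp: of_wo_in_box vimage_def)
  also have "\<dots> = ennreal (\<Prod>i\<in>UNIV. u $ unwo i - l $ unwo i)"
    by (subst emeasure_lborel_box_cart) (use le' in \<open>auto simp: to_wo_def\<close>)
  also have "(\<Prod>i\<in>UNIV. u $ unwo i - l $ unwo i) = (\<Prod>i\<in>UNIV. u $ i - l $ i)"
    by (rule prod.reindex_bij_betw[OF bij_unwo])
  also have "ennreal \<dots> = emeasure lborel (box l u)" by (simp add: emeasure_lborel_box_cart le')
  also have "\<dots> = (\<Prod>b\<in>Basis. (u - l) \<bullet> b)" by (rule emeasure_lborel_box) (rule le)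
  finally show "emeasure (distr lborel borel of_wo) (box l u) = ennreal (\<Prod>b\<in>Basis. (u - l) \<bullet> b)" .
qed simp

text \<open>\<open>J\<close> is not assumed symmetric: the fields to which this is applied are
  gradients multiplied by cutoffs. Only first derivatives of \<open>\<Phi>\<close> occur, hence only
  second derivatives of the functions behind it.\<close>

proposition integral_msym_compact_support:
  fixes \<Phi> :: "real ^ 'n \<Rightarrow> real ^ 'n" and J :: "real ^ 'n \<Rightarrow> real ^ 'n ^ 'n"
  assumes der: "\<And>x. (\<Phi> has_derivative (\<lambda>h. J x *v h)) (at x)"
    and cont: "continuous_on UNIV J"
    and supp: "\<And>x. x \<notin> cbox a b \<Longrightarrow> \<Phi> x = 0" "\<And>x. x \<notin> cbox a b \<Longrightarrow> J x = 0"
    and k: "1 \<le> k"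
  shows "(LINT x:cbox a b|lborel. msym k (J x)) = 0"
proof -
  define \<Psi> where "\<Psi> y = to_wo (\<Phi> (of_wo y))" for y
  define L where "L y = (\<chi> i j. J (of_wo y) $ unwo i $ unwo j)" for y
  have contof: "continuous_on UNIV (of_wo :: _ \<Rightarrow> real ^ 'n)"
    using bounded_linear_of_wo by (rule linear_continuous_on)
  have contL: "continuous_on UNIV L"
    unfolding L_def by (intro continuous_intros continuous_on_compose2[OF cont contof]) auto
  have der\<Psi>: "(\<Psi> has_derivative (\<lambda>h. L y *v h)) (at y)" for y
  proof -
    have "(\<Psi> has_derivative (\<lambda>h. to_wo (J (of_wo y) *v of_wo h))) (at y)"
      unfolding \<Psi>_def[abs_def]
      by (intro bounded_linear.has_derivative[OF bounded_linear_to_wo] has_derivative_compose[OF _ der]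
          bounded_linear_imp_has_derivative bounded_linear_of_wo)
    moreover have "to_wo (J (of_wo y) *v of_wo h) = L y *v h" for h
    proof -
      have "(\<Sum>j\<in>UNIV. J (of_wo y) $ unwo i $ j * h $ Wo j) =
          (\<Sum>j\<in>UNIV. J (of_wo y) $ unwo i $ unwo j * h $ j)" for i
        using sum.reindex_bij_betw[OF bij_unwo, of "\<lambda>j. J (of_wo y) $ unwo i $ j * h $ Wo j"] by simp
      then show ?thesis by (simp add: vec_eq_iff matrix_vector_mult_def to_wo_def of_wo_def L_def)
    qed
    ultimately show ?thesis by simp
  qed
  have "integral (cbox (to_wo a) (to_wo b)) (\<lambda>y. msym k (L y)) = 0"
  proof (rule integral_msym_wo[OF der\<Psi> contL _ _ k])
    fix y assume "y \<notin> cbox (to_wo a) (to_wo b)"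
    then have "of_wo y \<notin> cbox a b" by (simp add: of_wo_in_cbox)
    then show "\<Psi> y = 0" "L y = 0"
      using supp by (auto simp: \<Psi>_def L_def vec_eq_iff to_wo_def)
  qed
  moreover have "msym k (L y) = msym k (J (of_wo y))" for y
    unfolding L_def by (rule msym_reindex[OF bij_unwo])
  moreover have "set_integrable lborel (cbox (to_wo a) (to_wo b)) (\<lambda>y. msym k (L y))"
    unfolding set_integrable_def
    by (intro borel_integrable_compact continuous_on_msym continuous_on_subset[OF contL]) auto
  ultimately have 0: "(LINT y:cbox (to_wo a) (to_wo b)|lborel. msym k (J (of_wo y))) = 0"
    by (simp add: set_borel_integral_eq_integral)
  have "continuous_on UNIV (\<lambda>x. msym k (J x))" by (intro continuous_on_msym cont)
  then have "(\<lambda>x. indicator (cbox a b) x *\<^sub>R msym k (J x)) \<in> borel_measurable borel"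
    by (intro borel_measurable_scaleR borel_measurable_continuous_onI borel_measurable_indicator) auto
  moreover have "(of_wo :: _ \<Rightarrow> real ^ 'n) \<in> borel_measurable borel"
    using contof by (rule borel_measurable_continuous_onI)
  ultimately have "(LINT x|distr lborel borel of_wo. indicator (cbox a b) x *\<^sub>R msym k (J x)) =
      (LINT y|lborel. indicator (cbox a b) (of_wo y) *\<^sub>R msym k (J (of_wo y)))"
    by (intro integral_distr) auto
  also have "\<dots> = (LINT y:cbox (to_wo a) (to_wo b)|lborel. msym k (J (of_wo y)))"
    unfolding set_lebesgue_integral_def by (intro Bochner_Integration.integral_cong) (auto simp: indicator_def of_wo_in_cbox)
  finally show ?thesis unfolding lborel_of_wo set_lebesgue_integral_def 0[unfolded set_lebesgue_integral_def] .
qed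

section \<open>Integration by parts for Hessian operators\<close>

text \<open>The derivative of \<open>msym k\<close> at \<open>A\<close> in the direction
  \<open>B\<close>. The explicit polynomial form makes linearity in \<open>B\<close> and joint
  continuity immediate.\<close>

definition dmsym :: "nat \<Rightarrow> real ^ 'n ^ 'n \<Rightarrow> real ^ 'n ^ 'n \<Rightarrow> real" where
  "dmsym k A B = (\<Sum>I | card I = k. \<Sum>p | p permutes I.
     of_int (sign p) * (\<Sum>i\<in>I. B $ i $ p i * (\<Prod>j\<in>I - {i}. A $ j $ p j)))"

lemma has_derivative_msym:
  fixes f :: "'a::real_normed_vector \<Rightarrow> real ^ 'n ^ 'n"
  assumes "(f has_derivative f') (at x within S)"
  shows "((\<lambda>x. msym k (f x)) has_derivative (\<lambda>h. dmsym k (f x) (f' h))) (at x within S)"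
proof -
  have "((\<lambda>x. f x $ i $ j) has_derivative (\<lambda>h. f' h $ i $ j)) (at x within S)" for i j
    by (intro bounded_linear.has_derivative[OF bounded_linear_vec_nth] assms)
  then show ?thesis unfolding msym_def dmsym_def
    by (intro has_derivative_sum has_derivative_mult_right has_derivative_prod)
qed

lemma has_real_derivative_msym_line:
  "((\<lambda>t. msym k (A + t *\<^sub>R B)) has_real_derivative dmsym k (A + t *\<^sub>R B) B) (at t within S)"
proof -
  have "((\<lambda>t. A + t *\<^sub>R B) has_derivative (\<lambda>h. h *\<^sub>R B)) (at t within S)"
    by (auto intro!: derivative_eq_intros)
  from has_derivative_msym[OF this, of k] show ?thesis
    unfolding has_field_derivative_def
    by (rule has_derivative_eq_rhs) (auto simp: dmsym_def sum_distrib_left mult_ac fun_eq_iff intro!: sum.cong)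
qed

lemma dmsym_add: "dmsym k A (B + C) = dmsym k A B + dmsym k A C"
  by (simp add: dmsym_def sum.distrib distrib_left distrib_right)

lemma dmsym_scaleR: "dmsym k A (c *\<^sub>R B) = c * dmsym k A B"
  by (simp add: dmsym_def sum_distrib_left mult_ac)

lemma dmsym_diff: "dmsym k A (B - C) = dmsym k A B - dmsym k A C"
  using dmsym_add[of k A B "(-1) *\<^sub>R C"] dmsym_scaleR[of k A "-1" C] by simp

lemma dmsym_0 [simp]: "dmsym k A 0 = 0"
  by (simp add: dmsym_def)

lemma continuous_on_dmsym:
  assumes "continuous_on S f" "continuous_on S g"
  shows "continuous_on S (\<lambda>x. dmsym k (f x) (g x))"
  unfolding dmsym_def by (intro continuous_intros assms)

text \<open>Euler's relation for a form of degree \<open>k\<close>.\<close>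

lemma dmsym_self: "dmsym k A A = real k * msym k A"
proof -
  have "(\<Sum>i\<in>I. A $ i $ p i * (\<Prod>j\<in>I - {i}. A $ j $ p j)) = real (card I) * (\<Prod>i\<in>I. A $ i $ p i)" for I :: "'a set" and p
  proof -
    have "(\<Sum>i\<in>I. A $ i $ p i * (\<Prod>j\<in>I - {i}. A $ j $ p j)) = (\<Sum>i\<in>I. \<Prod>j\<in>I. A $ j $ p j)"
      by (intro sum.cong refl prod.remove[symmetric]) auto
    then show ?thesis by simp
  qed
  then show ?thesis by (simp add: dmsym_def msym_def sum_distrib_left mult_ac)
qed

lemma dmsym_transpose: "dmsym k (transpose A) (transpose B) = dmsym k A B"
proof -
  have "(\<lambda>t. msym k (transpose A + t *\<^sub>R transpose B)) = (\<lambda>t. msym k (A + t *\<^sub>R B))"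
    by (simp add: transpose_scalar[symmetric] transpose_add[symmetric] msym_transpose)
  then show ?thesis
    using has_real_derivative_msym_line[of k "transpose A" "transpose B" 0 UNIV]
      has_real_derivative_msym_line[of k A B 0 UNIV] by (simp add: DERIV_unique)
qed

lemma dmsym_outer_commute:
  "transpose A = A \<Longrightarrow> dmsym k A (outer a b) = dmsym k A (outer b a)"
  by (metis dmsym_transpose transpose_outer)

text \<open>Monotonicity along the cone in infinitesimal form; for rank-one directions
  \<open>outer a a\<close> this is the ellipticity of the Hessian operator.\<close>

lemma dmsym_nonneg:
  fixes A B :: "real ^ 'n ^ 'n"
  assumes A: "A \<in> closed_cone k" and B: "B \<in> closed_cone k" and k: "k \<le> CARD('n)"
  shows "0 \<le> dmsym k A B"
proof (rule ccontr)
  assume "\<not> 0 \<le> dmsym k A B"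
  moreover have "((\<lambda>t. msym k (A + t *\<^sub>R B)) has_real_derivative dmsym k A B) (at 0)"
    using has_real_derivative_msym_line[of k A B 0 UNIV] by simp
  ultimately obtain d where d: "d > 0" "\<And>h. 0 < h \<Longrightarrow> h < d \<Longrightarrow> msym k (A + (0 + h) *\<^sub>R B) < msym k (A + 0 *\<^sub>R B)"
    using DERIV_neg_dec_right[of "\<lambda>t. msym k (A + t *\<^sub>R B)" "dmsym k A B" 0] by auto
  have "msym k A \<le> msym k (A + (d / 2) *\<^sub>R B)"
    using d(1) by (intro closed_cone_msym_add closed_cone_scale A B k) auto
  then show False using d(2)[of "d / 2"] d(1) by simp
qed

lemma outer_closed_cone: "outer a a \<in> closed_cone k"
  by (rule psd_closed_cone) (auto simp: transpose_outer outer_mult)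

subsection \<open>A smooth approximation of the positive part\<close>

text \<open>The second antiderivative of the hat function \<open>spline2 d\<close>, which has mass
  \<open>1\<close> on \<open>[-d, d]\<close>: a positive part smoothed to class C2. It truncates in
  the integration by parts, its derivative \<open>spline1\<close> is a cutoff, and it gives the
  smooth maximum in the barrier.\<close>

definition spline :: "real \<Rightarrow> real \<Rightarrow> real" where
  "spline d s = ((max 0 (s + d)) ^ 3 - 2 * (max 0 s) ^ 3 + (max 0 (s - d)) ^ 3) / (6 * d\<^sup>2)"

definition spline1 :: "real \<Rightarrow> real \<Rightarrow> real" where
  "spline1 d s = ((max 0 (s + d))\<^sup>2 - 2 * (max 0 s)\<^sup>2 + (max 0 (s - d))\<^sup>2) / (2 * d\<^sup>2)"

definition spline2 :: "real \<Rightarrow> real \<Rightarrow> real" where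
  "spline2 d s = (max 0 (s + d) - 2 * max 0 s + max 0 (s - d)) / d\<^sup>2"

lemma has_real_derivative_pos_power:
  fixes x :: real
  shows "((\<lambda>x. (max 0 x) ^ Suc (Suc n)) has_real_derivative real (Suc (Suc n)) * (max 0 x) ^ Suc n) (at x)"
proof -
  consider "x < 0" | "x = 0" | "x > 0" by linarith
  then show ?thesis
  proof cases
    case 1
    have "((\<lambda>x. 0) has_real_derivative 0) (at x)" by simp
    then have "((\<lambda>x. (max 0 x) ^ Suc (Suc n)) has_real_derivative 0) (at x)"
      by (rule has_field_derivative_transform_within_open[where S = "{..<0}"]) (use 1 in auto)
    then show ?thesis using 1 by simp
  next
    case 2
    have "((\<lambda>h. (max 0 h) ^ Suc n * sgn (max 0 h)) \<longlongrightarrow> 0) (at (0::real))"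
    proof (rule Lim_null_comparison)
      show "((\<lambda>h. \<bar>h\<bar> ^ Suc n) \<longlongrightarrow> 0) (at (0::real))"
        by (auto intro!: tendsto_eq_intros)
      show "\<forall>\<^sub>F h in at 0. norm ((max 0 h) ^ Suc n * sgn (max 0 h)) \<le> \<bar>h\<bar> ^ Suc n"
        by (intro always_eventually allI) (auto simp: max_def sgn_if)
    qed
    moreover have "(max 0 h) ^ Suc (Suc n) / h = (max 0 h) ^ Suc n * sgn (max 0 h)" if "h \<noteq> 0" for h :: real
      using that by (auto simp: max_def sgn_if)
    ultimately have "((\<lambda>h. (max 0 h) ^ Suc (Suc n) / h) \<longlongrightarrow> 0) (at (0::real))"
      by (subst tendsto_cong[of _ "\<lambda>h. (max 0 h) ^ Suc n * sgn (max 0 h)"]) (auto simp: eventually_at_filter)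
    then show ?thesis using 2 by (simp add: has_field_derivative_iff)
  next
    case 3
    have "((\<lambda>x. x ^ Suc (Suc n)) has_real_derivative real (Suc (Suc n)) * x ^ Suc n) (at x)"
      by (auto intro!: derivative_eq_intros simp del: power_Suc)
    then have "((\<lambda>x. (max 0 x) ^ Suc (Suc n)) has_real_derivative real (Suc (Suc n)) * x ^ Suc n) (at x)"
      by (rule has_field_derivative_transform_within_open[where S = "{0<..}"]) (use 3 in auto)
    then show ?thesis using 3 by simp
  qed
qed

lemma has_real_derivative_spline:
  assumes "0 < d"
  shows "(spline d has_real_derivative spline1 d s) (at s)"
proof -
  have 1: "((\<lambda>s. (max 0 (s + c)) ^ 3) has_real_derivative 3 * (max 0 (s + c))\<^sup>2) (at s)" for c
    using DERIV_shift[of "\<lambda>s. (max 0 s) ^ 3" "3 * (max 0 (s + c))\<^sup>2" s c] has_real_derivative_pos_power[of 1 "s + c"]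
    by (simp add: numeral_3_eq_3 numeral_2_eq_2)
  have "((\<lambda>s. ((max 0 (s + d)) ^ 3 - 2 * (max 0 (s + 0)) ^ 3 + (max 0 (s + - d)) ^ 3) / (6 * d\<^sup>2)) has_real_derivative
      (3 * (max 0 (s + d))\<^sup>2 - 2 * (3 * (max 0 (s + 0))\<^sup>2) + 3 * (max 0 (s + - d))\<^sup>2) / (6 * d\<^sup>2)) (at s)"
    by (intro DERIV_cdivide DERIV_add DERIV_diff DERIV_cmult 1)
  moreover have "(3 * (max 0 (s + d))\<^sup>2 - 2 * (3 * (max 0 (s + 0))\<^sup>2) + 3 * (max 0 (s + - d))\<^sup>2) / (6 * d\<^sup>2) = spline1 d s"
    using assms by (simp add: spline1_def field_simps)
  ultimately show ?thesis by (simp add: spline_def[abs_def])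
qed

lemma has_real_derivative_spline1:
  assumes "0 < d"
  shows "(spline1 d has_real_derivative spline2 d s) (at s)"
proof -
  have 1: "((\<lambda>s. (max 0 (s + c))\<^sup>2) has_real_derivative 2 * (max 0 (s + c))) (at s)" for c
    using DERIV_shift[of "\<lambda>s. (max 0 s)\<^sup>2" "2 * (max 0 (s + c))" s c] has_real_derivative_pos_power[of 0 "s + c"]
    by (simp add: numeral_2_eq_2)
  have "((\<lambda>s. ((max 0 (s + d))\<^sup>2 - 2 * (max 0 (s + 0))\<^sup>2 + (max 0 (s + - d))\<^sup>2) / (2 * d\<^sup>2)) has_real_derivative
      (2 * (max 0 (s + d)) - 2 * (2 * (max 0 (s + 0))) + 2 * (max 0 (s + - d))) / (2 * d\<^sup>2)) (at s)"
    by (intro DERIV_cdivide DERIV_add DERIV_diff DERIV_cmult 1)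
  moreover have "(2 * (max 0 (s + d)) - 2 * (2 * (max 0 (s + 0))) + 2 * (max 0 (s + - d))) / (2 * d\<^sup>2) = spline2 d s"
    using assms by (simp add: spline2_def field_simps)
  ultimately show ?thesis by (simp add: spline1_def[abs_def])
qed

lemma spline_low: "s \<le> - d \<Longrightarrow> 0 < d \<Longrightarrow> spline d s = 0 \<and> spline1 d s = 0 \<and> spline2 d s = 0"
  by (simp add: spline_def spline1_def spline2_def max_def)

lemma spline_high: "d \<le> s \<Longrightarrow> 0 < d \<Longrightarrow> spline d s = s \<and> spline1 d s = 1 \<and> spline2 d s = 0"
  by (auto simp: spline_def spline1_def spline2_def max_def field_simps power2_eq_square power3_eq_cube)

lemma spline2_nonneg: "0 < d \<Longrightarrow> 0 \<le> spline2 d s"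
  by (auto simp: spline2_def max_def divide_simps)

lemma continuous_spline2: "continuous_on S (spline2 d)"
  unfolding spline2_def[abs_def] divide_inverse by (intro continuous_intros)

lemma spline1_mono: "0 < d \<Longrightarrow> a \<le> b \<Longrightarrow> spline1 d a \<le> spline1 d b"
  by (rule DERIV_nonneg_imp_nondecreasing[of a b])
    (auto intro!: exI[of _ "spline2 d _"] has_real_derivative_spline1 spline2_nonneg)

lemma spline1_bounds:
  assumes "0 < d"
  shows "0 \<le> spline1 d s" "spline1 d s \<le> 1"
  using spline1_mono[OF assms, of "min s (-d)" s] spline1_mono[OF assms, of s "max s d"]
    spline_low[of "min s (-d)" d] spline_high[of d "max s d"] assms by auto

lemma spline_mono: "0 < d \<Longrightarrow> a \<le> b \<Longrightarrow> spline d a \<le> spline d b"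
  by (rule DERIV_nonneg_imp_nondecreasing[of a b])
    (auto intro!: exI[of _ "spline1 d _"] has_real_derivative_spline spline1_bounds)

lemma spline_bounds:
  assumes "0 < d"
  shows "0 \<le> spline d s" "spline d s \<le> max 0 (s + d)"
proof -
  show "0 \<le> spline d s"
    using spline_mono[OF assms, of "min s (-d)" s] spline_low[of "min s (-d)" d] assms by auto
  have "(- d) - spline d (- d) \<le> s - spline d s" if "- d \<le> s"
  proof (rule DERIV_nonneg_imp_nondecreasing[OF that])
    fix x
    have "((\<lambda>s. s - spline d s) has_real_derivative 1 - spline1 d x) (at x)"
      by (intro DERIV_diff DERIV_ident has_real_derivative_spline assms)
    then show "\<exists>y. ((\<lambda>s. s - spline d s) has_real_derivative y) (at x) \<and> 0 \<le> y"
      using spline1_bounds[OF assms, of x] by fastforce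
  qed
  then show "spline d s \<le> max 0 (s + d)"
    using spline_low[of s d] spline_low[of "-d" d] assms by (cases "s \<le> - d") auto
qed

lemma continuous_on_spline:
  assumes "0 < d"
  shows "continuous_on S (spline d)" "continuous_on S (spline1 d)"
  using has_real_derivative_spline[OF assms] has_real_derivative_spline1[OF assms]
  by (meson DERIV_isCont continuous_at_imp_continuous_on)+

subsection \<open>Twice differentiable functions\<close>

text \<open>Gradient and Hessian are arguments rather than computed from \<open>f\<close>, so that
  outside \<open>S\<close> they can be continuous extensions to the boundary.\<close>

definition C2 :: "(real ^ 'n) set \<Rightarrow> (real ^ 'n \<Rightarrow> real) \<Rightarrow> (real ^ 'n \<Rightarrow> real ^ 'n) \<Rightarrow> (real ^ 'n \<Rightarrow> real ^ 'n ^ 'n) \<Rightarrow> bool" where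
  "C2 S f G H \<longleftrightarrow> (\<forall>x\<in>S. (f has_derivative (\<lambda>h. G x \<bullet> h)) (at x)) \<and>
     (\<forall>x\<in>S. (G has_derivative (\<lambda>h. H x *v h)) (at x)) \<and> continuous_on S H"

lemma C2_subset: "C2 S f G H \<Longrightarrow> T \<subseteq> S \<Longrightarrow> C2 T f G H"
  unfolding C2_def by (blast intro: continuous_on_subset)

lemma C2D:
  assumes "C2 S f G H"
  shows "x \<in> S \<Longrightarrow> (f has_derivative (\<lambda>h. G x \<bullet> h)) (at x)" "x \<in> S \<Longrightarrow> (G has_derivative (\<lambda>h. H x *v h)) (at x)"
    "continuous_on S f" "continuous_on S G" "continuous_on S H"
  using assms unfolding C2_def
  by (auto intro!: continuous_at_imp_continuous_on dest!: bspec has_derivative_continuous)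

lemma C2_add:
  assumes "C2 S f G H" "C2 S f' G' H'"
  shows "C2 S (\<lambda>x. f x + f' x) (\<lambda>x. G x + G' x) (\<lambda>x. H x + H' x)"
  unfolding C2_def inner_add_left matrix_vector_mult_add_rdistrib
  by (intro conjI ballI has_derivative_add continuous_intros C2D[OF assms(1)] C2D[OF assms(2)])

lemma C2_scale:
  assumes "C2 S f G H"
  shows "C2 S (\<lambda>x. c * f x) (\<lambda>x. c *\<^sub>R G x) (\<lambda>x. c *\<^sub>R H x)"
  unfolding C2_def inner_scaleR_left scaleR_matrix_vector_assoc[symmetric]
  by (intro conjI ballI has_derivative_mult_right has_derivative_scaleR_right continuous_intros C2D[OF assms])

lemma set_integrable_closure:
  fixes f :: "real ^ 'n \<Rightarrow> real"
  assumes "open D" "bounded D" "continuous_on (closure D) f"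
  shows "set_integrable lborel D f"
proof (rule set_integrable_subset)
  show "set_integrable lborel (closure D) f" unfolding set_integrable_def
    using assms by (intro borel_integrable_compact) (auto simp: compact_closure)
qed (use assms closure_subset in auto)

text \<open>By the mean value theorem the difference quotients are values of \<open>F'\<close> at
  parameters within distance \<open>1\<close> of \<open>t0\<close>, hence dominated by
  \<open>w\<close>.\<close>

lemma has_real_derivative_integral:
  fixes F F' :: "real \<Rightarrow> 'a \<Rightarrow> real"
  assumes deriv: "\<And>t x. x \<in> space M \<Longrightarrow> ((\<lambda>t. F t x) has_real_derivative F' t x) (at t)"
    and int: "\<And>t. integrable M (F t)" and meas: "F' t0 \<in> borel_measurable M"
    and bound: "\<And>t x. x \<in> space M \<Longrightarrow> \<bar>t - t0\<bar> \<le> 1 \<Longrightarrow> \<bar>F' t x\<bar> \<le> w x" and w: "integrable M w"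
  shows "((\<lambda>t. integral\<^sup>L M (F t)) has_real_derivative integral\<^sup>L M (F' t0)) (at t0)"
  unfolding has_field_derivative_iff tendsto_at_iff_sequentially comp_def
proof (intro allI impI)
  fix X :: "nat \<Rightarrow> real" assume X: "\<forall>i. X i \<in> UNIV - {t0}" "X \<longlonglongrightarrow> t0"
  then have "\<forall>\<^sub>F n in sequentially. dist (X n) t0 < 1" by (auto dest: tendstoD[of _ _ _ 1])
  then obtain N where N: "\<And>n. n \<ge> N \<Longrightarrow> \<bar>X n - t0\<bar> < 1" by (auto simp: eventually_sequentially dist_real_def)
  have q: "(integral\<^sup>L M (F (X n)) - integral\<^sup>L M (F t0)) / (X n - t0) =
      (\<integral>x. (F (X n) x - F t0 x) / (X n - t0) \<partial>M)" for n
    using int by simp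
  have "(\<lambda>n. \<integral>x. (F (X (n + N)) x - F t0 x) / (X (n + N) - t0) \<partial>M) \<longlonglongrightarrow> integral\<^sup>L M (F' t0)"
  proof (rule integral_dominated_convergence[where w = w])
    show "F' t0 \<in> borel_measurable M" by (rule meas)
    show "(\<lambda>x. (F (X (n + N)) x - F t0 x) / (X (n + N) - t0)) \<in> borel_measurable M" for n
      using int by (intro borel_measurable_divide borel_measurable_diff) auto
    show "AE x in M. (\<lambda>n. (F (X (n + N)) x - F t0 x) / (X (n + N) - t0)) \<longlonglongrightarrow> F' t0 x"
    proof (intro AE_I2)
      fix x assume "x \<in> space M"
      then have "((\<lambda>t. (F t x - F t0 x) / (t - t0)) \<longlongrightarrow> F' t0 x) (at t0)"
        using deriv by (simp add: has_field_derivative_iff)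
      then have "(\<lambda>n. (F (X n) x - F t0 x) / (X n - t0)) \<longlonglongrightarrow> F' t0 x"
        using X unfolding tendsto_at_iff_sequentially comp_def by blast
      then show "(\<lambda>n. (F (X (n + N)) x - F t0 x) / (X (n + N) - t0)) \<longlonglongrightarrow> F' t0 x"
        by (rule LIMSEQ_ignore_initial_segment)
    qed
    show "AE x in M. norm ((F (X (n + N)) x - F t0 x) / (X (n + N) - t0)) \<le> w x" for n
    proof (intro AE_I2)
      fix x assume x: "x \<in> space M"
      let ?y = "X (n + N)"
      have y: "\<bar>?y - t0\<bar> < 1" "?y \<noteq> t0" using N X(1) by auto
      have "\<exists>z. \<bar>z - t0\<bar> \<le> 1 \<and> F ?y x - F t0 x = (?y - t0) * F' z x"
      proof (cases "t0 < ?y")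
        case True
        from MVT2[OF this, of "\<lambda>t. F t x" "\<lambda>t. F' t x"] deriv[OF x]
        obtain z where "t0 < z" "z < ?y" "F ?y x - F t0 x = (?y - t0) * F' z x" by blast
        then show ?thesis using y by (intro exI[of _ z]) auto
      next
        case False
        then have "?y < t0" using y by simp
        from MVT2[OF this, of "\<lambda>t. F t x" "\<lambda>t. F' t x"] deriv[OF x]
        obtain z where "?y < z" "z < t0" "F t0 x - F ?y x = (t0 - ?y) * F' z x" by blast
        then show ?thesis using y by (intro exI[of _ z]) (auto simp: algebra_simps)
      qed
      then obtain z where "\<bar>z - t0\<bar> \<le> 1" "F ?y x - F t0 x = (?y - t0) * F' z x" by blast
      then show "norm ((F ?y x - F t0 x) / (?y - t0)) \<le> w x" using y(2) bound[OF x] by simp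
    qed
  qed (rule w)
  then have "(\<lambda>n. (integral\<^sup>L M (F (X (n + N))) - integral\<^sup>L M (F t0)) / (X (n + N) - t0)) \<longlonglongrightarrow> integral\<^sup>L M (F' t0)"
    by (simp only: q)
  then show "(\<lambda>n. (integral\<^sup>L M (F (X n)) - integral\<^sup>L M (F t0)) / (X n - t0)) \<longlonglongrightarrow> integral\<^sup>L M (F' t0)"
    by (rule LIMSEQ_offset)
qed

lemma has_real_derivative_msym_integral:
  fixes \<phi> \<psi> :: "real ^ 'n \<Rightarrow> real" and A B :: "real ^ 'n \<Rightarrow> real ^ 'n ^ 'n"
  assumes K: "compact K" and S: "S \<in> sets borel" "S \<subseteq> K"
    and cont: "continuous_on K \<phi>" "continuous_on K \<psi>" "continuous_on K A" "continuous_on K B"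
  shows "((\<lambda>t. LINT x:S|lborel. (\<phi> x + t * \<psi> x) * msym k (A x + t *\<^sub>R B x)) has_real_derivative
    (LINT x:S|lborel. \<psi> x * msym k (A x + t0 *\<^sub>R B x) + (\<phi> x + t0 * \<psi> x) * dmsym k (A x + t0 *\<^sub>R B x) (B x))) (at t0)"
proof -
  let ?F = "\<lambda>t x. (\<phi> x + t * \<psi> x) * msym k (A x + t *\<^sub>R B x)"
  let ?F' = "\<lambda>t x. \<psi> x * msym k (A x + t *\<^sub>R B x) + (\<phi> x + t * \<psi> x) * dmsym k (A x + t *\<^sub>R B x) (B x)"
  have cF: "continuous_on K (?F t)" for t by (intro continuous_intros continuous_on_msym cont)
  have cF': "continuous_on K (?F' t)" for t by (intro continuous_intros continuous_on_msym continuous_on_dmsym cont)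
  have int: "integrable lborel (\<lambda>x. indicator S x *\<^sub>R f x)" if "continuous_on K f" for f :: "_ \<Rightarrow> real"
  proof -
    have "set_integrable lborel K f" unfolding set_integrable_def using K that by (rule borel_integrable_compact)
    then have "set_integrable lborel S f" using S by (auto intro: set_integrable_subset)
    then show ?thesis by (simp add: set_integrable_def)
  qed
  have "continuous_on ({t0 - 1..t0 + 1} \<times> K) (\<lambda>p. ?F' (fst p) (snd p))"
  proof -
    have "continuous_on ({t0 - 1..t0 + 1} \<times> K) (\<lambda>p. f (snd p))" if "continuous_on K f" for f :: "real ^ 'n \<Rightarrow> 'z::topological_space"
      by (rule continuous_on_compose2[OF that continuous_on_snd]) (auto intro: continuous_on_id)
    note this[OF cont(1)] this[OF cont(2)] this[OF cont(3)] this[OF cont(4)]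
    then show ?thesis by (intro continuous_intros continuous_on_msym continuous_on_dmsym)
  qed
  then have "bounded ((\<lambda>p. ?F' (fst p) (snd p)) ` ({t0 - 1..t0 + 1} \<times> K))"
    using K by (intro compact_imp_bounded compact_continuous_image compact_Times) auto
  then obtain C where C: "\<And>t x. t \<in> {t0 - 1..t0 + 1} \<Longrightarrow> x \<in> K \<Longrightarrow> \<bar>?F' t x\<bar> \<le> C"
    by (force simp: bounded_iff)
  have "((\<lambda>t. \<integral>x. indicator S x *\<^sub>R ?F t x \<partial>lborel) has_real_derivative
      (\<integral>x. indicator S x *\<^sub>R ?F' t0 x \<partial>lborel)) (at t0)"
  proof (rule has_real_derivative_integral[where w = "\<lambda>x. indicator S x *\<^sub>R C" and F' = "\<lambda>t x. indicator S x *\<^sub>R ?F' t x"])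
    fix t x
    have "((\<lambda>t. ?F t x) has_real_derivative ?F' t x) (at t)"
      by (auto intro!: derivative_eq_intros has_real_derivative_msym_line)
    then show "((\<lambda>t. indicator S x *\<^sub>R ?F t x) has_real_derivative indicator S x *\<^sub>R ?F' t x) (at t)"
      unfolding real_scaleR_def by (rule DERIV_cmult)
  next
    fix t x assume "\<bar>t - t0\<bar> \<le> 1"
    then have "t \<in> {t0 - 1..t0 + 1}" by auto
    then show "\<bar>indicator S x *\<^sub>R ?F' t x\<bar> \<le> indicator S x *\<^sub>R C" using C[of t x] S(2)
      by (cases "x \<in> S") auto
  next
    show "(\<lambda>x. indicator S x *\<^sub>R ?F' t0 x) \<in> borel_measurable lborel" using int[OF cF'[of t0]] by auto
  qed (use int[OF cF] int[of "\<lambda>_. C"] in auto)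
  then show ?thesis by (simp only: set_lebesgue_integral_def)
qed

subsection \<open>Integration by parts\<close>

text \<open>The field \<open>cut f * Gv + s * \<eta> f * Gg\<close> has compact support in
  \<open>D\<close>, because \<open>f\<close> vanishes on the boundary. The null Lagrangian identity
  holds for every \<open>s\<close>, and its derivative at \<open>s = 0\<close> is the claim: where
  \<open>\<eta>\<close> is active the cutoff is \<open>1\<close>, so the linearization is taken at
  \<open>Hv\<close> itself.\<close>

lemma ibp_truncated:
  fixes D :: "(real ^ 'n) set"
  assumes D: "open D" "bounded D" and k: "1 \<le> k"
    and v: "C2 D v Gv Hv" and g: "C2 D g Gg Hg" and f: "C2 D f Gf Hf"
    and fc: "continuous_on (closure D) f" and f0: "\<And>x. x \<in> frontier D \<Longrightarrow> f x = 0"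
    and e: "0 < e"
  shows "(LINT x:D|lborel. dmsym k (Hv x) (- spline e (- f x - 2 * e) *\<^sub>R Hg x + outer (Gg x) (spline1 e (- f x - 2 * e) *\<^sub>R Gf x))) = 0"
proof -
  \<comment> \<open>\<open>\<eta>\<close> is a smooth version of \<open>min 0 (t + 2 * e)\<close>
    that vanishes for \<open>t \<ge> - e\<close>, while \<open>cut\<close> is \<open>1\<close> for
    \<open>t \<le> - e\<close> and \<open>0\<close> for \<open>t \<ge> - e / 2\<close>; shift
    \<open>3/4 * e\<close> and width \<open>e/4\<close> place its transition in between.\<close>
  define \<eta> where "\<eta> t = - spline e (- t - 2 * e)" for t
  define \<eta>1 where "\<eta>1 t = spline1 e (- t - 2 * e)" for t
  define cut where "cut t = spline1 (e/4) (- t - 3/4 * e)" for t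
  define cut1 where "cut1 t = - spline2 (e/4) (- t - 3/4 * e)" for t
  have e4: "0 < e / 4" using e by simp
  have d\<eta>: "(\<eta> has_real_derivative \<eta>1 t) (at t)" for t
  proof -
    have "((\<lambda>t. spline e (- t - 2 * e)) has_real_derivative spline1 e (- t - 2 * e) * (- 1)) (at t)"
      by (rule DERIV_chain2[OF has_real_derivative_spline[OF e]]) (auto intro!: derivative_eq_intros)
    from DERIV_minus[OF this] show ?thesis unfolding \<eta>_def[abs_def] \<eta>1_def by simp
  qed
  have dcut: "(cut has_real_derivative cut1 t) (at t)" for t
  proof -
    have "((\<lambda>t. spline1 (e/4) (- t - 3/4 * e)) has_real_derivative spline2 (e/4) (- t - 3/4 * e) * (- 1)) (at t)"
      by (rule DERIV_chain2[OF has_real_derivative_spline1[OF e4]]) (auto intro!: derivative_eq_intros)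
    then show ?thesis unfolding cut_def[abs_def] cut1_def by simp
  qed
  have c\<eta>1: "continuous_on UNIV \<eta>1" unfolding \<eta>1_def
    by (intro continuous_on_compose2[OF continuous_on_spline(2)[OF e, of UNIV]] continuous_intros) auto
  have ccut1: "continuous_on UNIV cut1" unfolding cut1_def
    by (intro continuous_on_minus continuous_on_compose2[OF continuous_spline2[of UNIV]] continuous_intros) auto
  have c\<eta>: "continuous_on UNIV \<eta>" using d\<eta> DERIV_isCont by (blast intro: continuous_at_imp_continuous_on)
  have ccut: "continuous_on UNIV cut" using dcut DERIV_isCont by (blast intro: continuous_at_imp_continuous_on)
  have off: "\<eta> t = 0 \<and> \<eta>1 t = 0" if "- e \<le> t" for t using that e spline_low[of "- t - 2 * e" e] by (auto simp: \<eta>_def \<eta>1_def)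
  have off': "cut t = 0 \<and> cut1 t = 0" if "- e / 2 \<le> t" for t using that e spline_low[of "- t - 3/4 * e" "e/4"] by (auto simp: cut_def cut1_def)
  have on: "cut t = 1 \<and> cut1 t = 0" if "t \<le> - e" for t using that e spline_high[of "e/4" "- t - 3/4 * e"] by (auto simp: cut_def cut1_def)
  \<comment> \<open>All fields vanish off the closed set \<open>L\<close>, which lies inside
    \<open>D\<close>; continuity and differentiability are checked on the open cover by
    \<open>D\<close> and \<open>- L\<close>.\<close>
  define L where "L = {x \<in> closure D. f x \<le> - e / 2}"
  have "L = closure D \<inter> f -` {..- e / 2}" by (auto simp: L_def)
  then have clL: "closed L" using continuous_closed_preimage[OF fc closed_closure closed_atMost] by simp
  have LD: "L \<subseteq> D"
  proof
    fix x assume x: "x \<in> L"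
    show "x \<in> D"
    proof (rule ccontr)
      assume "x \<notin> D"
      then have "x \<in> frontier D" using x D(1) by (auto simp: L_def frontier_def interior_open)
      then show False using f0 x e by (auto simp: L_def)
    qed
  qed
  have Lx: "- e / 2 < f x" if "x \<in> D" "x \<notin> L" for x using that closure_subset by (auto simp: L_def)
  define A where "A x = (if x \<in> D then cut (f x) *\<^sub>R Hv x + outer (Gv x) (cut1 (f x) *\<^sub>R Gf x) else 0)" for x
  define B where "B x = (if x \<in> D then \<eta> (f x) *\<^sub>R Hg x + outer (Gg x) (\<eta>1 (f x) *\<^sub>R Gf x) else 0)" for x
  define \<Phi> where "\<Phi> s x = (if x \<in> D then cut (f x) *\<^sub>R Gv x + s *\<^sub>R (\<eta> (f x) *\<^sub>R Gg x) else 0)" for s x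
  have z: "A x = 0" "B x = 0" "\<Phi> s x = 0" if "x \<in> - L" for x s
    using Lx[of x] that off[of "f x"] off'[of "f x"] e
    by (auto simp: A_def B_def \<Phi>_def outer_def vec_eq_iff)
  have UN: "D \<union> - L = UNIV" using LD by auto
  have co: "continuous_on S (\<lambda>x. outer (a x) (b x))" if "continuous_on S a" "continuous_on S b"
    for S :: "(real ^ 'n) set" and a b :: "real ^ 'n \<Rightarrow> real ^ 'n"
    unfolding outer_def by (intro continuous_intros that)
  have cf: "continuous_on D (\<lambda>x. q (f x))" if "continuous_on UNIV q" for q :: "real \<Rightarrow> real"
    by (rule continuous_on_compose2[OF that C2D(3)[OF f]]) auto
  have contA: "continuous_on UNIV A"
  proof -
    have "continuous_on D A"
      by (rule continuous_on_eq[of _ "\<lambda>x. cut (f x) *\<^sub>R Hv x + outer (Gv x) (cut1 (f x) *\<^sub>R Gf x)"])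
        (auto simp: A_def intro!: continuous_intros co cf ccut ccut1 C2D[OF v] C2D[OF f])
    moreover have "continuous_on (- L) A" by (rule continuous_on_eq[of _ "\<lambda>x. 0"]) (auto simp: z)
    ultimately show ?thesis using continuous_on_open_Un[of D "- L" A] D(1) clL UN by (simp add: open_Compl)
  qed
  have contB: "continuous_on UNIV B"
  proof -
    have "continuous_on D B"
      by (rule continuous_on_eq[of _ "\<lambda>x. \<eta> (f x) *\<^sub>R Hg x + outer (Gg x) (\<eta>1 (f x) *\<^sub>R Gf x)"])
        (auto simp: B_def intro!: continuous_intros co cf c\<eta> c\<eta>1 C2D[OF g] C2D[OF f])
    moreover have "continuous_on (- L) B" by (rule continuous_on_eq[of _ "\<lambda>x. 0"]) (auto simp: z)
    ultimately show ?thesis using continuous_on_open_Un[of D "- L" B] D(1) clL UN by (simp add: open_Compl)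
  qed
  have der: "(\<Phi> s has_derivative (\<lambda>h. (A x + s *\<^sub>R B x) *v h)) (at x)" for s x
  proof (cases "x \<in> D")
    case True
    have df: "((\<lambda>x. q (f x)) has_derivative (\<lambda>h. q1 (f x) * (Gf x \<bullet> h))) (at x)"
      if "\<And>t. (q has_real_derivative q1 t) (at t)" for q q1
      using has_derivative_compose[OF C2D(1)[OF f True] that[of "f x", unfolded has_field_derivative_def]] .
    have "((\<lambda>x. cut (f x) *\<^sub>R Gv x + s *\<^sub>R (\<eta> (f x) *\<^sub>R Gg x)) has_derivative
       (\<lambda>h. (cut (f x) *\<^sub>R (Hv x *v h) + (cut1 (f x) * (Gf x \<bullet> h)) *\<^sub>R Gv x) +
         s *\<^sub>R (\<eta> (f x) *\<^sub>R (Hg x *v h) + (\<eta>1 (f x) * (Gf x \<bullet> h)) *\<^sub>R Gg x))) (at x)"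
      by (intro has_derivative_add has_derivative_scaleR_right has_derivative_scaleR df dcut d\<eta> C2D(2)[OF v True] C2D(2)[OF g True])
    moreover have "(cut (f x) *\<^sub>R (Hv x *v h) + (cut1 (f x) * (Gf x \<bullet> h)) *\<^sub>R Gv x) +
         s *\<^sub>R (\<eta> (f x) *\<^sub>R (Hg x *v h) + (\<eta>1 (f x) * (Gf x \<bullet> h)) *\<^sub>R Gg x) = (A x + s *\<^sub>R B x) *v h" for h
      using True by (simp add: A_def B_def matrix_vector_mult_add_rdistrib scaleR_matrix_vector_assoc[symmetric] outer_mult)
    ultimately have "((\<lambda>x. cut (f x) *\<^sub>R Gv x + s *\<^sub>R (\<eta> (f x) *\<^sub>R Gg x)) has_derivative (\<lambda>h. (A x + s *\<^sub>R B x) *v h)) (at x)"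
      by simp
    then show ?thesis
      by (rule has_derivative_transform_within_open[OF _ D(1) True]) (simp add: \<Phi>_def)
  next
    case False
    then have x: "x \<in> - L" using LD by auto
    have "((\<lambda>x. 0) has_derivative (\<lambda>h. (A x + s *\<^sub>R B x) *v h)) (at x)" using z(1,2)[OF x] by simp
    then show ?thesis
      by (rule has_derivative_transform_within_open[OF _ _ x]) (use clL z in \<open>auto simp: open_Compl\<close>)
  qed
  obtain a b where ab: "D \<subseteq> cbox a b" using D(2) bounded_subset_cbox_symmetric by metis
  have "(LINT x:cbox a b|lborel. msym k (A x + s *\<^sub>R B x)) = 0" for s
  proof (rule integral_msym_compact_support[OF der _ _ _ k])
    show "continuous_on UNIV (\<lambda>x. A x + s *\<^sub>R B x)" by (intro continuous_intros contA contB)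
  qed (use ab in \<open>auto simp: \<Phi>_def A_def B_def\<close>)
  then have "((\<lambda>s. LINT x:cbox a b|lborel. (1 + s * 0) * msym k (A x + s *\<^sub>R B x)) has_real_derivative 0) (at 0)"
    by simp
  moreover have "((\<lambda>s. LINT x:cbox a b|lborel. (1 + s * 0) * msym k (A x + s *\<^sub>R B x)) has_real_derivative
     (LINT x:cbox a b|lborel. 0 * msym k (A x + 0 *\<^sub>R B x) + (1 + 0 * 0) * dmsym k (A x + 0 *\<^sub>R B x) (B x))) (at 0)"
    by (rule has_real_derivative_msym_integral[of "cbox a b"])
      (auto intro: continuous_on_subset[OF contA] continuous_on_subset[OF contB])
  ultimately have "(LINT x:cbox a b|lborel. dmsym k (A x) (B x)) = 0"
    using DERIV_unique by fastforce
  \<comment> \<open>Either \<open>f x \<le> - e\<close>, where the cutoff is constantly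
    \<open>1\<close>, or \<open>\<eta>\<close> and \<open>\<eta>1\<close> vanish and both sides are
    \<open>0\<close>.\<close>
  moreover have "indicator (cbox a b) x *\<^sub>R dmsym k (A x) (B x) =
      indicator D x *\<^sub>R dmsym k (Hv x) (\<eta> (f x) *\<^sub>R Hg x + outer (Gg x) (\<eta>1 (f x) *\<^sub>R Gf x))" for x
  proof (cases "x \<in> D")
    case True
    show ?thesis
    proof (cases "f x \<le> - e")
      case le: True
      have "outer (Gv x) (0 *\<^sub>R Gf x) = 0" by (simp add: outer_def vec_eq_iff)
      then show ?thesis using True ab on[OF le] by (auto simp: A_def B_def)
    next
      case False
      have "outer (Gg x) (0 *\<^sub>R Gf x) = 0" by (simp add: outer_def vec_eq_iff)
      then show ?thesis using True off[of "f x"] False by (auto simp: B_def)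
    qed
  qed (simp add: B_def)
  ultimately show ?thesis by (simp add: set_lebesgue_integral_def \<eta>_def \<eta>1_def)
qed

lemma zero_gradient_at_max:
  assumes "C2 D f G H" "open D" "x \<in> D" "\<And>y. y \<in> D \<Longrightarrow> f y \<le> f x"
  shows "G x = 0"
proof -
  have "(\<lambda>h. G x \<bullet> h) = (\<lambda>h. 0)"
    by (rule differential_zero_maxmin[OF assms(3,2) C2D(1)[OF assms(1,3)]]) (use assms(4) in auto)
  then show ?thesis by (metis inner_eq_zero_iff)
qed

lemma continuous_on_outer:
  "continuous_on S a \<Longrightarrow> continuous_on S b \<Longrightarrow> continuous_on S (\<lambda>x. outer (a x) (b x))"
  unfolding outer_def by (intro continuous_intros)

lemma outer_scaleR_right: "outer a (c *\<^sub>R b) = c *\<^sub>R outer a b"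
  by (simp add: outer_def vec_eq_iff)

lemma outer_diff: "outer (a - b) c = outer a c - outer b c" "outer c (a - b) = outer c a - outer c b"
  by (simp_all add: outer_def vec_eq_iff algebra_simps)

lemma outer_0 [simp]: "outer a 0 = 0" "outer 0 a = 0"
  by (simp_all add: outer_def vec_eq_iff)

text \<open>The limit of the truncated identity as \<open>e\<close> tends to \<open>0\<close>, by
  dominated convergence: where \<open>f < 0\<close> the truncation tends to \<open>f\<close> and its
  slope to \<open>1\<close>. The condition \<open>f \<le> 0\<close> is what makes this one-sided
  truncation sufficient.\<close>

proposition integration_by_parts:
  fixes D :: "(real ^ 'n) set"
  assumes D: "open D" "bounded D" and k: "1 \<le> k"
    and v: "C2 D v Gv Hv" "continuous_on (closure D) Hv"
    and g: "C2 D g Gg Hg" "continuous_on (closure D) Gg" "continuous_on (closure D) Hg"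
    and f: "C2 D f Gf Hf" "continuous_on (closure D) f" "continuous_on (closure D) Gf"
    and f0: "\<And>x. x \<in> frontier D \<Longrightarrow> f x = 0" and f1: "\<And>x. x \<in> D \<Longrightarrow> f x \<le> 0"
  shows "(LINT x:D|lborel. f x * dmsym k (Hv x) (Hg x)) = - (LINT x:D|lborel. dmsym k (Hv x) (outer (Gg x) (Gf x)))"
proof -
  define a where "a x = dmsym k (Hv x) (Hg x)" for x
  define b where "b x = dmsym k (Hv x) (outer (Gg x) (Gf x))" for x
  have ca: "continuous_on (closure D) a" unfolding a_def by (intro continuous_on_dmsym v g)
  have cb: "continuous_on (closure D) b" unfolding b_def by (intro continuous_on_dmsym continuous_on_outer v g f)
  define e where "e n = inverse (real (Suc n))" for n
  have e: "0 < e n" for n by (simp add: e_def)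
  have e_lim: "e \<longlonglongrightarrow> 0" unfolding e_def by (rule LIMSEQ_inverse_real_of_nat)
  define F where "F n x = - spline (e n) (- f x - 2 * e n) * a x + spline1 (e n) (- f x - 2 * e n) * b x" for n x
  have F0: "(LINT x:D|lborel. F n x) = 0" for n
    using ibp_truncated[OF D k v(1) g(1) f(1,2) f0 e, of n]
    by (simp add: F_def a_def b_def dmsym_add dmsym_diff dmsym_scaleR outer_scaleR_right)
  have cF: "continuous_on (closure D) (F n)" for n
  proof -
    have "continuous_on (closure D) (\<lambda>x. - f x - 2 * e n)" by (intro continuous_intros f)
    then show ?thesis unfolding F_def
      by (intro continuous_intros ca cb continuous_on_compose2[OF continuous_on_spline(1)[OF e, of UNIV]]
          continuous_on_compose2[OF continuous_on_spline(2)[OF e, of UNIV]]) (auto intro: f(2))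
  qed
  have int: "integrable lborel (\<lambda>x. indicator D x *\<^sub>R q x)" if "continuous_on (closure D) q" for q :: "_ \<Rightarrow> real"
    using set_integrable_closure[OF D that] by (simp add: set_integrable_def)
  have cc: "continuous_on (closure D) (\<lambda>x. f x * a x + b x)" by (intro continuous_intros f ca cb)
  have "(\<lambda>n. \<integral>x. indicator D x *\<^sub>R F n x \<partial>lborel) \<longlonglongrightarrow> (\<integral>x. indicator D x *\<^sub>R (f x * a x + b x) \<partial>lborel)"
  proof (rule integral_dominated_convergence[where w = "\<lambda>x. indicator D x *\<^sub>R (\<bar>f x\<bar> * \<bar>a x\<bar> + \<bar>b x\<bar>)"])
    show "AE x in lborel. (\<lambda>n. indicator D x *\<^sub>R F n x) \<longlonglongrightarrow> indicator D x *\<^sub>R (f x * a x + b x)"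
    proof (intro AE_I2)
      fix x
      show "(\<lambda>n. indicator D x *\<^sub>R F n x) \<longlonglongrightarrow> indicator D x *\<^sub>R (f x * a x + b x)"
      proof (cases "x \<in> D")
        case True
        \<comment> \<open>An interior zero of \<open>f\<close> is a maximum, so the gradient
          vanishes there and the limit agrees with the vanishing truncations.\<close>
        have "F n x = 0" if "f x = 0" for n using that e[of n] spline_low[of "- 2 * e n" "e n"] by (simp add: F_def)
        moreover have "b x = 0" if "f x = 0"
          using zero_gradient_at_max[OF f(1) D(1) True] that f1 by (simp add: b_def)
        moreover have "(\<lambda>n. F n x) \<longlonglongrightarrow> f x * a x + b x" if "f x < 0"
        proof -
          have "\<forall>\<^sub>F n in sequentially. e n < - f x / 3" using that by (intro order_tendstoD(2)[OF e_lim]) auto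
          then have "\<forall>\<^sub>F n in sequentially. (f x + 2 * e n) * a x + b x = F n x"
          proof eventually_elim
            case (elim n)
            then have "e n \<le> - f x - 2 * e n" by simp
            from spline_high[OF this e] show ?case by (simp add: F_def)
          qed
          moreover have "(\<lambda>n. (f x + 2 * e n) * a x + b x) \<longlonglongrightarrow> (f x + 2 * 0) * a x + b x"
            by (intro tendsto_intros e_lim)
          ultimately show ?thesis by (simp add: tendsto_cong)
        qed
        ultimately show ?thesis using f1[OF True] True by (cases "f x = 0") auto
      qed simp
    qed
    show "AE x in lborel. norm (indicator D x *\<^sub>R F n x) \<le> indicator D x *\<^sub>R (\<bar>f x\<bar> * \<bar>a x\<bar> + \<bar>b x\<bar>)" for n
    proof (intro AE_I2)
      fix x
      show "norm (indicator D x *\<^sub>R F n x) \<le> indicator D x *\<^sub>R (\<bar>f x\<bar> * \<bar>a x\<bar> + \<bar>b x\<bar>)"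
      proof (cases "x \<in> D")
        case True
        have "\<bar>spline (e n) (- f x - 2 * e n)\<bar> \<le> \<bar>f x\<bar>"
          using spline_bounds[OF e, of n "- f x - 2 * e n"] e[of n] f1[OF True] by (auto simp: max_def split: if_splits)
        moreover have "\<bar>spline1 (e n) (- f x - 2 * e n)\<bar> \<le> 1"
          using spline1_bounds[OF e, of n "- f x - 2 * e n"] by auto
        ultimately have "\<bar>spline (e n) (- f x - 2 * e n)\<bar> * \<bar>a x\<bar> + \<bar>spline1 (e n) (- f x - 2 * e n)\<bar> * \<bar>b x\<bar> \<le> \<bar>f x\<bar> * \<bar>a x\<bar> + 1 * \<bar>b x\<bar>"
          by (intro add_mono mult_right_mono) auto
        moreover have "\<bar>F n x\<bar> \<le> \<bar>spline (e n) (- f x - 2 * e n)\<bar> * \<bar>a x\<bar> + \<bar>spline1 (e n) (- f x - 2 * e n)\<bar> * \<bar>b x\<bar>"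
          unfolding F_def abs_mult[symmetric] by linarith
        ultimately show ?thesis using True by simp
      qed simp
    qed
    show "(\<lambda>x. indicator D x *\<^sub>R F n x) \<in> borel_measurable lborel" for n using int[OF cF[of n]] by auto
    show "(\<lambda>x. indicator D x *\<^sub>R (f x * a x + b x)) \<in> borel_measurable lborel"
      using int[OF cc] by (rule borel_measurable_integrable)
    show "integrable lborel (\<lambda>x. indicator D x *\<^sub>R (\<bar>f x\<bar> * \<bar>a x\<bar> + \<bar>b x\<bar>))"
      by (intro int continuous_intros f ca cb)
  qed
  then have "(\<integral>x. indicator D x *\<^sub>R (f x * a x + b x) \<partial>lborel) = 0"
    using F0 by (simp add: set_lebesgue_integral_def LIMSEQ_const_iff)
  then have "(LINT x:D|lborel. f x * a x) + (LINT x:D|lborel. b x) = 0"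
    using set_integral_add(2)[of lborel D "\<lambda>x. f x * a x" b] set_integrable_closure[OF D] f(2) ca cb
    by (simp add: set_lebesgue_integral_def continuous_intros)
  then show ?thesis by (simp add: a_def b_def)
qed

section \<open>Admissible functions and convexity of the energy\<close>

text \<open>The sign condition is part of the class because integration by parts uses it; for
  \<open>k\<close>-convex functions it follows from the maximum principle, see
  \<open>adm_of_k_convex\<close>.\<close>

definition adm :: "nat \<Rightarrow> (real ^ 'n) set \<Rightarrow> (real ^ 'n \<Rightarrow> real) \<Rightarrow> (real ^ 'n \<Rightarrow> real ^ 'n) \<Rightarrow> (real ^ 'n \<Rightarrow> real ^ 'n ^ 'n) \<Rightarrow> bool" where
  "adm k D f G H \<longleftrightarrow> C2 D f G H \<and> continuous_on (closure D) f \<and> continuous_on (closure D) G \<and> continuous_on (closure D) H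
     \<and> (\<forall>x\<in>frontier D. f x = 0) \<and> (\<forall>x\<in>D. f x \<le> 0) \<and> (\<forall>x\<in>D. H x \<in> closed_cone k)"

lemma admD:
  assumes "adm k D f G H"
  shows "C2 D f G H" "continuous_on (closure D) f" "continuous_on (closure D) G" "continuous_on (closure D) H"
    "x \<in> frontier D \<Longrightarrow> f x = 0" "x \<in> D \<Longrightarrow> f x \<le> 0" "x \<in> D \<Longrightarrow> H x \<in> closed_cone k"
  using assms by (auto simp: adm_def)

lemma adm_add:
  assumes "adm k D f G H" "adm k D f' G' H'" "k \<le> CARD('n)"
  shows "adm k (D :: (real ^ 'n) set) (\<lambda>x. f x + f' x) (\<lambda>x. G x + G' x) (\<lambda>x. H x + H' x)"
  using assms unfolding adm_def
  by (auto intro!: C2_add continuous_intros closed_cone_add add_nonpos_nonpos)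

lemma adm_scale:
  assumes "adm k D f G H" "0 \<le> c"
  shows "adm k D (\<lambda>x. c * f x) (\<lambda>x. c *\<^sub>R G x) (\<lambda>x. c *\<^sub>R H x)"
  using assms unfolding adm_def
  by (auto intro!: C2_scale continuous_intros closed_cone_scale simp: mult_nonneg_nonpos)

text \<open>Along the segment from \<open>v\<close> to \<open>w\<close> the energy has derivative
  \<open>(k + 1) N t\<close>, and \<open>N\<close> is nondecreasing because its derivative is the
  integral of the linearized operator on \<open>outer (Gh x) (Gh x)\<close>. The energy is therefore
  convex, and the claim is its tangent inequality at \<open>v\<close>.\<close>

proposition energy_convexity:
  fixes D :: "(real ^ 'n) set"
  assumes D: "open D" "bounded D" and k: "1 \<le> k" "k \<le> CARD('n)"
    and v: "adm k D v Gv Hv" and w: "adm k D w Gw Hw"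
  shows "(real k + 1) * (LINT x:D|lborel. - w x * msym k (Hv x)) \<le>
    (LINT x:D|lborel. - w x * msym k (Hw x)) + real k * (LINT x:D|lborel. - v x * msym k (Hv x))"
proof -
  note v' = admD[OF v] and w' = admD[OF w]
  define h where "h x = w x - v x" for x
  define Gh where "Gh x = Gw x - Gv x" for x
  define B where "B x = Hw x - Hv x" for x
  define V where "V t x = Hv x + t *\<^sub>R B x" for t x
  define u where "u t x = v x + t * h x" for t x
  define Gu where "Gu t x = Gv x + t *\<^sub>R Gh x" for t x
  have ch: "continuous_on (closure D) h" "continuous_on (closure D) Gh" "continuous_on (closure D) B"
    unfolding h_def Gh_def B_def by (intro continuous_intros v' w')+
  have C2h: "C2 D h Gh B"
    using C2_add[OF w'(1) C2_scale[OF v'(1), of "-1"]] by (simp add: h_def[abs_def] Gh_def[abs_def] B_def[abs_def])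
  have uadm: "adm k D (u t) (Gu t) (V t)" if "t \<in> {0..1}" for t
  proof -
    have "adm k D (\<lambda>x. (1 - t) * v x + t * w x) (\<lambda>x. (1 - t) *\<^sub>R Gv x + t *\<^sub>R Gw x) (\<lambda>x. (1 - t) *\<^sub>R Hv x + t *\<^sub>R Hw x)"
      using that by (intro adm_add adm_scale v w k) auto
    then show ?thesis
      by (simp add: u_def[abs_def] Gu_def[abs_def] V_def[abs_def] h_def Gh_def B_def algebra_simps)
  qed
  have int: "set_integrable lborel D q" if "continuous_on (closure D) q" for q :: "_ \<Rightarrow> real"
    using that by (rule set_integrable_closure[OF D])
  have neg: "(LINT x:D|lborel. - q x) = - (LINT x:D|lborel. q x)" for q :: "_ \<Rightarrow> real"
    by (simp add: set_lebesgue_integral_def)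
  have split: "(LINT x:D|lborel. p x + q x) = (LINT x:D|lborel. p x) + (LINT x:D|lborel. q x)"
    "(LINT x:D|lborel. p x - q x) = (LINT x:D|lborel. p x) - (LINT x:D|lborel. q x)"
    if "continuous_on (closure D) p" "continuous_on (closure D) q" for p q :: "_ \<Rightarrow> real"
    using set_integral_add(2)[OF int[OF that(1)] int[OF that(2)]]
      set_integral_diff(2)[OF int[OF that(1)] int[OF that(2)]] by auto
  define N where "N t = (LINT x:D|lborel. - h x * msym k (V t x))" for t
  define E where "E t = (LINT x:D|lborel. - u t x * msym k (V t x))" for t
  have ibph: "(LINT x:D|lborel. h x * dmsym k (V t x) (Hg x)) = - (LINT x:D|lborel. dmsym k (V t x) (outer (Gg x) (Gh x)))"
    if t: "t \<in> {0..1}" and g: "C2 D g Gg Hg" "continuous_on (closure D) Gg" "continuous_on (closure D) Hg" for t g Gg Hg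
  proof -
    note V = admD(1,4)[OF uadm[OF t]]
    have "(LINT x:D|lborel. w x * dmsym k (V t x) (Hg x)) = - (LINT x:D|lborel. dmsym k (V t x) (outer (Gg x) (Gw x)))"
      by (rule integration_by_parts[OF D k(1) V g w'(1-3)]) (use w' in auto)
    moreover have "(LINT x:D|lborel. v x * dmsym k (V t x) (Hg x)) = - (LINT x:D|lborel. dmsym k (V t x) (outer (Gg x) (Gv x)))"
      by (rule integration_by_parts[OF D k(1) V g v'(1-3)]) (use v' in auto)
    moreover have "(LINT x:D|lborel. h x * dmsym k (V t x) (Hg x)) =
        (LINT x:D|lborel. w x * dmsym k (V t x) (Hg x)) - (LINT x:D|lborel. v x * dmsym k (V t x) (Hg x))"
      unfolding h_def left_diff_distrib by (intro split continuous_intros continuous_on_dmsym V g w' v')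
    moreover have "(LINT x:D|lborel. dmsym k (V t x) (outer (Gg x) (Gh x))) =
        (LINT x:D|lborel. dmsym k (V t x) (outer (Gg x) (Gw x))) - (LINT x:D|lborel. dmsym k (V t x) (outer (Gg x) (Gv x)))"
      unfolding Gh_def outer_diff dmsym_diff by (intro split continuous_on_dmsym continuous_on_outer V g w' v')
    ultimately show ?thesis by simp
  qed
  have dN: "(N has_real_derivative (LINT x:D|lborel. - h x * dmsym k (V t x) (B x))) (at t)" for t
    using has_real_derivative_msym_integral[of "closure D" D "\<lambda>x. - h x" "\<lambda>x. 0" Hv B k t] D v' ch closure_subset[of D]
    by (simp add: N_def[abs_def] V_def compact_closure continuous_intros)
  have dN0: "0 \<le> (LINT x:D|lborel. - h x * dmsym k (V t x) (B x))" if t: "t \<in> {0..1}" for t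
  proof -
    have "(LINT x:D|lborel. - h x * dmsym k (V t x) (B x)) = (LINT x:D|lborel. dmsym k (V t x) (outer (Gh x) (Gh x)))"
      using ibph[OF t C2h ch(2,3)] neg by simp
    also have "0 \<le> \<dots>"
    proof -
      have "0 \<le> dmsym k (V t x) (outer (Gh x) (Gh x))" if "x \<in> D" for x
        using admD(7)[OF uadm[OF t] that] by (intro dmsym_nonneg outer_closed_cone k)
      then show ?thesis unfolding set_lebesgue_integral_def
        by (intro Bochner_Integration.integral_nonneg) (auto simp: indicator_def)
    qed
    finally show ?thesis .
  qed
  \<comment> \<open>Two integrations by parts, with a transposition of the rank-one matrix in
    between, exchange the roles of \<open>h\<close> and \<open>u t\<close>; Euler's relation then
    turns the second term of the product rule into \<open>real k * N t\<close>.\<close>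
  have dE: "(E has_real_derivative (real k + 1) * N t) (at t)" if t: "t \<in> {0..1}" for t
  proof -
    note U = admD[OF uadm[OF t]]
    have "(E has_real_derivative (LINT x:D|lborel. - h x * msym k (V t x) + - u t x * dmsym k (V t x) (B x))) (at t)"
      using has_real_derivative_msym_integral[of "closure D" D "\<lambda>x. - v x" "\<lambda>x. - h x" Hv B k t] D v' ch closure_subset[of D]
      by (simp add: E_def[abs_def] V_def u_def compact_closure continuous_intros)
    also have "(LINT x:D|lborel. - h x * msym k (V t x) + - u t x * dmsym k (V t x) (B x)) =
        N t + (LINT x:D|lborel. - u t x * dmsym k (V t x) (B x))"
      unfolding N_def by (intro split continuous_intros continuous_on_msym continuous_on_dmsym ch U)
    also have "(LINT x:D|lborel. - u t x * dmsym k (V t x) (B x)) = (LINT x:D|lborel. dmsym k (V t x) (outer (Gh x) (Gu t x)))"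
      using integration_by_parts[OF D k(1) U(1,4) C2h ch(2,3) U(1-3)] U(5,6) neg by simp
    also have "\<dots> = (LINT x:D|lborel. dmsym k (V t x) (outer (Gu t x) (Gh x)))"
      unfolding set_lebesgue_integral_def
    proof (intro Bochner_Integration.integral_cong refl)
      fix x
      show "indicator D x *\<^sub>R dmsym k (V t x) (outer (Gh x) (Gu t x)) = indicator D x *\<^sub>R dmsym k (V t x) (outer (Gu t x) (Gh x))"
        using U(7)[of x] dmsym_outer_commute[of "V t x" k "Gh x" "Gu t x"]
        by (cases "x \<in> D") (auto simp: closed_cone_def)
    qed
    also have "\<dots> = (LINT x:D|lborel. - h x * dmsym k (V t x) (V t x))"
      using ibph[OF t U(1,3,4)] neg by simp
    also have "\<dots> = real k * N t"
      unfolding N_def dmsym_self set_lebesgue_integral_def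
      by (subst Bochner_Integration.integral_mult_right_zero[symmetric]) (simp add: mult_ac)
    finally show ?thesis by (simp add: algebra_simps)
  qed
  have Nmono: "N 0 \<le> N t" if "0 \<le> t" "t \<le> 1" for t
    using that(1)
  proof (rule DERIV_nonneg_imp_nondecreasing)
    fix x assume "0 \<le> x" "x \<le> t"
    then show "\<exists>y. (N has_real_derivative y) (at x) \<and> 0 \<le> y" using dN[of x] dN0[of x] that by auto
  qed
  obtain z where z: "0 < z" "z < 1" "E 1 - E 0 = (1 - 0) * ((real k + 1) * N z)"
    using MVT2[of 0 1 E "\<lambda>t. (real k + 1) * N t"] dE by auto
  then have "(real k + 1) * N 0 \<le> E 1 - E 0" using Nmono[of z] by (simp add: mult_left_mono)
  moreover have "E 0 = (LINT x:D|lborel. - v x * msym k (Hv x))" by (simp add: E_def u_def V_def)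
  moreover have "E 1 = (LINT x:D|lborel. - w x * msym k (Hw x))" by (simp add: E_def u_def V_def h_def B_def)
  moreover have "N 0 = (LINT x:D|lborel. - w x * msym k (Hv x)) - (LINT x:D|lborel. - v x * msym k (Hv x))"
  proof -
    have "N 0 = (LINT x:D|lborel. - w x * msym k (Hv x) - - v x * msym k (Hv x))"
      by (simp add: N_def V_def h_def algebra_simps)
    also have "\<dots> = (LINT x:D|lborel. - w x * msym k (Hv x)) - (LINT x:D|lborel. - v x * msym k (Hv x))"
      by (intro split continuous_intros continuous_on_msym v' w')
    finally show ?thesis .
  qed
  ultimately show ?thesis by (simp add: algebra_simps)
qed

section \<open>The inequality from a barrier\<close>

text \<open>The exponents come from homogeneity: \<open>s = b powr (- 1 / (real k + 1))\<close>
  makes the term \<open>s ^ Suc k * b\<close> equal to \<open>1\<close>. For \<open>b = 0\<close> a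
  large \<open>s\<close> forces \<open>a = 0\<close>, because the left side grows at least
  linearly.\<close>

lemma power_optimization:
  fixes a b P Q c :: real
  assumes "0 \<le> a" "0 \<le> b" "0 \<le> P" "0 \<le> Q" "0 < c"
    and ineq: "\<And>s. 0 < s \<Longrightarrow> c * s ^ Suc m * a \<le> P * (s ^ Suc k * b + Q)"
  shows "a powr (1 / (real m + 1)) \<le> (P * (1 + Q) / c) powr (1 / (real m + 1)) * b powr (1 / (real k + 1))"
proof (cases "b = 0")
  case True
  have "a = 0"
  proof (rule ccontr)
    assume "a \<noteq> 0"
    then have a: "0 < a" using assms by simp
    \<comment> \<open>Chosen so that \<open>c * s * a = P * Q + c * a\<close>, which exceeds the
      bound \<open>P * Q\<close>; the summand \<open>1\<close> also gives
      \<open>1 \<le> s\<close>.\<close>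
    define s where "s = P * Q / (c * a) + 1"
    have s: "1 \<le> s" using assms a by (simp add: s_def)
    then have "s ^ 1 \<le> s ^ Suc m" by (intro power_increasing) auto
    then have "c * s * a \<le> c * s ^ Suc m * a" using assms a by (simp add: mult_left_mono mult_right_mono)
    also have "\<dots> \<le> P * Q" using ineq[of s] s True by simp
    also have "c * s * a = P * Q + c * a" using assms a by (simp add: s_def field_simps)
    finally show False using assms a by (simp add: mult_le_0_iff)
  qed
  then show ?thesis using True by simp
next
  case False
  then have b: "0 < b" using assms by simp
  define s where "s = b powr (- 1 / (real k + 1))"
  have s: "0 < s" using b by (simp add: s_def)
  have pw: "s ^ Suc j = b powr (- (real j + 1) / (real k + 1))" for j
  proof -
    have "s ^ Suc j = s powr real (Suc j)" using s by (rule powr_realpow[symmetric])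
    also have "\<dots> = b powr (- 1 / (real k + 1) * real (Suc j))" by (simp add: s_def powr_powr)
    also have "- 1 / (real k + 1) * real (Suc j) = - (real j + 1) / (real k + 1)" by (simp add: field_simps)
    finally show ?thesis .
  qed
  have "- (real k + 1) / (real k + 1) = - 1" by (simp add: field_simps)
  then have "s ^ Suc k * b = b powr (- 1) * b powr 1" unfolding pw using b by simp
  also have "\<dots> = 1" unfolding powr_add[symmetric] using b by simp
  finally have "c * s ^ Suc m * a \<le> P * (1 + Q)" using ineq[OF s] by simp
  then have "a * s ^ Suc m \<le> P * (1 + Q) / c" using assms(5) by (simp add: field_simps)
  then have "a * s ^ Suc m * b powr ((real m + 1) / (real k + 1)) \<le> P * (1 + Q) / c * b powr ((real m + 1) / (real k + 1))"
    by (intro mult_right_mono) auto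
  moreover have "- (real m + 1) / (real k + 1) + (real m + 1) / (real k + 1) = 0"
    by (simp add: add_divide_distrib[symmetric])
  then have "s ^ Suc m * b powr ((real m + 1) / (real k + 1)) = 1"
    unfolding pw powr_add[symmetric] using b by simp
  ultimately have "a \<le> P * (1 + Q) / c * b powr ((real m + 1) / (real k + 1))" by (simp add: mult.assoc)
  then have "a powr (1 / (real m + 1)) \<le> (P * (1 + Q) / c * b powr ((real m + 1) / (real k + 1))) powr (1 / (real m + 1))"
    using assms by (intro powr_mono2) auto
  also have "\<dots> = (P * (1 + Q) / c) powr (1 / (real m + 1)) * b powr (1 / (real k + 1))"
    using assms(3-5) by (subst powr_mult) (auto simp: powr_powr)
  finally show ?thesis .
qed

definition energy :: "nat \<Rightarrow> (real ^ 'n) set \<Rightarrow> (real ^ 'n \<Rightarrow> real) \<Rightarrow> (real ^ 'n \<Rightarrow> real ^ 'n ^ 'n) \<Rightarrow> real" where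
  "energy j D u H = (LINT x:D|lborel. - u x * msym j (H x))"

lemma set_integral_nonneg':
  fixes f :: "'a \<Rightarrow> real"
  assumes "\<And>x. x \<in> D \<Longrightarrow> 0 \<le> f x"
  shows "0 \<le> (LINT x:D|M. f x)"
  unfolding set_lebesgue_integral_def using assms
  by (intro Bochner_Integration.integral_nonneg) (auto simp: indicator_def)

lemma adm_msym_nonneg: "adm k D u G H \<Longrightarrow> j \<le> k \<Longrightarrow> x \<in> D \<Longrightarrow> 0 \<le> msym j (H x)"
  using admD(7)[of k D u G H x] by (cases "j = 0") (auto simp: closed_cone_def)

lemma energy_nonneg: "adm k D u G H \<Longrightarrow> j \<le> k \<Longrightarrow> 0 \<le> energy j D u H"
  unfolding energy_def using admD(6) adm_msym_nonneg
  by (intro set_integral_nonneg' mult_nonneg_nonneg) (auto simp: le_minus_iff)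

lemma energy_scale: "energy j D (\<lambda>x. c * u x) (\<lambda>x. c *\<^sub>R H x) = c ^ Suc j * energy j D u H"
  unfolding energy_def set_lebesgue_integral_def msym_scaleR
  by (subst Bochner_Integration.integral_mult_right_zero[symmetric]) (simp add: mult_ac)

text \<open>The tangent inequality at \<open>u + v\<close>, tested with \<open>2 u\<close> and with
  \<open>2 v\<close>: the two left sides add up to \<open>2 * (k + 1)\<close> times the energy of
  \<open>u + v\<close>, and the right sides contain \<open>2 * k\<close> times the same energy. The
  powers of \<open>2\<close> are the homogeneity of the energy.\<close>

lemma energy_add_le:
  fixes D :: "(real ^ 'n) set"
  assumes D: "open D" "bounded D" and k: "1 \<le> k" "k \<le> CARD('n)"
    and u: "adm k D u Gu Hu" and v: "adm k D v Gv Hv"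
  shows "energy k D (\<lambda>x. u x + v x) (\<lambda>x. Hu x + Hv x) \<le> 2 ^ k * (energy k D u Hu + energy k D v Hv)"
proof -
  let ?I = "\<lambda>w. (LINT x:D|lborel. - w x * msym k (Hu x + Hv x))"
  have s: "adm k D (\<lambda>x. u x + v x) (\<lambda>x. Gu x + Gv x) (\<lambda>x. Hu x + Hv x)" by (rule adm_add[OF u v k(2)])
  have *: "(real k + 1) * ?I (\<lambda>x. 2 * w x) \<le> 2 ^ Suc k * energy k D w Hw + real k * energy k D (\<lambda>x. u x + v x) (\<lambda>x. Hu x + Hv x)"
    if w: "adm k D w Gw Hw" for w Gw Hw
    using energy_convexity[OF D k s adm_scale[OF w, of 2]] energy_scale[of k D 2 w Hw] by (simp add: energy_def)
  have "set_integrable lborel D (\<lambda>x. - (2 * w x) * msym k (Hu x + Hv x))" if w: "adm k D w Gw Hw" for w Gw Hw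
    using admD[OF w] admD[OF u] admD[OF v]
    by (intro set_integrable_closure[OF D] continuous_intros continuous_on_msym)
  from set_integral_add(2)[OF this[OF u] this[OF v]]
  have "?I (\<lambda>x. 2 * u x) + ?I (\<lambda>x. 2 * v x) = (LINT x:D|lborel. 2 * (- (u x + v x) * msym k (Hu x + Hv x)))"
    by (simp add: algebra_simps)
  also have "\<dots> = 2 * energy k D (\<lambda>x. u x + v x) (\<lambda>x. Hu x + Hv x)"
    unfolding energy_def set_lebesgue_integral_def
    by (subst Bochner_Integration.integral_mult_right_zero[symmetric]) (simp add: mult_ac)
  finally have "(real k + 1) * ?I (\<lambda>x. 2 * u x) + (real k + 1) * ?I (\<lambda>x. 2 * v x) =
      (real k + 1) * (2 * energy k D (\<lambda>x. u x + v x) (\<lambda>x. Hu x + Hv x))"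
    by (simp only: distrib_left[symmetric])
  with *[OF u] *[OF v] show ?thesis by (simp add: algebra_simps)
qed

text \<open>The barrier contributes at least \<open>c I\<close> to the Hessian of
  \<open>s u + rho\<close>, and expanding \<open>msym k\<close> at a multiple of the identity
  produces the lower order \<open>m\<close>.\<close>

proposition inequality_from_barrier:
  fixes D :: "(real ^ 'n) set"
  assumes D: "open D" "bounded D" and k: "m < k" "k \<le> CARD('n)"
    and r: "adm k D rho Gr Hr" and c: "0 < c" and strict: "\<And>x. x \<in> D \<Longrightarrow> Hr x - c *\<^sub>R mat 1 \<in> closed_cone k"
  shows "\<exists>C>0. \<forall>u G H. adm k D u G H \<longrightarrow>
    energy m D u H powr (1 / (real m + 1)) \<le> C * energy k D u H powr (1 / (real k + 1))"
proof -
  \<comment> \<open>The weight of \<open>msym m A\<close> in the expansion of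
    \<open>msym k (A + c I)\<close>.\<close>
  define d where "d = real ((CARD('n) - m) choose (k - m)) * c ^ (k - m)"
  have d: "0 < d" using k c by (simp add: d_def)
  have lower: "d * s ^ Suc m * energy m D u H \<le> 2 ^ k * (s ^ Suc k * energy k D u H + energy k D rho Hr)"
    if u: "adm k D u G H" and s: "0 < s" for u G H s
  proof -
    have su: "adm k D (\<lambda>x. s * u x) (\<lambda>x. s *\<^sub>R G x) (\<lambda>x. s *\<^sub>R H x)" using u s by (intro adm_scale) auto
    note U = admD[OF su] and R = admD[OF r]
    have pt: "d * s ^ m * msym m (H x) \<le> msym k (s *\<^sub>R H x + Hr x)" if x: "x \<in> D" for x
    proof -
      have "d * msym m (s *\<^sub>R H x) \<le> msym k (s *\<^sub>R H x + c *\<^sub>R mat 1)"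
        unfolding d_def using msym_shift_lower_bound[OF U(7)[OF x] k(2), of c m] c k by simp
      also have "\<dots> \<le> msym k (s *\<^sub>R H x + c *\<^sub>R mat 1 + (Hr x - c *\<^sub>R mat 1))"
        using closed_cone_shift[OF U(7)[OF x] k(2) c] open_cone_subset_closed
        by (intro closed_cone_msym_add strict x k) auto
      finally show ?thesis by (simp add: msym_scaleR)
    qed
    have int: "set_integrable lborel D q" if "continuous_on (closure D) q" for q :: "_ \<Rightarrow> real"
      using that by (rule set_integrable_closure[OF D])
    have "d * s ^ Suc m * energy m D u H = (LINT x:D|lborel. - (s * u x) * (d * s ^ m * msym m (H x)))"
      unfolding energy_def set_lebesgue_integral_def
      by (subst Bochner_Integration.integral_mult_right_zero[symmetric]) (simp add: mult_ac)
    also have "\<dots> \<le> (LINT x:D|lborel. - (s * u x + rho x) * msym k (s *\<^sub>R H x + Hr x))"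
    proof (rule set_integral_mono)
      show "set_integrable lborel D (\<lambda>x. - (s * u x) * (d * s ^ m * msym m (H x)))"
        using admD[OF u] by (intro int continuous_intros continuous_on_msym)
      show "set_integrable lborel D (\<lambda>x. - (s * u x + rho x) * msym k (s *\<^sub>R H x + Hr x))"
        using admD[OF u] R by (intro int continuous_intros continuous_on_msym)
      fix x assume x: "x \<in> D"
      have "- (s * u x) * (d * s ^ m * msym m (H x)) \<le> - (s * u x) * msym k (s *\<^sub>R H x + Hr x)"
        using U(6)[OF x] by (intro mult_left_mono pt x) auto
      moreover have "0 \<le> - rho x * msym k (s *\<^sub>R H x + Hr x)"
        using R(6)[OF x] adm_msym_nonneg[OF adm_add[OF su r k(2)] order_refl x] by (intro mult_nonneg_nonneg) auto
      ultimately show "- (s * u x) * (d * s ^ m * msym m (H x)) \<le> - (s * u x + rho x) * msym k (s *\<^sub>R H x + Hr x)"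
        by (simp add: algebra_simps)
    qed
    also have "\<dots> \<le> 2 ^ k * (energy k D (\<lambda>x. s * u x) (\<lambda>x. s *\<^sub>R H x) + energy k D rho Hr)"
      using energy_add_le[OF D _ k(2) su r] k by (simp add: energy_def)
    finally show ?thesis by (simp only: energy_scale)
  qed
  have "energy m D u H powr (1 / (real m + 1)) \<le>
      (2 ^ k * (1 + energy k D rho Hr) / d) powr (1 / (real m + 1)) * energy k D u H powr (1 / (real k + 1))"
    if u: "adm k D u G H" for u G H
    using energy_nonneg[OF u, of m] energy_nonneg[OF u, of k] energy_nonneg[OF r, of k] k d lower[OF u]
    by (intro power_optimization) auto
  moreover have "0 < (2 ^ k * (1 + energy k D rho Hr) / d) powr (1 / (real m + 1))"
    using energy_nonneg[OF r, of k] d by (simp add: add_pos_nonneg)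
  ultimately show ?thesis by blast
qed

section \<open>Maximum principles\<close>

lemma msym_1: "msym (Suc 0) A = (\<Sum>i\<in>UNIV. A $ i $ i)"
proof -
  have "msym (Suc 0) A = (\<Sum>I\<in>(\<lambda>i. {i}) ` UNIV. \<Sum>p | p permutes I. of_int (sign p) * (\<Prod>i\<in>I. A $ i $ p i))"
    unfolding msym_def by (intro sum.cong) (auto simp: card_1_singleton_iff)
  also have "\<dots> = (\<Sum>i\<in>UNIV. A $ i $ i)"
    by (subst sum.reindex) (auto simp: permutes_sing inj_def)
  finally show ?thesis .
qed

lemma C2_cong:
  assumes "C2 S f G H" "open S" "\<And>x. x \<in> S \<Longrightarrow> f x = f' x \<and> G x = G' x \<and> H x = H' x"
  shows "C2 S f' G' H'"
  unfolding C2_def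
proof (intro conjI ballI)
  fix x assume x: "x \<in> S"
  have "(f' has_derivative (\<lambda>h. G x \<bullet> h)) (at x)"
    by (rule has_derivative_transform_within_open[OF C2D(1)[OF assms(1) x] assms(2) x]) (use assms(3) in blast)
  then show "(f' has_derivative (\<lambda>h. G' x \<bullet> h)) (at x)" using assms(3)[OF x] by simp
  have "(G' has_derivative (\<lambda>h. H x *v h)) (at x)"
    by (rule has_derivative_transform_within_open[OF C2D(2)[OF assms(1) x] assms(2) x]) (use assms(3) in blast)
  then show "(G' has_derivative (\<lambda>h. H' x *v h)) (at x)" using assms(3)[OF x] by simp
next
  show "continuous_on S H'"
    by (rule continuous_on_eq[OF C2D(5)[OF assms(1)]]) (use assms(3) in blast)
qed

lemma C2_Un: "C2 S f G H \<Longrightarrow> C2 T f G H \<Longrightarrow> open S \<Longrightarrow> open T \<Longrightarrow> C2 (S \<union> T) f G H"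
  unfolding C2_def by (auto intro: continuous_on_open_Un)

lemma C2_compose:
  assumes f: "C2 S f G H" and q: "\<And>t. (q has_real_derivative q1 t) (at t)" "\<And>t. (q1 has_real_derivative q2 t) (at t)"
    and c: "continuous_on UNIV q2"
  shows "C2 S (\<lambda>x. q (f x)) (\<lambda>x. q1 (f x) *\<^sub>R G x) (\<lambda>x. q1 (f x) *\<^sub>R H x + q2 (f x) *\<^sub>R outer (G x) (G x))"
proof -
  have df: "((\<lambda>x. q (f x)) has_derivative (\<lambda>h. q1 (f x) * (G x \<bullet> h))) (at x)"
    if "\<And>t. (q has_real_derivative q1 t) (at t)" "x \<in> S" for q q1 x
    using has_derivative_compose[OF C2D(1)[OF f that(2)] that(1)[of "f x", unfolded has_field_derivative_def]] .
  have cq1: "continuous_on UNIV q1" using q(2) DERIV_isCont by (blast intro: continuous_at_imp_continuous_on)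
  show ?thesis unfolding C2_def
  proof (intro conjI ballI)
    fix x assume x: "x \<in> S"
    show "((\<lambda>x. q (f x)) has_derivative (\<lambda>h. q1 (f x) *\<^sub>R G x \<bullet> h)) (at x)" using df[OF q(1) x] by simp
    have "((\<lambda>x. q1 (f x) *\<^sub>R G x) has_derivative (\<lambda>h. q1 (f x) *\<^sub>R (H x *v h) + (q2 (f x) * (G x \<bullet> h)) *\<^sub>R G x)) (at x)"
      by (intro has_derivative_scaleR df[OF q(2) x] C2D(2)[OF f x])
    then show "((\<lambda>x. q1 (f x) *\<^sub>R G x) has_derivative (\<lambda>h. (q1 (f x) *\<^sub>R H x + q2 (f x) *\<^sub>R outer (G x) (G x)) *v h)) (at x)"
      by (simp add: matrix_vector_mult_add_rdistrib scaleR_matrix_vector_assoc[symmetric] outer_mult)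
  next
    show "continuous_on S (\<lambda>x. q1 (f x) *\<^sub>R H x + q2 (f x) *\<^sub>R outer (G x) (G x))"
      by (intro continuous_intros continuous_on_outer C2D[OF f] continuous_on_compose2[OF cq1] continuous_on_compose2[OF c]) auto
  qed
qed

lemma C2_mult:
  assumes f: "C2 S f Gf Hf" and g: "C2 S g Gg Hg"
  shows "C2 S (\<lambda>x. f x * g x) (\<lambda>x. f x *\<^sub>R Gg x + g x *\<^sub>R Gf x)
    (\<lambda>x. (f x *\<^sub>R Hg x + outer (Gg x) (Gf x)) + (g x *\<^sub>R Hf x + outer (Gf x) (Gg x)))"
  unfolding C2_def
proof (intro conjI ballI)
  fix x assume x: "x \<in> S"
  have "((\<lambda>x. f x * g x) has_derivative (\<lambda>h. f x * (Gg x \<bullet> h) + Gf x \<bullet> h * g x)) (at x)"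
    by (intro has_derivative_mult C2D(1)[OF f x] C2D(1)[OF g x])
  then show "((\<lambda>x. f x * g x) has_derivative (\<lambda>h. (f x *\<^sub>R Gg x + g x *\<^sub>R Gf x) \<bullet> h)) (at x)"
    by (simp add: inner_add_left mult.commute)
  have "((\<lambda>x. f x *\<^sub>R Gg x + g x *\<^sub>R Gf x) has_derivative
      (\<lambda>h. (f x *\<^sub>R (Hg x *v h) + (Gf x \<bullet> h) *\<^sub>R Gg x) + (g x *\<^sub>R (Hf x *v h) + (Gg x \<bullet> h) *\<^sub>R Gf x))) (at x)"
    by (intro has_derivative_add has_derivative_scaleR C2D[OF f] C2D[OF g] x)
  then show "((\<lambda>x. f x *\<^sub>R Gg x + g x *\<^sub>R Gf x) has_derivative
      (\<lambda>h. ((f x *\<^sub>R Hg x + outer (Gg x) (Gf x)) + (g x *\<^sub>R Hf x + outer (Gf x) (Gg x))) *v h)) (at x)"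
    by (simp add: matrix_vector_mult_add_rdistrib scaleR_matrix_vector_assoc[symmetric] outer_mult)
next
  show "continuous_on S (\<lambda>x. (f x *\<^sub>R Hg x + outer (Gg x) (Gf x)) + (g x *\<^sub>R Hf x + outer (Gf x) (Gg x)))"
    by (intro continuous_intros continuous_on_outer C2D[OF f] C2D[OF g])
qed

lemma C2_const: "C2 S (\<lambda>x. c) (\<lambda>x. 0) (\<lambda>x. 0)"
  by (auto simp: C2_def)

lemma C2_sq_dist: "C2 S (\<lambda>x. (x - y) \<bullet> (x - y)) (\<lambda>x. 2 *\<^sub>R (x - y)) (\<lambda>x. 2 *\<^sub>R mat 1)"
  unfolding C2_def
  by (auto intro!: derivative_eq_intros simp: fun_eq_iff inner_commute scaleR_matrix_vector_assoc[symmetric] inner_add_left)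

lemma C2_line_nonpos:
  assumes f: "C2 S f G H" and S: "open S" "x \<in> S" and max: "\<And>y. y \<in> S \<Longrightarrow> f y \<le> f x"
  shows "(H x *v e) \<bullet> e \<le> 0"
proof (rule ccontr)
  assume "\<not> (H x *v e) \<bullet> e \<le> 0"
  then have pos: "0 < (H x *v e) \<bullet> e" by simp
  have G0: "G x = 0" by (rule zero_gradient_at_max[OF f S max])
  have "((\<lambda>t. x + t *\<^sub>R e) has_derivative (\<lambda>t. t *\<^sub>R e)) (at s)" for s by (auto intro!: derivative_eq_intros)
  note line = has_derivative_compose[OF this]
  have d0: "((\<lambda>t. f (x + t *\<^sub>R e)) has_real_derivative G (x + s *\<^sub>R e) \<bullet> e) (at s)" if "x + s *\<^sub>R e \<in> S" for s
    using line[OF C2D(1)[OF f that]] unfolding has_field_derivative_def by (rule has_derivative_eq_rhs) (auto simp: mult.commute)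
  have "((\<lambda>t. G (x + t *\<^sub>R e) \<bullet> e) has_real_derivative (H x *v e) \<bullet> e) (at 0)"
    using has_derivative_inner_left[OF line[of G "\<lambda>h. H x *v h" 0], of e] C2D(2)[OF f S(2)]
    unfolding has_field_derivative_def by (auto elim!: has_derivative_eq_rhs simp: matrix_vector_mult_scaleR mult.commute)
  from DERIV_pos_inc_right[OF this pos] obtain d where
    d: "0 < d" "\<And>h. 0 < h \<Longrightarrow> h < d \<Longrightarrow> 0 < G (x + h *\<^sub>R e) \<bullet> e" using G0 by auto
  have "open ((\<lambda>t. x + t *\<^sub>R e) -` S)" by (intro continuous_open_vimage S(1) continuous_intros)
  then obtain r where r: "0 < r" "ball 0 r \<subseteq> (\<lambda>t. x + t *\<^sub>R e) -` S" using S(2) by (force simp: open_contains_ball)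
  define h where "h = min d r / 2"
  have h: "0 < h" "h < d" "h < r" using d(1) r(1) by (auto simp: h_def min_def)
  have inS: "x + t *\<^sub>R e \<in> S" if "0 \<le> t" "t \<le> h" for t using r(2) that h by (auto simp: subset_iff dist_real_def)
  obtain z where "0 < z" "z < h" "f (x + h *\<^sub>R e) - f (x + 0 *\<^sub>R e) = (h - 0) * (G (x + z *\<^sub>R e) \<bullet> e)"
    using MVT2[OF h(1), of "\<lambda>t. f (x + t *\<^sub>R e)" "\<lambda>t. G (x + t *\<^sub>R e) \<bullet> e"] d0 inS by blast
  moreover have "0 < G (x + z *\<^sub>R e) \<bullet> e" using d(2) calculation h by auto
  ultimately have "f x < f (x + h *\<^sub>R e)" using h(1) by (smt (verit) mult_pos_pos scaleR_zero_left add_0_right)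
  then show False using max[OF inS[of h]] h(1) by simp
qed

text \<open>At a positive maximum the trace of the Hessian would be at most \<open>0\<close>. The
  first alternative stands for boundary points, and the neighbourhood \<open>S\<close> is local, so
  the lemma serves closures, annuli and collars alike.\<close>

lemma max_principle:
  fixes f :: "real ^ 'n \<Rightarrow> real"
  assumes K: "compact K" "continuous_on K f"
    and int: "\<And>x. x \<in> K \<Longrightarrow> f x \<le> 0 \<or> (\<exists>S G H. open S \<and> x \<in> S \<and> S \<subseteq> K \<and> C2 S f G H \<and> 0 < msym (Suc 0) (H x))"
    and x: "x \<in> K"
  shows "f x \<le> 0"
proof -
  obtain y where y: "y \<in> K" "\<And>z. z \<in> K \<Longrightarrow> f z \<le> f y" using continuous_attains_sup[OF K(1) _ K(2)] x by blast
  have "f y \<le> 0"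
  proof (rule ccontr)
    assume "\<not> f y \<le> 0"
    then obtain S G H where S: "open S" "y \<in> S" "S \<subseteq> K" "C2 S f G H" "0 < msym (Suc 0) (H y)" using int[OF y(1)] by blast
    have "H y $ i $ i \<le> 0" for i
    proof -
      have "(H y *v axis i 1) \<bullet> axis i 1 \<le> 0" using S y(2) by (intro C2_line_nonpos[OF S(4,1,2)]) auto
      then show ?thesis by (simp add: inner_axis matrix_vector_mult_basis column_def)
    qed
    then have "msym (Suc 0) (H y) \<le> 0" unfolding msym_1 by (intro sum_nonpos) auto
    then show False using S(5) by simp
  qed
  then show ?thesis using y(2)[OF x] by linarith
qed

text \<open>Adding \<open>e * (x \<bullet> x - R)\<close> makes the trace strictly positive and
  keeps the boundary values nonpositive; afterwards \<open>e\<close> is taken small.\<close>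

lemma subharmonic_nonpos:
  fixes D :: "(real ^ 'n) set"
  assumes D: "open D" "bounded D" and u: "C2 D u G H" "continuous_on (closure D) u"
    and u0: "\<And>x. x \<in> frontier D \<Longrightarrow> u x = 0" and tr: "\<And>x. x \<in> D \<Longrightarrow> 0 \<le> msym (Suc 0) (H x)" and x: "x \<in> D"
  shows "u x \<le> 0"
proof -
  obtain R where R: "\<And>x. x \<in> closure D \<Longrightarrow> x \<bullet> x \<le> R"
  proof -
    have "bounded ((\<lambda>x. x \<bullet> x) ` closure D)"
      using D(2) by (intro compact_imp_bounded compact_continuous_image continuous_intros) (auto simp: compact_closure)
    then show ?thesis using that by (auto simp: bounded_iff)
  qed
  have *: "u x + e * (x \<bullet> x - R) \<le> 0" if e: "0 < e" for e
  proof (rule max_principle[where K = "closure D"])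
    show "compact (closure D)" using D by (simp add: compact_closure)
    show "continuous_on (closure D) (\<lambda>x. u x + e * (x \<bullet> x - R))" by (intro continuous_intros u)
    show "x \<in> closure D" using x closure_subset by blast
    fix y assume y: "y \<in> closure D"
    show "u y + e * (y \<bullet> y - R) \<le> 0 \<or> (\<exists>S Ga Ha. open S \<and> y \<in> S \<and> S \<subseteq> closure D \<and>
        C2 S (\<lambda>a. u a + e * (a \<bullet> a - R)) Ga Ha \<and> 0 < msym (Suc 0) (Ha y))"
    proof (cases "y \<in> D")
      case False
      then have "u y = 0" using y D(1) by (intro u0) (simp add: frontier_def interior_open)
      then show ?thesis using R[OF y] e by (simp add: mult_nonneg_nonpos)
    next
      case True
      have "C2 D (\<lambda>a. u a + e * (((a - 0) \<bullet> (a - 0)) + - R)) (\<lambda>x. G x + e *\<^sub>R (2 *\<^sub>R (x - 0) + 0)) (\<lambda>x. H x + e *\<^sub>R (2 *\<^sub>R mat 1 + 0))"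
        by (intro C2_add C2_scale C2_sq_dist C2_const u)
      moreover have "msym (Suc 0) (H y + e *\<^sub>R (2 *\<^sub>R mat 1 + 0)) = msym (Suc 0) (H y) + 2 * e * real CARD('n)"
        by (simp add: msym_1 sum.distrib mat_def)
      then have "0 < msym (Suc 0) (H y + e *\<^sub>R (2 *\<^sub>R mat 1 + 0))" using tr[OF True] e by (simp add: add_nonneg_pos)
      ultimately show ?thesis using True D(1) closure_subset[of D] by (intro disjI2 exI[of _ D]) auto
    qed
  qed
  show ?thesis
  proof (rule ccontr)
    assume "\<not> u x \<le> 0"
    then have p: "0 < u x" by simp
    define M where "M = \<bar>x \<bullet> x - R\<bar> + 1"
    have M: "M > 0" by (simp add: M_def add_nonneg_pos)
    have "u x / (2 * M) * (x \<bullet> x - R) \<ge> u x / (2 * M) * (- M)" using p M by (intro mult_left_mono) (auto simp: M_def)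
    then have "u x / (2 * M) * (x \<bullet> x - R) \<ge> - (u x / 2)" using M by simp
    then show False using *[of "u x / (2 * M)"] p M by simp
  qed
qed

section \<open>The strong maximum principle\<close>

lemma C2_exp_sq_dist:
  fixes y :: "real ^ 'n"
  shows "C2 S (\<lambda>x. exp (- (a * ((x - y) \<bullet> (x - y)))))
     (\<lambda>x. (- a * exp (- (a * ((x - y) \<bullet> (x - y))))) *\<^sub>R (2 *\<^sub>R (x - y)))
     (\<lambda>x. (- a * exp (- (a * ((x - y) \<bullet> (x - y))))) *\<^sub>R (2 *\<^sub>R mat 1) +
        (a\<^sup>2 * exp (- (a * ((x - y) \<bullet> (x - y))))) *\<^sub>R outer (2 *\<^sub>R (x - y)) (2 *\<^sub>R (x - y)))"
proof (rule C2_compose[OF C2_sq_dist, where q = "\<lambda>t. exp (- (a * t))" and ?q1.0 = "\<lambda>t. - a * exp (- (a * t))" and ?q2.0 = "\<lambda>t. a\<^sup>2 * exp (- (a * t))"])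
  show "((\<lambda>t. exp (- (a * t))) has_real_derivative - a * exp (- (a * t))) (at t)" for t
    by (auto intro!: derivative_eq_intros)
  show "((\<lambda>t. - a * exp (- (a * t))) has_real_derivative a\<^sup>2 * exp (- (a * t))) (at t)" for t
    by (auto intro!: derivative_eq_intros simp: power2_eq_square)
qed (intro continuous_intros)

lemma msym_1_add: "msym (Suc 0) (A + B) = msym (Suc 0) A + msym (Suc 0) (B :: real ^ 'n ^ 'n)"
  by (simp add: msym_1 sum.distrib)

lemma msym_1_scale: "msym (Suc 0) (c *\<^sub>R A) = c * msym (Suc 0) (A :: real ^ 'n ^ 'n)"
  by (simp add: msym_1 sum_distrib_left)

lemma msym_1_mat: "msym (Suc 0) (mat 1 :: real ^ 'n ^ 'n) = real CARD('n)"
  by (simp add: msym_1 mat_def)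

lemma msym_1_outer: "msym (Suc 0) (outer a b) = a \<bullet> b"
  by (simp add: msym_1 outer_def inner_vec_def)

lemma negative_compact_bound:
  fixes f :: "'a::topological_space \<Rightarrow> real"
  assumes "compact K" "continuous_on K f" "\<And>x. x \<in> K \<Longrightarrow> f x < 0"
  obtains m where "0 < m" "\<And>x. x \<in> K \<Longrightarrow> f x \<le> - m"
proof (cases "K = {}")
  case False
  then obtain y where "y \<in> K" "\<And>x. x \<in> K \<Longrightarrow> f x \<le> f y" using continuous_attains_sup[OF assms(1) _ assms(2)] by blast
  then show ?thesis using that[of "- f y"] assms(3) by auto
qed (use that[of 1] in auto)

text \<open>Hopf's comparison on an annulus \<open>s \<le> dist y x \<le> r\<close>: a small
  multiple of a Gaussian minus its value on the outer sphere can be added to \<open>u\<close> and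
  the sum is still nonpositive, so \<open>u\<close> is negative inside.\<close>

lemma negative_in_ball:
  fixes u :: "real ^ 'n \<Rightarrow> real"
  assumes u: "C2 (ball y R) u G H" and le: "\<And>x. x \<in> ball y R \<Longrightarrow> u x \<le> 0"
    and tr: "\<And>x. x \<in> ball y R \<Longrightarrow> 0 \<le> msym (Suc 0) (H x)" and uy: "u y < 0" and x: "x \<in> ball y R"
  shows "u x < 0"
proof -
  have R: "0 < R" using x by (metis ball_empty empty_iff not_le)
  have cu: "continuous_on (ball y R) u" by (rule C2D(3)[OF u])
  have "{z \<in> ball y R. u z < 0} = ball y R \<inter> u -` {..<0}" by auto
  then have "open {z \<in> ball y R. u z < 0}" using continuous_open_preimage[OF cu open_ball open_lessThan] by simp
  moreover have "y \<in> {z \<in> ball y R. u z < 0}" using uy R by simp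
  ultimately obtain s0 where s0: "0 < s0" "ball y s0 \<subseteq> {z \<in> ball y R. u z < 0}"
    by (rule openE)
  define s where "s = min s0 R / 2"
  have s: "0 < s" "s < s0" "s < R" using s0(1) R by (auto simp: s_def min_def)
  show ?thesis
  proof (cases "dist y x < s0")
    case True
    then show ?thesis using s0(2) by auto
  next
    case False
    define r where "r = (dist y x + R) / 2"
    have r: "dist y x < r" "r < R" "s < r" using x s False by (auto simp: r_def)
    have "compact (sphere y s)" by simp
    moreover have "continuous_on (sphere y s) u" using s by (intro continuous_on_subset[OF cu]) auto
    moreover have "u z < 0" if "z \<in> sphere y s" for z using that s s0(2) by (auto simp: subset_iff)
    ultimately obtain m where m: "0 < m" "\<And>z. z \<in> sphere y s \<Longrightarrow> u z \<le> - m"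
      using negative_compact_bound by metis
    \<comment> \<open>With \<open>n\<close> the dimension, the trace of the Hessian of
      \<open>b\<close> is \<open>2 * a * b\<close> times
      \<open>2 * a * (dist y z)\<^sup>2 - n\<close>; this \<open>a\<close> makes the last factor
      positive beyond the radius \<open>s\<close>.\<close>
    define a where "a = real CARD('n) / s\<^sup>2"
    have a: "0 < a" "a * s\<^sup>2 = real CARD('n)" using s by (auto simp: a_def)
    define b where "b z = exp (- (a * ((z - y) \<bullet> (z - y))))" for z
    define f where "f z = u z + m * (b z + - exp (- (a * r\<^sup>2)))" for z
    have sq: "(z - y) \<bullet> (z - y) = (dist y z)\<^sup>2" for z
      unfolding dist_norm norm_minus_commute[of y z] power2_norm_eq_inner ..
    have "f x \<le> 0"
    proof (rule max_principle[where K = "cball y r - ball y s"])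
      show "compact (cball y r - ball y s)" by (intro compact_diff) auto
      show "continuous_on (cball y r - ball y s) f" unfolding f_def b_def
        using r by (intro continuous_intros continuous_on_subset[OF cu]) auto
      show "x \<in> cball y r - ball y s" using r False s by auto
      fix z assume z: "z \<in> cball y r - ball y s"
      consider "dist y z = s" | "dist y z = r" | "s < dist y z" "dist y z < r" using z by force
      then show "f z \<le> 0 \<or> (\<exists>S G H. open S \<and> z \<in> S \<and> S \<subseteq> cball y r - ball y s \<and> C2 S f G H \<and> 0 < msym (Suc 0) (H z))"
      proof cases
        case 1
        have "b z \<le> 1" using a(1) by (simp add: b_def)
        then have "b z + - exp (- (a * r\<^sup>2)) \<le> 1" using exp_ge_zero[of "- (a * r\<^sup>2)"] by linarith
        then have "m * (b z + - exp (- (a * r\<^sup>2))) \<le> m * 1"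
          using m(1) by (intro mult_left_mono) auto
        then show ?thesis using m(2)[of z] 1 by (simp add: f_def)
      next
        case 2
        then show ?thesis using le[of z] r by (simp add: f_def b_def sq)
      next
        case 3
        define S where "S = ball y r - cball y s"
        have S: "open S" "z \<in> S" "S \<subseteq> cball y r - ball y s" "S \<subseteq> ball y R"
          using 3 r by (auto simp: S_def intro: open_Diff)
        define w where "w x = (- a * b x) *\<^sub>R (2 *\<^sub>R mat 1) + (a\<^sup>2 * b x) *\<^sub>R outer (2 *\<^sub>R (x - y)) (2 *\<^sub>R (x - y))" for x
        have "C2 S b (\<lambda>x. (- a * b x) *\<^sub>R (2 *\<^sub>R (x - y))) w"
          unfolding b_def[abs_def] w_def[abs_def] by (rule C2_exp_sq_dist)
        then have "C2 S f (\<lambda>x. G x + m *\<^sub>R ((- a * b x) *\<^sub>R (2 *\<^sub>R (x - y)) + 0)) (\<lambda>x. H x + m *\<^sub>R (w x + 0))"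
          unfolding f_def[abs_def] by (intro C2_add C2_scale C2_const C2_subset[OF u S(4)])
        moreover have "0 < msym (Suc 0) (w z)"
        proof -
          have "msym (Suc 0) (w z) = 2 * a * b z * (2 * a * (dist y z)\<^sup>2 - real CARD('n))"
            unfolding w_def msym_1_add msym_1_scale msym_1_mat msym_1_outer inner_scaleR_left inner_scaleR_right sq
            by (simp add: algebra_simps power2_eq_square)
          moreover have "s\<^sup>2 < (dist y z)\<^sup>2" using 3 s by (intro power_strict_mono) auto
          then have "a * s\<^sup>2 < a * (dist y z)\<^sup>2" by (rule mult_strict_left_mono[OF _ a(1)])
          then have "0 < 2 * a * (dist y z)\<^sup>2 - real CARD('n)"
            using a(2) of_nat_0_le_iff[of "CARD('n)", where 'a = real] unfolding mult.assoc by linarith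
          ultimately show ?thesis using a by (simp add: b_def)
        qed
        moreover have "0 \<le> msym (Suc 0) (H z)" using tr S by auto
        ultimately show ?thesis using S m(1)
          by (intro disjI2 exI[of _ S] exI[of _ "\<lambda>x. G x + m *\<^sub>R ((- a * b x) *\<^sub>R (2 *\<^sub>R (x - y)) + 0)"] exI[of _ "\<lambda>x. H x + m *\<^sub>R (w x + 0)"])
            (simp add: msym_1_add msym_1_scale add_nonneg_pos)
      qed
    qed
    moreover have "(dist y x)\<^sup>2 < r\<^sup>2" using r by (intro power_strict_mono) auto
    then have "exp (- (a * r\<^sup>2)) < b x" using a by (simp add: b_def sq)
    then have "0 < m * (b x + - exp (- (a * r\<^sup>2)))" using m(1) by simp
    ultimately show ?thesis by (simp add: f_def)
  qed
qed

text \<open>Both the negative set and the zero set are open in the connected set \<open>D\<close>: a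
  negative value near a zero \<open>z\<close> would spread to \<open>z\<close> over a ball.\<close>

lemma strong_max_principle:
  fixes D :: "(real ^ 'n) set"
  assumes D: "open D" "connected D" and u: "C2 D u G H" and le: "\<And>x. x \<in> D \<Longrightarrow> u x \<le> 0"
    and tr: "\<And>x. x \<in> D \<Longrightarrow> 0 \<le> msym (Suc 0) (H x)" and y: "y \<in> D" "u y < 0" and x: "x \<in> D"
  shows "u x < 0"
proof -
  have ball: "u z < 0" if "ball w R \<subseteq> D" "u w < 0" "z \<in> ball w R" for w z R
    using that by (intro negative_in_ball[OF C2_subset[OF u that(1)] _ _ that(2,3)] le tr) auto
  define A where "A = {z \<in> D. u z < 0}"
  define B where "B = {z \<in> D. u z = 0}"
  have "open A" unfolding open_contains_ball
  proof
    fix z assume z: "z \<in> A"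
    then obtain R where R: "0 < R" "ball z R \<subseteq> D" using D(1) by (auto simp: A_def open_contains_ball)
    then have "ball z R \<subseteq> A" using ball[OF R(2)] z by (auto simp: A_def)
    then show "\<exists>e>0. ball z e \<subseteq> A" using R by blast
  qed
  moreover have "open B" unfolding open_contains_ball
  proof
    fix z assume z: "z \<in> B"
    then obtain R where R: "0 < R" "ball z R \<subseteq> D" using D(1) by (auto simp: B_def open_contains_ball)
    \<comment> \<open>For \<open>w\<close> within \<open>R / 2\<close> of \<open>z\<close>, the ball
      of that radius about \<open>w\<close> contains \<open>z\<close> and stays in
      \<open>D\<close>.\<close>
    have "ball z (R / 2) \<subseteq> B"
    proof
      fix w assume w: "w \<in> ball z (R / 2)"
      have sub: "ball w (R / 2) \<subseteq> D"
      proof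
        fix p assume "p \<in> ball w (R / 2)"
        then have "dist z p < R" using w dist_triangle[of z p w] by simp
        then show "p \<in> D" using R(2) by auto
      qed
      moreover have wD: "w \<in> D" using w R by auto
      moreover have "z \<in> ball w (R / 2)" using w by (simp add: dist_commute)
      ultimately have "\<not> u w < 0" using ball[of w "R / 2" z] z by (auto simp: B_def)
      then show "w \<in> B" using le[OF wD] wD by (simp add: B_def)
    qed
    then show "\<exists>e>0. ball z e \<subseteq> B" using R(1) by (intro exI[of _ "R / 2"]) simp
  qed
  moreover have "D \<subseteq> A \<union> B" using le by (force simp: A_def B_def)
  moreover have "A \<inter> B \<inter> D = {}" by (auto simp: A_def B_def)
  moreover have "A \<inter> D \<noteq> {}" using y by (auto simp: A_def)
  ultimately have "B \<inter> D = {}" using D(2) unfolding connected_def by blast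
  then show ?thesis using x le[OF x] by (force simp: B_def)
qed

section \<open>Hessian matrices\<close>

text \<open>The second difference is symmetric in \<open>a\<close> and \<open>b\<close>, so its
  limit after division by \<open>t\<^sup>2\<close> gives the symmetry of \<open>H\<close>.\<close>

lemma second_difference_bound:
  fixes S :: "(real ^ 'n) set"
  assumes S: "open S" "x \<in> S" and f: "\<And>y. y \<in> S \<Longrightarrow> (f has_derivative (\<lambda>h. G y \<bullet> h)) (at y)"
    and G: "(G has_derivative (\<lambda>h. H *v h)) (at x)" and e: "0 < e"
  shows "\<exists>d>0. \<forall>t. 0 < t \<and> t < d \<longrightarrow> \<bar>f (x + t *\<^sub>R a + t *\<^sub>R b) - f (x + t *\<^sub>R a) - f (x + t *\<^sub>R b) + f x - t\<^sup>2 * ((H *v b) \<bullet> a)\<bar>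
    \<le> t\<^sup>2 * (e * (norm a * (2 * norm a + norm b)))"
proof -
  obtain r where r: "0 < r" "ball x r \<subseteq> S" using S by (auto simp: open_contains_ball)
  obtain d0 where d0: "0 < d0" "\<And>y. norm (y - x) < d0 \<Longrightarrow> norm (G y - G x - H *v (y - x)) \<le> e * norm (y - x)"
    using G e unfolding has_derivative_at_alt by blast
  define M where "M = norm a + norm b + 1"
  have M: "0 < M" by (simp add: M_def add_nonneg_pos)
  define d where "d = min r d0 / M"
  have "0 < d" using r d0 M by (simp add: d_def)
  moreover have "\<bar>f (x + t *\<^sub>R a + t *\<^sub>R b) - f (x + t *\<^sub>R a) - f (x + t *\<^sub>R b) + f x - t\<^sup>2 * ((H *v b) \<bullet> a)\<bar>
    \<le> t\<^sup>2 * (e * (norm a * (2 * norm a + norm b)))" if t: "0 < t" "t < d" for t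
  proof -
    have tM: "t * M < r" "t * M < d0" using t M by (auto simp: d_def field_simps)
    have small: "norm (s *\<^sub>R a + q *\<^sub>R b) \<le> t * (norm a + norm b)" if "0 \<le> s" "s \<le> t" "0 \<le> q" "q \<le> t" for s q
    proof -
      have "norm (s *\<^sub>R a + q *\<^sub>R b) \<le> s * norm a + q * norm b" using norm_triangle_ineq[of "s *\<^sub>R a" "q *\<^sub>R b"] that by simp
      also have "\<dots> \<le> t * norm a + t * norm b" using that by (intro add_mono mult_right_mono) auto
      finally show ?thesis by (simp add: distrib_left)
    qed
    have lt: "t * (norm a + norm b) < t * M" using t by (simp add: M_def)
    have inS: "x + (s *\<^sub>R a + q *\<^sub>R b) \<in> S" if "0 \<le> s" "s \<le> t" "0 \<le> q" "q \<le> t" for s q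
    proof -
      have "dist (x + (s *\<^sub>R a + q *\<^sub>R b)) x < r" using small[OF that] lt tM by (simp add: dist_norm)
      then show ?thesis using r(2) by (metis dist_commute mem_ball subsetD)
    qed
    \<comment> \<open>The second difference is \<open>g t - g 0\<close>; the mean value theorem in
      the direction \<open>a\<close> leaves a first difference of \<open>G\<close>, to which
      differentiability at \<open>x\<close> applies.\<close>
    define g where "g s = f (x + (s *\<^sub>R a + t *\<^sub>R b)) - f (x + (s *\<^sub>R a + 0 *\<^sub>R b))" for s
    have line: "((\<lambda>s. f (x + (s *\<^sub>R a + q *\<^sub>R b))) has_real_derivative G (x + (s *\<^sub>R a + q *\<^sub>R b)) \<bullet> a) (at s)"
      if "0 \<le> s" "s \<le> t" "0 \<le> q" "q \<le> t" for s q
    proof -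
      have "((\<lambda>s. x + (s *\<^sub>R a + q *\<^sub>R b)) has_derivative (\<lambda>h. h *\<^sub>R a)) (at s)" by (auto intro!: derivative_eq_intros)
      from has_derivative_compose[OF this f[OF inS[OF that]]] show ?thesis
        unfolding has_field_derivative_def by (rule has_derivative_eq_rhs) (auto simp: mult.commute)
    qed
    have dg: "(g has_real_derivative G (x + (s *\<^sub>R a + t *\<^sub>R b)) \<bullet> a - G (x + (s *\<^sub>R a + 0 *\<^sub>R b)) \<bullet> a) (at s)"
      if "0 \<le> s" "s \<le> t" for s
      unfolding g_def[abs_def] using that t(1) by (intro DERIV_diff line) auto
    obtain z where z: "0 < z" "z < t" "g t - g 0 = (t - 0) * (G (x + (z *\<^sub>R a + t *\<^sub>R b)) \<bullet> a - G (x + (z *\<^sub>R a + 0 *\<^sub>R b)) \<bullet> a)"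
      using MVT2[OF t(1) dg] by auto
    define p1 p2 where "p1 = z *\<^sub>R a + t *\<^sub>R b" and "p2 = z *\<^sub>R a + 0 *\<^sub>R b"
    have E: "norm (G (x + p) - G x - H *v p) \<le> e * norm p" if "norm p < d0" for p
      using d0(2)[of "x + p"] that by simp
    have n1: "norm p1 \<le> t * (norm a + norm b)" unfolding p1_def using z by (intro small) auto
    have n2: "norm p2 \<le> t * norm a" using z by (simp add: p2_def mult_right_mono)
    have n2': "norm p2 < d0"
    proof -
      have "t * norm a \<le> t * (norm a + norm b)" using t by (intro mult_left_mono) auto
      then show ?thesis using n2 lt tM by linarith
    qed
    have "g t - g 0 - t\<^sup>2 * ((H *v b) \<bullet> a) = t * (((G (x + p1) - G x - H *v p1) - (G (x + p2) - G x - H *v p2)) \<bullet> a)"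
    proof -
      have "H *v p1 - H *v p2 = t *\<^sub>R (H *v b)" by (simp add: p1_def p2_def algebra_simps)
      then have "(H *v p1) \<bullet> a - (H *v p2) \<bullet> a = t * ((H *v b) \<bullet> a)" by (metis inner_diff_left inner_scaleR_left)
      then show ?thesis using z(3) unfolding p1_def[symmetric] p2_def[symmetric]
        by (simp add: inner_diff_left algebra_simps power2_eq_square)
    qed
    also have "\<bar>\<dots>\<bar> \<le> t * ((e * norm p1 + e * norm p2) * norm a)"
    proof -
      have "\<bar>((G (x + p1) - G x - H *v p1) - (G (x + p2) - G x - H *v p2)) \<bullet> a\<bar> \<le>
          norm ((G (x + p1) - G x - H *v p1) - (G (x + p2) - G x - H *v p2)) * norm a" by (rule Cauchy_Schwarz_ineq2)
      also have "\<dots> \<le> (e * norm p1 + e * norm p2) * norm a"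
        using E[of p1] E[of p2] n1 n2' lt tM norm_triangle_ineq4[of "G (x + p1) - G x - H *v p1" "G (x + p2) - G x - H *v p2"]
        by (intro mult_right_mono) auto
      finally show ?thesis using t(1) by (simp add: abs_mult mult_left_mono)
    qed
    also have "\<dots> \<le> t * ((e * (t * (norm a + norm b)) + e * (t * norm a)) * norm a)"
      using n1 n2 t e by (intro mult_left_mono mult_right_mono add_mono) auto
    also have "\<dots> = t\<^sup>2 * (e * (norm a * (2 * norm a + norm b)))" by (simp add: power2_eq_square algebra_simps)
    finally have "\<bar>g t - g 0 - t\<^sup>2 * ((H *v b) \<bullet> a)\<bar> \<le> t\<^sup>2 * (e * (norm a * (2 * norm a + norm b)))" .
    then show ?thesis by (simp add: g_def algebra_simps)
  qed
  ultimately show ?thesis by blast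
qed

lemma hessian_symmetric:
  fixes S :: "(real ^ 'n) set"
  assumes S: "open S" "x \<in> S" and f: "\<And>y. y \<in> S \<Longrightarrow> (f has_derivative (\<lambda>h. G y \<bullet> h)) (at y)"
    and G: "(G has_derivative (\<lambda>h. H *v h)) (at x)"
  shows "transpose H = H"
proof -
  have eq: "(H *v b) \<bullet> a = (H *v a) \<bullet> b" for a b
  proof -
    define C where "C = norm a * (2 * norm a + norm b) + norm b * (2 * norm b + norm a)"
    have le: "\<bar>(H *v b) \<bullet> a - (H *v a) \<bullet> b\<bar> \<le> e * C" if e: "0 < e" for e
    proof -
      obtain d1 where d1: "0 < d1" "\<And>t. 0 < t \<Longrightarrow> t < d1 \<Longrightarrow> \<bar>f (x + t *\<^sub>R a + t *\<^sub>R b) - f (x + t *\<^sub>R a) - f (x + t *\<^sub>R b) + f x - t\<^sup>2 * ((H *v b) \<bullet> a)\<bar>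
        \<le> t\<^sup>2 * (e * (norm a * (2 * norm a + norm b)))"
        using second_difference_bound[OF S f G e, of a b] by blast
      obtain d2 where d2: "0 < d2" "\<And>t. 0 < t \<Longrightarrow> t < d2 \<Longrightarrow> \<bar>f (x + t *\<^sub>R b + t *\<^sub>R a) - f (x + t *\<^sub>R b) - f (x + t *\<^sub>R a) + f x - t\<^sup>2 * ((H *v a) \<bullet> b)\<bar>
        \<le> t\<^sup>2 * (e * (norm b * (2 * norm b + norm a)))"
        using second_difference_bound[OF S f G e, of b a] by blast
      define t where "t = min d1 d2 / 2"
      have t: "0 < t" "t < d1" "t < d2" using d1(1) d2(1) by (auto simp: t_def min_def)
      have sw: "f (x + t *\<^sub>R b + t *\<^sub>R a) = f (x + t *\<^sub>R a + t *\<^sub>R b)" by (simp add: add_ac)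
      have "\<bar>t\<^sup>2 * ((H *v b) \<bullet> a) - t\<^sup>2 * ((H *v a) \<bullet> b)\<bar> \<le> t\<^sup>2 * (e * (norm a * (2 * norm a + norm b))) + t\<^sup>2 * (e * (norm b * (2 * norm b + norm a)))"
        using d1(2)[OF t(1,2)] d2(2)[OF t(1,3)] unfolding sw by linarith
      also have "\<dots> = t\<^sup>2 * (e * C)" unfolding C_def by (simp only: distrib_left)
      also have "\<bar>t\<^sup>2 * ((H *v b) \<bullet> a) - t\<^sup>2 * ((H *v a) \<bullet> b)\<bar> = t\<^sup>2 * \<bar>(H *v b) \<bullet> a - (H *v a) \<bullet> b\<bar>"
        unfolding right_diff_distrib[symmetric] abs_mult by simp
      finally have "t\<^sup>2 * \<bar>(H *v b) \<bullet> a - (H *v a) \<bullet> b\<bar> \<le> t\<^sup>2 * (e * C)" .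
      then show ?thesis using t(1) by simp
    qed
    have "0 \<le> C" by (simp add: C_def)
    have "\<bar>(H *v b) \<bullet> a - (H *v a) \<bullet> b\<bar> \<le> 0"
    proof (rule field_le_epsilon)
      fix \<epsilon> :: real assume "0 < \<epsilon>"
      then have "\<bar>(H *v b) \<bullet> a - (H *v a) \<bullet> b\<bar> \<le> \<epsilon> / (C + 1) * C" using \<open>0 \<le> C\<close> by (intro le) simp
      also have "\<dots> \<le> \<epsilon>" using \<open>0 \<le> C\<close> \<open>0 < \<epsilon>\<close> by (simp add: field_simps)
      finally show "\<bar>(H *v b) \<bullet> a - (H *v a) \<bullet> b\<bar> \<le> 0 + \<epsilon>" by simp
    qed
    then show ?thesis by simp
  qed
  have "H $ i $ j = H $ j $ i" for i j
    using eq[of "axis j 1" "axis i 1"] by (simp add: inner_axis matrix_vector_mult_basis column_def)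
  then show ?thesis by (simp add: vec_eq_iff transpose_def)
qed

lemma grad_has_derivative:
  fixes f :: "real ^ 'n \<Rightarrow> real"
  assumes "f differentiable (at x)"
  shows "(f has_derivative (\<lambda>h. grad f x \<bullet> h)) (at x)"
proof -
  let ?f' = "frechet_derivative f (at x)"
  have f': "(f has_derivative ?f') (at x)" using assms by (simp add: frechet_derivative_works)
  then have lin: "linear ?f'" by (rule has_derivative_linear)
  have "?f' h = grad f x \<bullet> h" for h
  proof -
    have "?f' h = ?f' (\<Sum>i\<in>UNIV. h $ i *\<^sub>R axis i 1)"
      using basis_expansion[of h] by (simp add: scalar_mult_eq_scaleR)
    also have "\<dots> = (\<Sum>i\<in>UNIV. h $ i * ?f' (axis i 1))"
      using lin by (simp add: linear_sum linear_scale)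
    finally show ?thesis by (simp add: grad_def partial_deriv_def inner_vec_def mult.commute)
  qed
  then have eq: "?f' = (\<lambda>h. grad f x \<bullet> h)" by (rule ext)
  show ?thesis using f' unfolding eq .
qed

lemma has_derivative_cart_componentwise:
  fixes F :: "'a::real_normed_vector \<Rightarrow> real ^ 'n"
  assumes "\<And>i. ((\<lambda>x. F x $ i) has_derivative (\<lambda>h. F' h $ i)) (at x within S)"
  shows "(F has_derivative F') (at x within S)"
  unfolding has_derivative_componentwise_within[of F]
  using assms by (auto simp: Basis_vec_def inner_axis)

lemma C2_of_partials:
  fixes f :: "real ^ 'n \<Rightarrow> real"
  assumes S: "open S" and f: "\<And>x. x \<in> S \<Longrightarrow> f differentiable (at x)"
    and df: "\<And>x i. x \<in> S \<Longrightarrow> partial_deriv i f differentiable (at x)"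
    and ddf: "\<And>i j. continuous_on S (partial_deriv i (partial_deriv j f))"
  shows "C2 S f (grad f) (hessian f)" "\<And>x. x \<in> S \<Longrightarrow> transpose (hessian f x) = hessian f x"
proof -
  \<comment> \<open>Row \<open>i\<close> of the derivative consists of the derivatives of
    \<open>partial_deriv i f\<close>, while \<open>hessian\<close> takes the outer derivative as its
    first index; the transposition disappears once symmetry is known.\<close>
  have G: "(grad f has_derivative (\<lambda>h. transpose (hessian f x) *v h)) (at x)" if "x \<in> S" for x
  proof (rule has_derivative_cart_componentwise)
    fix i
    have "(transpose (hessian f x) *v h) $ i = grad (partial_deriv i f) x \<bullet> h" for h
      by (simp add: matrix_vector_mult_def transpose_def hessian_def grad_def inner_vec_def)
    then show "((\<lambda>x. grad f x $ i) has_derivative (\<lambda>h. (transpose (hessian f x) *v h) $ i)) (at x)"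
      using grad_has_derivative[OF df[OF that, of i]] by (simp add: grad_def)
  qed
  show sym: "transpose (hessian f x) = hessian f x" if "x \<in> S" for x
    using hessian_symmetric[OF S that grad_has_derivative[OF f] G[OF that]] by simp
  show "C2 S f (grad f) (hessian f)" unfolding C2_def
  proof (intro conjI ballI)
    show "continuous_on S (hessian f)" unfolding hessian_def by (intro continuous_intros ddf)
  qed (use grad_has_derivative f G sym in auto)
qed

lemma C2_smooth_on:
  assumes "smooth_on U r" "open U"
  shows "C2 U r (grad r) (hessian r)"
proof -
  have "Ck_on (Suc (Suc 0)) U r" using assms(1) unfolding smooth_on_def by blast
  then show ?thesis by (intro C2_of_partials(1) assms(2)) auto
qed

text \<open>On the boundary \<open>G\<close> and \<open>H\<close> are the continuous extensions from
  \<open>Ck_extendable\<close>, because \<open>C2_closure\<close> says nothing about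
  differentiability of \<open>u\<close> there. The sign comes from the maximum principle, as
  \<open>k \<ge> 1\<close> makes the Laplacian nonnegative.\<close>

lemma adm_of_k_convex:
  fixes D :: "(real ^ 'n) set"
  assumes D: "open D" "bounded D" and k: "1 \<le> k" and u: "k_convex k D u" and u0: "\<And>x. x \<in> frontier D \<Longrightarrow> u x = 0"
  obtains G H where "adm k D u G H" "\<And>x. x \<in> D \<Longrightarrow> H x = hessian u x"
    "\<And>x. x \<in> D \<Longrightarrow> transpose (hessian u x) = hessian u x"
proof -
  have cl: "continuous_on (closure D) u" and ext: "Ck_extendable (Suc (Suc 0)) D u"
    using u by (auto simp: k_convex_def C2_closure_def numeral_2_eq_2)
  have d: "\<And>x. x \<in> D \<Longrightarrow> u differentiable (at x)" "\<And>x i. x \<in> D \<Longrightarrow> partial_deriv i u differentiable (at x)"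
    using ext by auto
  have "\<forall>i. \<exists>g. continuous_on (closure D) g \<and> (\<forall>x\<in>D. g x = partial_deriv i u x)" using ext by auto
  then obtain g where g: "\<And>i. continuous_on (closure D) (g i)" "\<And>i x. x \<in> D \<Longrightarrow> g i x = partial_deriv i u x" by metis
  have "\<forall>i j. \<exists>g. continuous_on (closure D) g \<and> (\<forall>x\<in>D. g x = partial_deriv i (partial_deriv j u) x)" using ext by auto
  then obtain h where h: "\<And>i j. continuous_on (closure D) (h i j)"
    "\<And>i j x. x \<in> D \<Longrightarrow> h i j x = partial_deriv i (partial_deriv j u) x" by metis
  define G where "G x = (\<chi> i. g i x)" for x
  define H where "H x = (\<chi> i j. h i j x)" for x
  have GH: "G x = grad u x" "H x = hessian u x" if "x \<in> D" for x
    using that by (auto simp: G_def H_def grad_def hessian_def g h)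
  have c: "continuous_on D (partial_deriv i (partial_deriv j u))" for i j
    using continuous_on_subset[OF h(1)[of i j] closure_subset] by (rule continuous_on_eq) (use h in auto)
  have C2u: "C2 D u (grad u) (hessian u)" "\<And>x. x \<in> D \<Longrightarrow> transpose (hessian u x) = hessian u x"
    using C2_of_partials[OF D(1), of u] d c by blast+
  have C2': "C2 D u G H"
  proof (rule C2_cong[OF C2u(1) D(1)])
    fix x assume x: "x \<in> D"
    then show "u x = u x \<and> grad u x = G x \<and> hessian u x = H x" using GH[OF x] by simp
  qed
  have cone: "H x \<in> closed_cone k" if x: "x \<in> D" for x
  proof -
    have sym: "transpose (H x) = H x" using C2u(2)[OF x] GH(2)[OF x] by simp
    have "0 \<le> msym j (H x)" if j: "j \<in> {1..k}" for j
    proof -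
      have "0 \<le> nsym j (matrix_eigenvalues (H x))"
        using u x j GH(2)[OF x] by (auto simp: k_convex_def Gamma_cone_def)
      then have "0 \<le> esym j (matrix_eigenvalues (H x))"
        using nsym_esym[of "CARD('n)" j] matrix_eigenvalues_esym(1)[OF sym] by (auto simp: zero_le_mult_iff)
      then show ?thesis by (simp add: matrix_eigenvalues_esym(2)[OF sym])
    qed
    then show ?thesis using sym by (simp add: closed_cone_def)
  qed
  have "0 \<le> msym (Suc 0) (H x)" if "x \<in> D" for x using cone[OF that] k by (auto simp: closed_cone_def)
  then have "u x \<le> 0" if "x \<in> D" for x using subharmonic_nonpos[OF D C2' cl u0 _ that] by blast
  then have "adm k D u G H" unfolding adm_def using C2' cl u0 cone g(1) h(1)
    by (auto simp: G_def[abs_def] H_def[abs_def] intro!: continuous_intros)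
  then show ?thesis using that GH(2) C2u(2) by blast
qed

lemma hessian_integral_energy:
  "\<exists>c>0. \<forall>u H. (\<forall>x\<in>D. H x = hessian u x \<and> transpose (hessian u x) = hessian u x) \<longrightarrow>
     hessian_integral j (D :: (real ^ 'n) set) u = c * energy j D u H"
proof -
  obtain c where c: "0 < c" "\<And>xs. length xs = CARD('n) \<Longrightarrow> nsym j xs = c * esym j xs"
    using nsym_esym[of "CARD('n)" j] by blast
  have "hessian_integral j D u = c * energy j D u H" if H: "\<forall>x\<in>D. H x = hessian u x \<and> transpose (hessian u x) = hessian u x" for u H
  proof -
    have "- u x * nsym j (matrix_eigenvalues (hessian u x)) = c * (- u x * msym j (H x))" if "x \<in> D" for x
    proof -
      have h: "H x = hessian u x" "transpose (hessian u x) = hessian u x" using H that by auto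
      show ?thesis
        by (simp add: h(1) c(2)[OF matrix_eigenvalues_esym(1)[OF h(2)]] matrix_eigenvalues_esym(2)[OF h(2)])
    qed
    then have "hessian_integral j D u = (\<integral>x. c * (indicator D x *\<^sub>R (- u x * msym j (H x))) \<partial>lborel)"
      unfolding hessian_integral_def set_lebesgue_integral_def
      by (intro Bochner_Integration.integral_cong) (auto simp: indicator_def)
    then show ?thesis by (simp add: energy_def set_lebesgue_integral_def)
  qed
  then show ?thesis using c(1) by blast
qed

section \<open>A global defining function\<close>

lemma descent_direction:
  fixes f :: "real ^ 'n \<Rightarrow> real"
  assumes "(f has_derivative (\<lambda>h. g \<bullet> h)) (at p)" "f p = 0" "g \<bullet> h < 0"
  shows "\<exists>d>0. \<forall>t. 0 < t \<and> t < d \<longrightarrow> f (p + t *\<^sub>R h) < 0"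
proof -
  have "((\<lambda>t. p + t *\<^sub>R h) has_derivative (\<lambda>t. t *\<^sub>R h)) (at 0)" by (auto intro!: derivative_eq_intros)
  from has_derivative_compose[OF this, of f "\<lambda>h. g \<bullet> h"] assms(1)
  have "((\<lambda>t. f (p + t *\<^sub>R h)) has_real_derivative g \<bullet> h) (at 0)"
    unfolding has_field_derivative_def by (auto elim!: has_derivative_eq_rhs simp: mult.commute)
  from DERIV_neg_dec_right[OF this assms(3)] show ?thesis using assms(2) by auto
qed

text \<open>\<open>p\<close> is a limit of points of \<open>D\<close>, which rules out
  \<open>0 < r p\<close>, and it is not in the open set \<open>D\<close>, which rules out
  \<open>r p < 0\<close>.\<close>

lemma local_defining_zero:
  assumes D: "open D" and l: "local_defining_function D U r" and p: "p \<in> frontier D" "p \<in> U"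
  shows "r p = 0"
proof -
  have U: "open U" "C2 U r (grad r) (hessian r)" "D \<inter> U = {x\<in>U. r x < 0}"
    using l C2_smooth_on by (auto simp: local_defining_function_def)
  have "p \<notin> D" "p \<in> closure D" using p D by (auto simp: frontier_def interior_open)
  have "\<not> 0 < r p"
  proof
    assume "0 < r p"
    have "open (U \<inter> r -` {0<..})" by (intro continuous_open_preimage C2D(3)[OF U(2)] U open_greaterThan)
    moreover have "p \<in> U \<inter> r -` {0<..}" using p \<open>0 < r p\<close> by auto
    moreover have "r x < 0" if "x \<in> D" "x \<in> U" for x using U(3) that by blast
    then have "(U \<inter> r -` {0<..}) \<inter> D = {}" by force
    ultimately show False using \<open>p \<in> closure D\<close> by (meson closure_iff_nhds_not_empty disjoint_iff order_refl)
  qed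
  moreover have "\<not> r p < 0" using U(3) \<open>p \<notin> D\<close> p by blast
  ultimately show ?thesis by simp
qed

text \<open>If the unit normals \<open>a\<close> and \<open>b\<close> differed, the direction
  \<open>b - a\<close> would decrease \<open>r1\<close> and increase \<open>r2\<close>, giving
  points both in \<open>D\<close> and outside. This makes the definite description in
  \<open>outer_normal\<close> meaningful.\<close>

lemma sgn_grad_unique:
  assumes D: "open D" and l1: "local_defining_function D U1 r1" and l2: "local_defining_function D U2 r2"
    and p: "p \<in> frontier D" "p \<in> U1" "p \<in> U2"
  shows "sgn (grad r1 p) = sgn (grad r2 p)"
proof (rule ccontr)
  assume ne: "sgn (grad r1 p) \<noteq> sgn (grad r2 p)"
  define a b where "a = sgn (grad r1 p)" and "b = sgn (grad r2 p)"
  have U1: "open U1" "C2 U1 r1 (grad r1) (hessian r1)" "D \<inter> U1 = {x\<in>U1. r1 x < 0}" "grad r1 p \<noteq> 0"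
    using l1 C2_smooth_on p by (auto simp: local_defining_function_def)
  have U2: "open U2" "C2 U2 r2 (grad r2) (hessian r2)" "D \<inter> U2 = {x\<in>U2. r2 x < 0}" "grad r2 p \<noteq> 0"
    using l2 C2_smooth_on p by (auto simp: local_defining_function_def)
  have ab: "norm a = 1" "norm b = 1" using U1(4) U2(4) by (auto simp: a_def b_def norm_sgn)
  have "a \<bullet> b < 1"
  proof -
    have "(a - b) \<bullet> (a - b) > 0" using ne by (simp add: a_def b_def)
    then show ?thesis using ab by (simp add: inner_diff_left inner_diff_right norm_eq_1 inner_commute)
  qed
  define h where "h = b - a"
  have g: "grad r1 p = norm (grad r1 p) *\<^sub>R a" "grad r2 p = norm (grad r2 p) *\<^sub>R b"
    using U1(4) U2(4) by (auto simp: a_def b_def sgn_div_norm)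
  have "a \<bullet> h < 0" "b \<bullet> - h < 0" using ab \<open>a \<bullet> b < 1\<close> by (auto simp: h_def inner_diff_right norm_eq_1 inner_commute)
  moreover have "grad r1 p \<bullet> h = norm (grad r1 p) * (a \<bullet> h)" by (subst (1) g(1)) simp
  moreover have "- grad r2 p \<bullet> h = norm (grad r2 p) * (b \<bullet> - h)" by (subst (1) g(2)) simp
  ultimately have "grad r1 p \<bullet> h < 0" "- grad r2 p \<bullet> h < 0"
    using U1(4) U2(4) by (auto simp: mult_less_0_iff)
  obtain d1 where d1: "0 < d1" "\<And>t. 0 < t \<Longrightarrow> t < d1 \<Longrightarrow> r1 (p + t *\<^sub>R h) < 0"
    using descent_direction[OF C2D(1)[OF U1(2) p(2)] local_defining_zero[OF D l1 p(1,2)] \<open>grad r1 p \<bullet> h < 0\<close>] by blast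
  have nd: "((\<lambda>x. - r2 x) has_derivative (\<lambda>h. - grad r2 p \<bullet> h)) (at p)"
    using has_derivative_minus[OF C2D(1)[OF U2(2) p(3)]] by simp
  have "- r2 p = 0" using local_defining_zero[OF D l2 p(1,3)] by simp
  then obtain d2 where d2: "0 < d2" "\<And>t. 0 < t \<Longrightarrow> t < d2 \<Longrightarrow> - r2 (p + t *\<^sub>R h) < 0"
    using descent_direction[OF nd _ \<open>- grad r2 p \<bullet> h < 0\<close>] by blast
  have "open ((\<lambda>t. p + t *\<^sub>R h) -` (U1 \<inter> U2))" by (intro continuous_open_vimage open_Int U1 U2 continuous_intros)
  then obtain d3 where d3: "0 < d3" "ball 0 d3 \<subseteq> (\<lambda>t. p + t *\<^sub>R h) -` (U1 \<inter> U2)" using p by (force simp: open_contains_ball)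
  define t where "t = min d1 (min d2 d3) / 2"
  have t: "0 < t" "t < d1" "t < d2" "t < d3" using d1(1) d2(1) d3(1) by (auto simp: t_def min_def)
  have U: "p + t *\<^sub>R h \<in> U1" "p + t *\<^sub>R h \<in> U2" using d3(2) t by (auto simp: subset_iff dist_real_def)
  then have "p + t *\<^sub>R h \<in> D" using d1(2) t U1(3) by blast
  then have "r2 (p + t *\<^sub>R h) < 0" using U U2(3) by blast
  then show False using d2(2) t by force
qed

lemma outer_normal_eq:
  assumes "open D" "local_defining_function D U r" "p \<in> frontier D" "p \<in> U"
  shows "outer_normal D p = sgn (grad r p)"
  unfolding outer_normal_def using assms sgn_grad_unique[OF assms(1)]
  by (intro the_equality) blast+

text \<open>Models a local defining function times a bump. All pieces have the same sign inside and
  outside \<open>D\<close>, and their boundary gradients are nonnegative multiples of the same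
  normal, so nothing cancels in a sum.\<close>

definition defining_piece :: "(real ^ 'n) set \<Rightarrow> real ^ 'n \<Rightarrow> (real ^ 'n \<Rightarrow> real) \<Rightarrow> (real ^ 'n \<Rightarrow> real ^ 'n) \<Rightarrow>
    (real ^ 'n \<Rightarrow> real ^ 'n ^ 'n) \<Rightarrow> real \<Rightarrow> bool" where
  "defining_piece D x f G H e \<longleftrightarrow> 0 < e \<and> C2 UNIV f G H \<and>
     (\<forall>y\<in>D. f y \<le> 0 \<and> (y \<in> ball x e \<longrightarrow> f y < 0)) \<and> (\<forall>y. y \<notin> D \<longrightarrow> 0 \<le> f y) \<and>
     (\<forall>q\<in>frontier D. f q = 0 \<and> (\<exists>c\<ge>0. G q = c *\<^sub>R outer_normal D q \<and> (q \<in> ball x e \<longrightarrow> 0 < c)))"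

lemma defining_piece_exists:
  fixes D :: "(real ^ 'n) set"
  assumes V: "open V" "x \<in> V" "C2 V r Gr Hr" and neg: "\<And>y. y \<in> V \<Longrightarrow> r y < 0 \<longleftrightarrow> y \<in> D"
    and bd: "\<And>q. q \<in> frontier D \<Longrightarrow> q \<in> V \<Longrightarrow> r q = 0 \<and> (\<exists>c>0. Gr q = c *\<^sub>R outer_normal D q)"
  shows "\<exists>f G H e. defining_piece D x f G H e"
proof -
  obtain e where e: "0 < e" "cball x e \<subseteq> V" using V by (auto simp: open_contains_cball)
  \<comment> \<open>The third power of the positive part makes the bump of class C2.\<close>
  define q where "q t = (max 0 (e\<^sup>2 - t)) ^ 3" for t :: real
  define q1 where "q1 t = - 3 * (max 0 (e\<^sup>2 - t))\<^sup>2" for t :: real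
  define q2 where "q2 t = 6 * max 0 (e\<^sup>2 - t)" for t :: real
  have dq: "(q has_real_derivative q1 t) (at t)" for t
  proof -
    have P: "((\<lambda>x. (max 0 x) ^ 3) has_real_derivative 3 * (max 0 x)\<^sup>2) (at x)" for x :: real
      using has_real_derivative_pos_power[of 1 x] by (simp add: numeral_3_eq_3 numeral_2_eq_2)
    have "((\<lambda>t. (max 0 (e\<^sup>2 - t)) ^ 3) has_real_derivative 3 * (max 0 (e\<^sup>2 - t))\<^sup>2 * (- 1)) (at t)"
      by (rule DERIV_chain2[where f = "\<lambda>x. (max 0 x) ^ 3" and g = "\<lambda>t. e\<^sup>2 - t", OF P])
        (auto intro!: derivative_eq_intros)
    then show ?thesis by (simp add: q_def[abs_def] q1_def)
  qed
  have dq1: "(q1 has_real_derivative q2 t) (at t)" for t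
  proof -
    have P: "((\<lambda>x. (max 0 x)\<^sup>2) has_real_derivative 2 * max 0 x) (at x)" for x :: real
      using has_real_derivative_pos_power[of 0 x] by (simp add: numeral_2_eq_2)
    have "((\<lambda>t. (max 0 (e\<^sup>2 - t))\<^sup>2) has_real_derivative 2 * max 0 (e\<^sup>2 - t) * (- 1)) (at t)"
      by (rule DERIV_chain2[where f = "\<lambda>x. (max 0 x)\<^sup>2" and g = "\<lambda>t. e\<^sup>2 - t", OF P])
        (auto intro!: derivative_eq_intros)
    from DERIV_cmult[OF this, of "-3"] show ?thesis by (simp add: q1_def[abs_def] q2_def)
  qed
  have cq2: "continuous_on UNIV q2" unfolding q2_def by (intro continuous_intros)
  define b where "b y = q ((y - x) \<bullet> (y - x))" for y
  define Gb where "Gb y = q1 ((y - x) \<bullet> (y - x)) *\<^sub>R (2 *\<^sub>R (y - x))" for y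
  define Hb where "Hb y = q1 ((y - x) \<bullet> (y - x)) *\<^sub>R (2 *\<^sub>R mat 1) + q2 ((y - x) \<bullet> (y - x)) *\<^sub>R outer (2 *\<^sub>R (y - x)) (2 *\<^sub>R (y - x))" for y
  have C2b: "C2 S b Gb Hb" for S unfolding b_def[abs_def] Gb_def[abs_def] Hb_def[abs_def]
    by (rule C2_compose[OF C2_sq_dist dq dq1 cq2])
  have sq: "(y - x) \<bullet> (y - x) = (dist x y)\<^sup>2" for y
    unfolding dist_norm norm_minus_commute[of x y] power2_norm_eq_inner ..
  have b0: "b y = 0 \<and> Gb y = 0 \<and> Hb y = 0" if "y \<notin> ball x e" for y
  proof -
    have "e\<^sup>2 \<le> (dist x y)\<^sup>2" using that e by (intro power_mono) auto
    then show ?thesis by (simp add: b_def Gb_def Hb_def q_def q1_def q2_def sq max_def)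
  qed
  have b1: "0 < b y" if "y \<in> ball x e" for y
  proof -
    have "(dist x y)\<^sup>2 < e\<^sup>2" using that e by (intro power_strict_mono) auto
    then show ?thesis by (simp add: b_def q_def sq)
  qed
  have b2: "0 \<le> b y" for y by (simp add: b_def q_def)
  define f where "f y = (if y \<in> V then b y * r y else 0)" for y
  define G where "G y = (if y \<in> V then b y *\<^sub>R Gr y + r y *\<^sub>R Gb y else 0)" for y
  define H where "H y = (if y \<in> V then (b y *\<^sub>R Hr y + outer (Gr y) (Gb y)) + (r y *\<^sub>R Hb y + outer (Gb y) (Gr y)) else 0)" for y
  have "C2 V f G H" by (rule C2_cong[OF C2_mult[OF C2b V(3)] V(1)]) (auto simp: f_def G_def H_def)
  moreover have "C2 (- cball x e) f G H"
    by (rule C2_cong[OF C2_const[of _ 0]]) (use b0 in \<open>auto simp: f_def G_def H_def\<close>)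
  moreover have "V \<union> - cball x e = UNIV" using e by auto
  ultimately have C2f: "C2 UNIV f G H" using C2_Un[of V f G H "- cball x e"] V(1) by (simp add: open_Compl)
  have "defining_piece D x f G H e" unfolding defining_piece_def
  proof (intro conjI ballI allI impI)
    fix y assume y: "y \<in> D"
    show "f y \<le> 0" using neg[of y] b2[of y] y by (auto simp: f_def mult_nonneg_nonpos)
    assume yb: "y \<in> ball x e"
    then have "y \<in> V" using e by auto
    then show "f y < 0" using neg[of y] b1[OF yb] y by (auto simp: f_def mult_pos_neg)
  next
    fix y assume "y \<notin> D"
    then show "0 \<le> f y" using neg[of y] b2[of y] by (auto simp: f_def not_less)
  next
    fix p assume p: "p \<in> frontier D"
    show "f p = 0" using bd[OF p] by (simp add: f_def)
    show "\<exists>c\<ge>0. G p = c *\<^sub>R outer_normal D p \<and> (p \<in> ball x e \<longrightarrow> 0 < c)"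
    proof (cases "p \<in> V")
      case True
      then obtain c where c: "0 < c" "Gr p = c *\<^sub>R outer_normal D p" "r p = 0" using bd[OF p] by blast
      then show ?thesis using True b1[of p] b2[of p] by (intro exI[of _ "b p * c"]) (auto simp: G_def)
    next
      case False
      then have "p \<notin> ball x e" using e by (auto simp: subset_iff)
      then show ?thesis using False by (intro exI[of _ 0]) (auto simp: G_def)
    qed
  qed (use e C2f in auto)
  then show ?thesis by blast
qed

lemma C2_sum:
  assumes "finite F" "\<And>a. a \<in> F \<Longrightarrow> C2 S (f a) (G a) (H a)"
  shows "C2 S (\<lambda>x. \<Sum>a\<in>F. f a x) (\<lambda>x. \<Sum>a\<in>F. G a x) (\<lambda>x. \<Sum>a\<in>F. H a x)"
  using assms
proof (induction F rule: finite_induct)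
  case empty
  then show ?case using C2_const[of S 0] by simp
next
  case (insert a F)
  then show ?case using C2_add[of S "f a" "G a" "H a" "\<lambda>x. \<Sum>a\<in>F. f a x" "\<lambda>x. \<Sum>a\<in>F. G a x" "\<lambda>x. \<Sum>a\<in>F. H a x"] by simp
qed

text \<open>Finitely many pieces covering the closure are added; at every point of it some piece is
  strictly active, which gives negativity in \<open>D\<close> and a nonzero gradient on the
  boundary.\<close>

proposition global_defining_function:
  fixes D :: "(real ^ 'n) set"
  assumes "smooth_bounded_domain D"
  obtains r G H where "C2 UNIV r G H" "D = {x. r x < 0}"
    "\<And>q. q \<in> frontier D \<Longrightarrow> r q = 0 \<and> G q \<noteq> 0 \<and> outer_normal D q = sgn (G q)"
proof -
  have D: "open D" "bounded D" and loc: "\<And>p. p \<in> frontier D \<Longrightarrow> \<exists>U r. p \<in> U \<and> local_defining_function D U r"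
    using assms by (auto simp: smooth_bounded_domain_def)
  have ex: "\<exists>f G H e. defining_piece D x f G H e" if x: "x \<in> closure D" for x
  proof (cases "x \<in> D")
    case True
    \<comment> \<open>At interior points the constant \<open>-1\<close> on the open set
      \<open>D\<close>, which contains no boundary points, serves as local defining
      function.\<close>
    show ?thesis
      by (rule defining_piece_exists[OF D(1) True C2_const[of _ "-1"]]) (use D(1) in \<open>auto simp: frontier_def interior_open\<close>)
  next
    case False
    then have "x \<in> frontier D" using x D(1) by (simp add: frontier_def interior_open)
    then obtain U r where U: "x \<in> U" "local_defining_function D U r" using loc by blast
    then have U': "open U" "C2 U r (grad r) (hessian r)" "D \<inter> U = {x\<in>U. r x < 0}" "\<And>y. y \<in> U \<Longrightarrow> grad r y \<noteq> 0"
      using C2_smooth_on by (auto simp: local_defining_function_def)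
    show ?thesis
    proof (rule defining_piece_exists[OF U'(1) U(1) U'(2)])
      show "r y < 0 \<longleftrightarrow> y \<in> D" if "y \<in> U" for y using U'(3) that by blast
      fix q assume q: "q \<in> frontier D" "q \<in> U"
      have "grad r q = norm (grad r q) *\<^sub>R outer_normal D q"
        using outer_normal_eq[OF D(1) U(2) q] U'(4)[OF q(2)] by (simp add: sgn_div_norm)
      then show "r q = 0 \<and> (\<exists>c>0. grad r q = c *\<^sub>R outer_normal D q)"
        using local_defining_zero[OF D(1) U(2) q] U'(4)[OF q(2)] by (metis zero_less_norm_iff)
    qed
  qed
  then obtain f G H e where piece: "\<And>x. x \<in> closure D \<Longrightarrow> defining_piece D x (f x) (G x) (H x) (e x)" by metis
  have cpt: "compact (closure D)" using D by (simp add: compact_closure)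
  have "\<And>x. x \<in> closure D \<Longrightarrow> 0 < e x" using piece by (auto simp: defining_piece_def)
  then have cover: "closure D \<subseteq> (\<Union>x\<in>closure D. ball x (e x))" by force
  obtain F where F: "F \<subseteq> closure D" "finite F" "closure D \<subseteq> (\<Union>x\<in>F. ball x (e x))"
    by (rule compactE_image[where f = "\<lambda>x. ball x (e x)", OF cpt open_ball cover])
  define R where "R y = (\<Sum>x\<in>F. f x y)" for y
  have piece': "defining_piece D x (f x) (G x) (H x) (e x)" if "x \<in> F" for x using piece F(1) that by blast
  have C2R: "C2 UNIV R (\<lambda>y. \<Sum>x\<in>F. G x y) (\<lambda>y. \<Sum>x\<in>F. H x y)" unfolding R_def[abs_def]
    using piece' by (intro C2_sum F(2)) (auto simp: defining_piece_def)
  have neg: "R y < 0" if y: "y \<in> D" for y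
  proof -
    obtain x where x: "x \<in> F" "y \<in> ball x (e x)" using F(3) y closure_subset by blast
    have "R y = f x y + (\<Sum>x\<in>F - {x}. f x y)" unfolding R_def using F(2) x(1) by (rule sum.remove)
    moreover have "(\<Sum>x\<in>F - {x}. f x y) \<le> 0" using piece' y by (intro sum_nonpos) (auto simp: defining_piece_def)
    moreover have "f x y < 0" using piece'[OF x(1)] x(2) y by (auto simp: defining_piece_def)
    ultimately show ?thesis by linarith
  qed
  have pos: "0 \<le> R y" if "y \<notin> D" for y
    unfolding R_def using piece' that by (intro sum_nonneg) (auto simp: defining_piece_def)
  have bd: "R q = 0 \<and> (\<Sum>x\<in>F. G x q) \<noteq> 0 \<and> outer_normal D q = sgn (\<Sum>x\<in>F. G x q)" if q: "q \<in> frontier D" for q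
  proof -
    have "\<forall>x\<in>F. \<exists>c\<ge>0. G x q = c *\<^sub>R outer_normal D q \<and> (q \<in> ball x (e x) \<longrightarrow> 0 < c)"
      using piece' q by (auto simp: defining_piece_def)
    then obtain c where c: "\<And>x. x \<in> F \<Longrightarrow> 0 \<le> c x \<and> G x q = c x *\<^sub>R outer_normal D q \<and> (q \<in> ball x (e x) \<longrightarrow> 0 < c x)"
      by metis
    obtain x where x: "x \<in> F" "q \<in> ball x (e x)" using F(3) q by (auto simp: frontier_def)
    have "0 < (\<Sum>x\<in>F. c x)" using F(2) c x by (intro sum_pos2[of F x]) auto
    moreover have "(\<Sum>x\<in>F. G x q) = (\<Sum>x\<in>F. c x) *\<^sub>R outer_normal D q"
      unfolding scaleR_left.sum by (intro sum.cong) (use c in auto)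
    moreover have "norm (outer_normal D q) = 1"
    proof -
      obtain U r where U: "q \<in> U" "local_defining_function D U r" using loc[OF q] by blast
      then show ?thesis using outer_normal_eq[OF D(1) U(2) q U(1)] by (auto simp: local_defining_function_def norm_sgn)
    qed
    moreover have "R q = 0" unfolding R_def using piece' q by (intro sum.neutral) (auto simp: defining_piece_def)
    ultimately show ?thesis by (auto simp: sgn_div_norm)
  qed
  have "D = {x. R x < 0}" using neg pos by force
  then show ?thesis using that C2R bd by blast
qed

section \<open>Boundary geometry\<close>

lemma compress_add: "compress N (A + B) = compress N A + compress N B"
  by (simp add: compress_def matrix_add_ldistrib matrix_add_rdistrib)

lemma compress_scale: "compress N (c *\<^sub>R A) = c *\<^sub>R compress N A"
  by (simp add: compress_def matrix_scaleR_left matrix_scaleR_right)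

text \<open>By the rank-one formula, \<open>msym j\<close> of the compression is the increase of
  \<open>msym (Suc j)\<close> when \<open>outer N N\<close> is added, and this is nonnegative by
  monotonicity.\<close>

lemma compress_closed_cone:
  fixes A :: "real ^ 'n ^ 'n"
  assumes A: "A \<in> closed_cone k" and N: "norm N = 1" and k: "1 \<le> k" "k \<le> CARD('n)"
  shows "compress N A \<in> closed_cone (k - 1)"
proof -
  have "0 \<le> msym j (compress N A)" if j: "j \<in> {1..k - 1}" for j
  proof -
    have Sj: "A \<in> closed_cone (Suc j)" "Suc j \<le> CARD('n)" using A closed_cone_mono[of "Suc j" k] j k by fastforce+
    have "msym (Suc j) A \<le> msym (Suc j) (A + 1 *\<^sub>R outer N N)"
      using Sj by (intro closed_cone_msym_add closed_cone_scale outer_closed_cone) auto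
    then show ?thesis unfolding msym_add_rank_one[OF N] by simp
  qed
  then show ?thesis using A by (simp add: closed_cone_def transpose_compress)
qed

lemma compress_psd:
  assumes sym: "transpose A = A" and N: "norm N = 1" and psd: "\<And>v. v \<bullet> N = 0 \<Longrightarrow> 0 \<le> (A *v v) \<bullet> v"
  shows "compress N A \<in> closed_cone k"
proof (rule psd_closed_cone)
  show "transpose (compress N A) = compress N A" by (rule transpose_compress[OF sym])
  fix v
  have "(compress N A *v v) \<bullet> v = (A *v (proj_mat N *v v)) \<bullet> (proj_mat N *v v)"
    unfolding compress_mult by (rule symmetric_dot[OF transpose_proj_mat])
  moreover have "N \<bullet> N = 1" using N by (simp add: norm_eq_1)
  then have "(proj_mat N *v v) \<bullet> N = 0" by (simp add: proj_mat_mult inner_diff_left) (rule inner_commute)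
  ultimately show "0 \<le> (compress N A *v v) \<bullet> v" using psd by simp
qed

lemma line_has_real_derivative:
  fixes f :: "real ^ 'n \<Rightarrow> real"
  assumes "(f has_derivative (\<lambda>h. g \<bullet> h)) (at (c s))" "(c has_vector_derivative c') (at s)"
  shows "((\<lambda>s. f (c s)) has_real_derivative g \<bullet> c') (at s)"
  using has_derivative_compose[OF assms(2)[unfolded has_vector_derivative_def] assms(1)]
  unfolding has_field_derivative_def by (rule has_derivative_eq_rhs) (auto simp: mult.commute)

lemma line_gradient_has_real_derivative:
  fixes G :: "real ^ 'n \<Rightarrow> real ^ 'n"
  assumes "(G has_derivative (\<lambda>h. H *v h)) (at (c s))" "(c has_vector_derivative c' s) (at s)" "(c' has_vector_derivative c'') (at s)"
  shows "((\<lambda>s. G (c s) \<bullet> c' s) has_real_derivative (H *v c' s) \<bullet> c' s + G (c s) \<bullet> c'') (at s)"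
proof -
  have "((\<lambda>s. G (c s)) has_derivative (\<lambda>h. H *v (h *\<^sub>R c' s))) (at s)"
    by (rule has_derivative_compose[OF assms(2)[unfolded has_vector_derivative_def] assms(1)])
  from has_derivative_inner[OF this assms(3)[unfolded has_vector_derivative_def]]
  show ?thesis unfolding has_field_derivative_def
    by (rule has_derivative_eq_rhs) (auto simp: matrix_vector_mult_scaleR algebra_simps)
qed

section \<open>Domains with a global defining function\<close>

locale defined_domain =
  fixes D :: "(real ^ 'n) set" and r :: "real ^ 'n \<Rightarrow> real" and G :: "real ^ 'n \<Rightarrow> real ^ 'n" and H :: "real ^ 'n \<Rightarrow> real ^ 'n ^ 'n"
  assumes C2r: "C2 UNIV r G H" and D_eq: "D = {x. r x < 0}" and bounded_D: "bounded D" and connected_D: "connected D"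
    and frontier_D: "\<And>q. q \<in> frontier D \<Longrightarrow> r q = 0 \<and> G q \<noteq> 0 \<and> outer_normal D q = sgn (G q)"
begin

lemma open_D: "open D"
  unfolding D_eq by (intro open_Collect_less continuous_on_const C2D(3)[OF C2r])

lemma closure_D: "x \<in> closure D \<Longrightarrow> x \<notin> D \<Longrightarrow> x \<in> frontier D"
  using open_D by (simp add: frontier_def interior_open)

lemma compact_closure_D: "compact (closure D)"
  using bounded_D by (simp add: compact_closure)

lemma compact_frontier_D: "compact (frontier D)"
  using bounded_D by (rule compact_frontier_bounded)

lemma symH: "transpose (H x) = H x"
  using hessian_symmetric[of UNIV x r G "H x"] C2D[OF C2r] by simp

definition nu :: "real ^ 'n \<Rightarrow> real ^ 'n" where "nu q = sgn (G q)"

lemma nu: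
  assumes "q \<in> frontier D"
  shows "norm (nu q) = 1" "G q = norm (G q) *\<^sub>R nu q" "0 < norm (G q)" "outer_normal D q = nu q"
  using frontier_D[OF assms] by (auto simp: nu_def norm_sgn sgn_div_norm)

text \<open>On tangent vectors this represents the second fundamental form: the derivative of the
  normalizing factor \<open>1 / norm (G q)\<close> only adds multiples of the normal.\<close>

definition shape :: "real ^ 'n \<Rightarrow> real ^ 'n ^ 'n" where
  "shape q = inverse (norm (G q)) *\<^sub>R H q"

lemma sym_shape: "transpose (shape q) = shape q"
  by (simp add: shape_def transpose_scalar symH)

text \<open>For small \<open>t\<close> the segment from \<open>p + t (v - e nu)\<close> to
  \<open>p + t (v + e nu)\<close> runs from \<open>D\<close> to its complement and therefore meets
  the boundary. So every tangent vector is a limit of directions towards boundary points.\<close>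

lemma frontier_near_tangent:
  assumes p: "p \<in> frontier D" and v: "v \<bullet> nu p = 0" and e: "0 < e"
  shows "\<exists>d>0. \<forall>t. 0 < t \<and> t < d \<longrightarrow> (\<exists>s. \<bar>s\<bar> \<le> e * t \<and> p + (t *\<^sub>R v + s *\<^sub>R nu p) \<in> frontier D)"
proof -
  note np = nu[OF p]
  have Gv: "G p \<bullet> v = 0" by (subst np(2)) (simp add: v inner_commute)
  have GN: "G p \<bullet> nu p = norm (G p)" by (subst np(2)) (simp add: np(1) norm_eq_1[symmetric])
  have "G p \<bullet> (v - e *\<^sub>R nu p) < 0" using Gv GN e np(3) by (simp add: inner_diff_right)
  with descent_direction[OF C2D(1)[OF C2r UNIV_I], of p "v - e *\<^sub>R nu p"] frontier_D[OF p]
  obtain d1 where d1: "0 < d1" "\<And>t. 0 < t \<Longrightarrow> t < d1 \<Longrightarrow> r (p + t *\<^sub>R (v - e *\<^sub>R nu p)) < 0" by blast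
  have "((\<lambda>x. - r x) has_derivative (\<lambda>h. - G p \<bullet> h)) (at p)"
    using has_derivative_minus[OF C2D(1)[OF C2r UNIV_I, of p]] by simp
  moreover have "- G p \<bullet> (v + e *\<^sub>R nu p) < 0" using Gv GN e np(3) by (simp add: inner_add_right)
  moreover have "- r p = 0" using frontier_D[OF p] by simp
  ultimately obtain d2 where d2: "0 < d2" "\<And>t. 0 < t \<Longrightarrow> t < d2 \<Longrightarrow> - r (p + t *\<^sub>R (v + e *\<^sub>R nu p)) < 0"
    using descent_direction[of "\<lambda>x. - r x" "- G p" p "v + e *\<^sub>R nu p"] by blast
  have "\<exists>s. \<bar>s\<bar> \<le> e * t \<and> p + (t *\<^sub>R v + s *\<^sub>R nu p) \<in> frontier D" if t: "0 < t" "t < min d1 d2" for t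
  proof -
    define S where "S = (\<lambda>s. p + (t *\<^sub>R v + s *\<^sub>R nu p)) ` {- (e * t)..e * t}"
    have et: "0 < e * t" using e t by simp
    have "connected S" unfolding S_def by (intro connected_continuous_image continuous_intros) auto
    moreover have "p + (t *\<^sub>R v + (- (e * t)) *\<^sub>R nu p) \<in> S \<inter> D"
      using d1(2)[of t] t et unfolding S_def D_eq by (intro IntI imageI) (auto simp: algebra_simps)
    moreover have "p + (t *\<^sub>R v + (e * t) *\<^sub>R nu p) \<in> S - D"
      using d2(2)[of t] t et unfolding S_def D_eq by (intro DiffI imageI) (auto simp: algebra_simps)
    ultimately have "S \<inter> frontier D \<noteq> {}" using connected_Int_frontier[of S D] by blast
    then obtain s where "s \<in> {- (e * t)..e * t}" "p + (t *\<^sub>R v + s *\<^sub>R nu p) \<in> frontier D"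
      unfolding S_def by blast
    then show ?thesis by (intro exI[of _ s]) (auto simp: abs_le_iff)
  qed
  then show ?thesis using d1(1) d2(1) by (intro exI[of _ "min d1 d2"]) auto
qed

text \<open>\<open>frechet_derivative\<close> within the boundary selects one of several
  derivatives. Two of them differ by some \<open>M\<close> as here, and testing it on boundary
  points \<open>p + t v + s nu\<close> with \<open>s\<close> small relative to \<open>t\<close>
  shows that they agree on tangent vectors.\<close>

lemma frontier_derivative_zero:
  assumes p: "p \<in> frontier D" and M: "((\<lambda>x. 0) has_derivative M) (at p within frontier D)" and v: "v \<bullet> nu p = 0"
  shows "M v = (0 :: real ^ 'n)"
proof -
  have lin: "linear M" using M by (rule has_derivative_linear)
  have le: "norm (M v) \<le> e * (norm v + 1 + norm (M (nu p)))" if e: "0 < e" "e < 1" for e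
  proof -
    have "\<exists>d>0. \<forall>y\<in>frontier D. norm (y - p) < d \<longrightarrow> norm (0 - 0 - M (y - p)) \<le> e * norm (y - p)"
      using M e(1) unfolding has_derivative_within_alt by blast
    then obtain d where d: "0 < d" "\<And>y. y \<in> frontier D \<Longrightarrow> norm (y - p) < d \<Longrightarrow> norm (M (y - p)) \<le> e * norm (y - p)"
      by auto
    obtain d' where d': "0 < d'" "\<And>t. 0 < t \<Longrightarrow> t < d' \<Longrightarrow> \<exists>s. \<bar>s\<bar> \<le> e * t \<and> p + (t *\<^sub>R v + s *\<^sub>R nu p) \<in> frontier D"
      using frontier_near_tangent[OF p v e(1)] by blast
    define t where "t = min d' (d / (norm v + 1)) / 2"
    have nv: "0 < norm v + 1" by (simp add: add_nonneg_pos)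
    have t: "0 < t" "t < d'" "t * (norm v + 1) < d"
    proof -
      define m where "m = min d' (d / (norm v + 1))"
      have "0 < m" "m \<le> d'" "m \<le> d / (norm v + 1)" using d(1) d'(1) nv by (auto simp: m_def)
      then have "0 < t" "t < d'" "t < d / (norm v + 1)" unfolding t_def m_def[symmetric] by linarith+
      then show "0 < t" "t < d'" "t * (norm v + 1) < d" using nv by (auto simp: pos_less_divide_eq)
    qed
    obtain s where s: "\<bar>s\<bar> \<le> e * t" "p + (t *\<^sub>R v + s *\<^sub>R nu p) \<in> frontier D" using d'(2) t by blast
    define h where "h = t *\<^sub>R v + s *\<^sub>R nu p"
    have "norm h \<le> t * norm v + \<bar>s\<bar>"
      using norm_triangle_ineq[of "t *\<^sub>R v" "s *\<^sub>R nu p"] nu(1)[OF p] t(1) by (simp add: h_def)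
    moreover have "e * t \<le> 1 * t" using e t by (intro mult_right_mono) auto
    ultimately have nh: "norm h \<le> t * (norm v + 1)" using s(1) by (simp add: algebra_simps)
    have Mh: "norm (M h) \<le> e * norm h" using d(2)[of "p + h"] s(2) nh t(3) by (simp add: h_def)
    have "M h = t *\<^sub>R M v + s *\<^sub>R M (nu p)" using lin by (simp add: h_def linear_add linear_scale)
    then have "t *\<^sub>R M v = M h - s *\<^sub>R M (nu p)" by simp
    then have "t * norm (M v) \<le> norm (M h) + \<bar>s\<bar> * norm (M (nu p))"
      using norm_triangle_ineq4[of "M h" "s *\<^sub>R M (nu p)"] t(1) by (metis abs_of_pos norm_scaleR)
    also have "\<dots> \<le> e * (t * (norm v + 1)) + e * t * norm (M (nu p))"
      using Mh nh s(1) e by (intro add_mono mult_right_mono order_trans[OF Mh] mult_left_mono) auto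
    also have "\<dots> = t * (e * (norm v + 1 + norm (M (nu p))))" by (simp add: algebra_simps)
    finally show ?thesis using t(1) by simp
  qed
  define C where "C = norm v + 1 + norm (M (nu p))"
  have C: "0 < C" by (simp add: C_def add_pos_nonneg add_nonneg_pos)
  have "norm (M v) \<le> 0"
  proof (rule field_le_epsilon)
    fix e :: real assume e: "0 < e"
    define e' where "e' = min (e / C) (1 / 2)"
    have "0 < e'" "e' < 1" "e' \<le> e / C" using e C by (auto simp: e'_def)
    then have "norm (M v) \<le> e' * C" "e' * C \<le> e" using le C by (auto simp: C_def[symmetric] pos_le_divide_eq)
    then show "norm (M v) \<le> 0 + e" by simp
  qed
  then show ?thesis by simp
qed

lemma second_fundamental_form_eq:
  assumes p: "p \<in> frontier D" and v: "v \<bullet> nu p = 0" and w: "w \<bullet> nu p = 0"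
  shows "second_fundamental_form D p v w = (shape p *v v) \<bullet> w"
proof -
  have Gp: "G p \<noteq> 0" using frontier_D[OF p] by simp
  have "(norm has_derivative (\<lambda>h. h \<bullet> sgn (G p))) (at (G p))" using Gp has_derivative_norm[of "G p"] by (simp add: inner_commute)
  from has_derivative_compose[OF C2D(2)[OF C2r UNIV_I] this]
  have "((\<lambda>x. norm (G x)) has_derivative (\<lambda>h. (H p *v h) \<bullet> sgn (G p))) (at p)" .
  from Deriv.has_derivative_inverse[OF _ this] Gp
  obtain \<phi>' where "((\<lambda>x. inverse (norm (G x))) has_derivative \<phi>') (at p)" by auto
  from has_derivative_scaleR[OF this C2D(2)[OF C2r UNIV_I]]
  have dN: "((\<lambda>x. inverse (norm (G x)) *\<^sub>R G x) has_derivative (\<lambda>h. inverse (norm (G p)) *\<^sub>R (H p *v h) + \<phi>' h *\<^sub>R G p)) (at p within frontier D)"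
    (is "(_ has_derivative ?L) _") by (rule has_derivative_at_withinI)
  have dnu: "(outer_normal D has_derivative ?L) (at p within frontier D)"
    by (rule has_derivative_transform[OF p _ dN]) (use frontier_D in \<open>auto simp: sgn_div_norm divide_inverse\<close>)
  \<comment> \<open>\<open>?F\<close> is an arbitrary choice among the derivatives, but on
    \<open>v\<close> it agrees with \<open>?L\<close>, whose second term is normal to the
    boundary.\<close>
  let ?F = "frechet_derivative (outer_normal D) (at p within frontier D)"
  have "(outer_normal D has_derivative ?F) (at p within frontier D)"
    using dnu frechet_derivative_works differentiableI by blast
  from has_derivative_diff[OF this dnu] have "((\<lambda>x. 0) has_derivative (\<lambda>h. ?F h - ?L h)) (at p within frontier D)" by simp
  from frontier_derivative_zero[OF p this v] have "?F v = ?L v" by simp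
  moreover have "G p \<bullet> w = 0" by (subst nu(2)[OF p]) (simp add: w inner_commute)
  ultimately show ?thesis
    by (simp add: second_fundamental_form_def inner_add_left shape_def scaleR_matrix_vector_assoc[symmetric])
qed

lemma principal_curvatures_esym:
  assumes p: "p \<in> frontier D"
  shows "length (principal_curvatures D p) = CARD('n) - 1"
    "esym j (principal_curvatures D p) = msym j (compress (nu p) (shape p))"
proof -
  define T where "T = {v. v \<bullet> nu p = 0}"
  have bt: "boundary_tangent D p = T" by (simp add: boundary_tangent_def T_def nu(4)[OF p])
  have "{v \<in> T. \<forall>w\<in>T. second_fundamental_form D p v w = a * (v \<bullet> w)} = {v \<in> T. \<forall>w\<in>T. (shape p *v v) \<bullet> w = a * (v \<bullet> w)}" for a
    using second_fundamental_form_eq[OF p] by (auto simp: T_def)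
  then have "principal_curvatures D p = eigenvalue_list (\<lambda>a. {v \<in> T. \<forall>w\<in>T. (shape p *v v) \<bullet> w = a * (v \<bullet> w)})"
    by (simp add: principal_curvatures_def bt)
  then show "length (principal_curvatures D p) = CARD('n) - 1"
    "esym j (principal_curvatures D p) = msym j (compress (nu p) (shape p))"
    using compress_eigenvalues[OF sym_shape nu(1)[OF p] T_def] by simp_all
qed

subsection \<open>The Hopf lemma\<close>

text \<open>For large \<open>t\<close>, \<open>1 - exp (- (t * r x))\<close> is strictly
  superharmonic where the gradient of \<open>r\<close> is bounded away from \<open>0\<close>. A
  small multiple lies above \<open>u\<close>: both vanish on the boundary, and on the inner side of
  the collar \<open>u\<close> is bounded away from \<open>0\<close>.\<close>

lemma collar_barrier:
  assumes u: "C2 D u Gu Hu" "continuous_on (closure D) u" and u0: "\<And>x. x \<in> frontier D \<Longrightarrow> u x = 0"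
    and neg: "\<And>x. x \<in> D \<Longrightarrow> u x < 0" and tr: "\<And>x. x \<in> D \<Longrightarrow> 0 \<le> msym (Suc 0) (Hu x)"
  obtains a t d where "0 < a" "0 < t" "0 < d" "\<And>x. x \<in> closure D \<Longrightarrow> - d \<le> r x \<Longrightarrow> u x \<le> a * (1 - exp (- (t * r x)))"
proof -
  have cr: "continuous_on S r" and cG: "continuous_on S G" and cH: "continuous_on S H" for S
    using C2D[OF C2_subset[OF C2r subset_UNIV]] by auto
  \<comment> \<open>The critical points of \<open>r\<close> form a compact subset of
    \<open>D\<close>, so \<open>r \<le> - m0\<close> there, and the collar with
    \<open>d = m0 / 2\<close> contains none of them.\<close>
  define B where "B = {x \<in> closure D. G x = 0}"
  have "B = closure D \<inter> {x. G x = 0}" by (auto simp: B_def)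
  then have "compact B" using compact_closure_D closed_Collect_eq[OF cG continuous_on_const]
    by (simp add: compact_Int_closed)
  moreover have "r x < 0" if "x \<in> B" for x using that closure_D[of x] frontier_D D_eq by (auto simp: B_def)
  ultimately obtain m0 where m0: "0 < m0" "\<And>x. x \<in> B \<Longrightarrow> r x \<le> - m0"
    using negative_compact_bound[OF _ cr] by metis
  define d where "d = m0 / 2"
  have d: "0 < d" using m0 by (simp add: d_def)
  define K where "K = {x \<in> closure D. - d \<le> r x}"
  have "K = closure D \<inter> {x. - d \<le> r x}" by (auto simp: K_def)
  then have K: "compact K" using compact_closure_D closed_Collect_le[OF continuous_on_const cr]
    by (simp add: compact_Int_closed)
  have "- (G x \<bullet> G x) < 0" if "x \<in> K" for x
  proof -
    have "x \<notin> B" using that m0 d by (auto simp: K_def d_def dest!: m0(2))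
    then show ?thesis using that by (auto simp: B_def K_def)
  qed
  then obtain g where g: "0 < g" "\<And>x. x \<in> K \<Longrightarrow> - (G x \<bullet> G x) \<le> - g"
    using negative_compact_bound[OF K, of "\<lambda>x. - (G x \<bullet> G x)"] continuous_on_minus[OF continuous_on_inner[OF cG cG]] by blast
  have "bounded ((\<lambda>x. msym (Suc 0) (H x)) ` K)"
    by (intro compact_imp_bounded compact_continuous_image K continuous_on_msym cH)
  then obtain M where M: "\<And>x. x \<in> K \<Longrightarrow> \<bar>msym (Suc 0) (H x)\<bar> \<le> M" by (auto simp: bounded_iff)
  \<comment> \<open>Large enough for \<open>t * (G x \<bullet> G x)\<close> to exceed the trace of
    \<open>H x\<close> on the collar.\<close>
  define t where "t = \<bar>M\<bar> / g + 1"
  have t: "0 < t" "\<bar>M\<bar> < t * g" using g(1) by (auto simp: t_def field_simps add_nonneg_pos)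
  define w where "w x = 1 - exp (- (t * r x))" for x
  define Hw where "Hw x = (t * exp (- (t * r x))) *\<^sub>R H x + (- t\<^sup>2 * exp (- (t * r x))) *\<^sub>R outer (G x) (G x)" for x
  have C2w: "C2 UNIV w (\<lambda>x. (t * exp (- (t * r x))) *\<^sub>R G x) Hw" unfolding w_def[abs_def] Hw_def[abs_def]
  proof (rule C2_compose[OF C2r, where q = "\<lambda>s. 1 - exp (- (t * s))" and ?q1.0 = "\<lambda>s. t * exp (- (t * s))" and ?q2.0 = "\<lambda>s. - t\<^sup>2 * exp (- (t * s))"])
    show "((\<lambda>s. 1 - exp (- (t * s))) has_real_derivative t * exp (- (t * s))) (at s)" for s
      by (auto intro!: derivative_eq_intros)
    show "((\<lambda>s. t * exp (- (t * s))) has_real_derivative - t\<^sup>2 * exp (- (t * s))) (at s)" for s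
      by (auto intro!: derivative_eq_intros simp: power2_eq_square)
  qed (intro continuous_intros)
  have trw: "msym (Suc 0) (Hw x) < 0" if x: "x \<in> K" for x
  proof -
    have "msym (Suc 0) (Hw x) = t * exp (- (t * r x)) * (msym (Suc 0) (H x) - t * (G x \<bullet> G x))"
      unfolding Hw_def msym_1_add msym_1_scale msym_1_outer by (simp add: power2_eq_square algebra_simps)
    moreover have "t * g \<le> t * (G x \<bullet> G x)" using g(2)[OF x] t by (intro mult_left_mono) auto
    then have "msym (Suc 0) (H x) - t * (G x \<bullet> G x) < 0" using M[OF x] t(2) by linarith
    ultimately show ?thesis using t(1) by (simp add: mult_less_0_iff)
  qed
  define K' where "K' = {x \<in> closure D. r x \<le> - d}"
  have "K' = closure D \<inter> {x. r x \<le> - d}" by (auto simp: K'_def)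
  then have "compact K'" using compact_closure_D closed_Collect_le[OF cr continuous_on_const]
    by (simp add: compact_Int_closed)
  moreover have "K' \<subseteq> D" using d by (auto simp: K'_def D_eq)
  moreover have "continuous_on K' u" using u(2) by (rule continuous_on_subset) (auto simp: K'_def)
  ultimately obtain m where m: "0 < m" "\<And>x. x \<in> K' \<Longrightarrow> u x \<le> - m"
    using negative_compact_bound[of K' u] neg by (metis subsetD)
  \<comment> \<open>Makes the barrier equal to \<open>- m\<close> where
    \<open>r x = - d\<close>.\<close>
  define a where "a = m / (exp (t * d) - 1)"
  have ex: "0 < exp (t * d) - 1" using t d by simp
  then have a: "0 < a" "a * (exp (t * d) - 1) = m" using m by (auto simp: a_def)
  have "u x + (- a) * w x \<le> 0" if x: "x \<in> K" for x
  proof (rule max_principle[OF K _ _ x])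
    show "continuous_on K (\<lambda>x. u x + - a * w x)"
      using C2D(3)[OF C2w] by (intro continuous_intros continuous_on_subset[OF u(2)]) (auto simp: K_def intro: continuous_on_subset)
    fix y assume y: "y \<in> K"
    show "u y + - a * w y \<le> 0 \<or> (\<exists>S Ga Ha. open S \<and> y \<in> S \<and> S \<subseteq> K \<and> C2 S (\<lambda>x. u x + - a * w x) Ga Ha \<and> 0 < msym (Suc 0) (Ha y))"
    proof (cases "y \<in> D")
      case False
      then have "y \<in> frontier D" using y closure_D by (auto simp: K_def)
      then show ?thesis using u0 frontier_D by (simp add: w_def)
    next
      case yD: True
      show ?thesis
      proof (cases "r y = - d")
        case True
        then have "u y \<le> - m" using y by (intro m) (auto simp: K_def K'_def)
        moreover have "- a * w y = m" unfolding w_def True using a(2) by (simp add: algebra_simps)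
        ultimately show ?thesis by simp
      next
        case False
        define S where "S = {x. - d < r x} \<inter> D"
        have "open S" unfolding S_def by (intro open_Int open_D open_Collect_less continuous_on_const cr)
        moreover have "y \<in> S" using y yD False by (auto simp: S_def K_def)
        moreover have "S \<subseteq> K" using closure_subset by (auto simp: S_def K_def)
        moreover have "C2 S (\<lambda>x. u x + - a * w x) (\<lambda>x. Gu x + - a *\<^sub>R ((t * exp (- (t * r x))) *\<^sub>R G x)) (\<lambda>x. Hu x + - a *\<^sub>R Hw x)"
          by (intro C2_add C2_scale C2_subset[OF C2w subset_UNIV] C2_subset[OF u(1)]) (auto simp: S_def)
        moreover have "0 < msym (Suc 0) (Hu y + - a *\<^sub>R Hw y)"
          unfolding msym_1_add msym_1_scale using tr[OF yD] trw[OF y] a(1) by (intro add_nonneg_pos) (auto simp: mult_pos_neg)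
        ultimately show ?thesis by blast
      qed
    qed
  qed
  then show ?thesis using that[of a t d] a(1) t(1) d by (simp add: K_def w_def)
qed

text \<open>The barrier has outward slope \<open>a * t * norm (G p)\<close> at \<open>p\<close>,
  twice the constant \<open>c\<close>, and \<open>u\<close> lies below it. As \<open>Gu p\<close> is
  only a continuous extension, the mean value theorem along the inward normal is used: it yields
  points near \<open>p\<close> where the normal derivative exceeds \<open>c\<close>, so the limit
  cannot be nonpositive.\<close>

lemma hopf:
  assumes u: "adm k D u Gu Hu" and k: "1 \<le> k" and y: "y \<in> D" "u y \<noteq> 0" and p: "p \<in> frontier D"
  shows "0 < Gu p \<bullet> nu p"
proof -
  note U = admD[OF u]
  have tr: "0 \<le> msym (Suc 0) (Hu x)" if "x \<in> D" for x using adm_msym_nonneg[OF u _ that] k by simp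
  have neg: "u x < 0" if "x \<in> D" for x
    using strong_max_principle[OF open_D connected_D U(1) U(6) tr y(1) _ that] U(6)[OF y(1)] y(2) by auto
  obtain a t d where atd: "0 < a" "0 < t" "0 < d"
    and bar: "\<And>x. x \<in> closure D \<Longrightarrow> - d \<le> r x \<Longrightarrow> u x \<le> a * (1 - exp (- (t * r x)))"
    using collar_barrier[OF U(1,2,5) neg tr] by metis
  note np = nu[OF p]
  have rp: "r p = 0" using frontier_D[OF p] by simp
  have GN: "G p \<bullet> nu p = norm (G p)" by (subst np(2)) (simp add: np(1) norm_eq_1[symmetric])
  define c where "c = a * t * norm (G p) / 2"
  have c: "0 < c" using atd np(3) by (simp add: c_def)
  have line: "((\<lambda>s. p + s *\<^sub>R (- nu p)) has_vector_derivative - nu p) (at s)" for s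
    by (auto intro!: derivative_eq_intros)
  have dr: "((\<lambda>s. r (p + s *\<^sub>R (- nu p))) has_real_derivative - norm (G p)) (at 0)"
    using line_has_real_derivative[OF C2D(1)[OF C2r UNIV_I] line, of 0] GN by simp
  have "((\<lambda>s. a * (1 - exp (- (t * r (p + s *\<^sub>R (- nu p))))) + c * s) has_real_derivative - c) (at 0)"
    by (rule derivative_eq_intros dr refl | simp add: rp c_def)+
  from DERIV_neg_dec_right[OF this] c obtain d1 where
    d1: "0 < d1" "\<And>s. 0 < s \<Longrightarrow> s < d1 \<Longrightarrow> a * (1 - exp (- (t * r (p + s *\<^sub>R (- nu p))))) + c * s < 0" by (auto simp: rp)
  from DERIV_neg_dec_right[OF dr] np(3) obtain d2 where
    d2: "0 < d2" "\<And>s. 0 < s \<Longrightarrow> s < d2 \<Longrightarrow> r (p + s *\<^sub>R (- nu p)) < 0" by (auto simp: rp)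
  have "isCont (\<lambda>s. r (p + s *\<^sub>R (- nu p))) 0" using dr by (rule DERIV_isCont)
  then obtain d3 where d3: "0 < d3" "\<And>s. \<bar>s\<bar> < d3 \<Longrightarrow> \<bar>r (p + s *\<^sub>R (- nu p))\<bar> < d"
    using atd(3) unfolding continuous_at_eps_delta by (force simp: dist_real_def rp)
  show ?thesis
  proof (rule ccontr)
    assume "\<not> 0 < Gu p \<bullet> nu p"
    have pc: "p \<in> closure D" using p by (simp add: frontier_def)
    have "continuous_on (closure D) (\<lambda>x. Gu x \<bullet> nu p)" by (intro continuous_intros U)
    then obtain d4 where d4: "0 < d4" "\<And>x. x \<in> closure D \<Longrightarrow> dist x p < d4 \<Longrightarrow> dist (Gu x \<bullet> nu p) (Gu p \<bullet> nu p) < c"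
      using pc c unfolding continuous_on_iff by metis
    define s where "s = min (min d1 d2) (min d3 d4) / 2"
    have s: "0 < s" "s < d1" "s < d2" "s < d3" "s < d4"
      using d1(1) d2(1) d3(1) d4(1) unfolding s_def by auto
    have inD: "p + q *\<^sub>R (- nu p) \<in> D" if "0 < q" "q \<le> s" for q using d2(2)[of q] that s by (simp add: D_eq)
    have inC: "p + q *\<^sub>R (- nu p) \<in> closure D" if "0 \<le> q" "q \<le> s" for q
      using inD[of q] that pc closure_subset by (cases "q = 0") auto
    have us: "u (p + s *\<^sub>R (- nu p)) < - c * s"
      using bar[OF inC[of s]] d3(2)[of s] d1(2)[of s] s(1,2,4) by (simp add: abs_less_iff)
    have "continuous_on {0..s} (\<lambda>q. u (p + q *\<^sub>R (- nu p)))"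
      using inC by (intro continuous_on_compose2[OF U(2)] continuous_intros) auto
    moreover have "((\<lambda>q. u (p + q *\<^sub>R (- nu p))) has_real_derivative Gu (p + q *\<^sub>R (- nu p)) \<bullet> - nu p) (at q)" if "0 < q" "q < s" for q
      using inD[of q] that by (intro line_has_real_derivative[OF C2D(1)[OF U(1)] line]) auto
    ultimately obtain q where q: "0 < q" "q < s"
      "u (p + s *\<^sub>R (- nu p)) - u (p + 0 *\<^sub>R (- nu p)) = (Gu (p + q *\<^sub>R (- nu p)) \<bullet> - nu p) * (s - 0)"
      using mvt[OF s(1), of "\<lambda>q. u (p + q *\<^sub>R (- nu p))" "\<lambda>q h. (Gu (p + q *\<^sub>R (- nu p)) \<bullet> - nu p) * h"]
      unfolding has_field_derivative_def by metis
    then have "s * (Gu (p + q *\<^sub>R (- nu p)) \<bullet> - nu p) < - c * s" using us U(5)[OF p] by (simp add: mult.commute)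
    then have "s * (c - Gu (p + q *\<^sub>R (- nu p)) \<bullet> nu p) < 0" by (simp add: algebra_simps)
    then have "c < Gu (p + q *\<^sub>R (- nu p)) \<bullet> nu p" using s(1) by (simp add: mult_less_0_iff)
    moreover have "dist (Gu (p + q *\<^sub>R (- nu p)) \<bullet> nu p) (Gu p \<bullet> nu p) < c"
      using q s np(1) by (intro d4 inC) (auto simp: dist_norm)
    ultimately show False using \<open>\<not> 0 < Gu p \<bullet> nu p\<close> by (simp add: dist_real_def)
  qed
qed

end

section \<open>Second-order comparison at the boundary and the barrier\<close>

text \<open>One-sided at \<open>0\<close>: along a curve that starts on the boundary,
  \<open>u\<close> is differentiable only after the start, and its derivatives extend
  continuously.\<close>

lemma positive_second_derivative_right:
  fixes f f1 f2 :: "real \<Rightarrow> real"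
  assumes e: "0 < e" and c: "continuous_on {0..e} f" "continuous_on {0..e} f1" "continuous_on {0..e} f2"
    and d: "\<And>s. 0 < s \<Longrightarrow> s < e \<Longrightarrow> (f has_real_derivative f1 s) (at s)"
      "\<And>s. 0 < s \<Longrightarrow> s < e \<Longrightarrow> (f1 has_real_derivative f2 s) (at s)"
    and z: "f 0 = 0" "0 \<le> f1 0" "0 < f2 0"
  shows "\<exists>d>0. \<forall>s. 0 < s \<and> s < d \<longrightarrow> 0 < f s"
proof -
  have "0 \<in> {0..e}" using e by simp
  then obtain d' where d': "0 < d'" "\<And>s. s \<in> {0..e} \<Longrightarrow> dist s 0 < d' \<Longrightarrow> dist (f2 s) (f2 0) < f2 0"
    using c(3) z(3) unfolding continuous_on_iff by metis
  have pos2: "0 < f2 s" if "0 < s" "s < min d' e" for s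
    using d'(2)[of s] that by (auto simp: dist_real_def abs_less_iff)
  have pos1: "0 < f1 s" if s: "0 < s" "s < min d' e" for s
  proof -
    have "continuous_on {0..s} f1" using c(2) s by (auto intro: continuous_on_subset)
    then obtain q where "0 < q" "q < s" "f1 s - f1 0 = f2 q * (s - 0)"
      using mvt[OF s(1), of f1 "\<lambda>q h. f2 q * h"] d(2) s unfolding has_field_derivative_def by (metis less_trans min_less_iff_conj)
    then have "0 < f2 q * s" "f1 s = f1 0 + f2 q * s" using pos2[of q] s by (auto intro: mult_pos_pos)
    then show ?thesis using z(2) by linarith
  qed
  have "0 < f s" if s: "0 < s" "s < min d' e" for s
  proof -
    have "continuous_on {0..s} f" using c(1) s by (auto intro: continuous_on_subset)
    then obtain q where "0 < q" "q < s" "f s - f 0 = f1 q * (s - 0)"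
      using mvt[OF s(1), of f "\<lambda>q h. f1 q * h"] d(1) s unfolding has_field_derivative_def by (metis less_trans min_less_iff_conj)
    then show ?thesis using pos1[of q] s z(1) by (auto intro: mult_pos_pos)
  qed
  then show ?thesis using d'(1) e by (intro exI[of _ "min d' e"]) auto
qed

lemma continuous_on_matrix_vector_mult:
  fixes A :: "'b::topological_space \<Rightarrow> real ^ 'n ^ 'm"
  assumes "continuous_on S A" "continuous_on S v"
  shows "continuous_on S (\<lambda>x. A x *v v x)"
  unfolding matrix_vector_mult_def by (intro continuous_intros assms)

lemma closed_closed_cone: "closed (closed_cone k)"
proof -
  have "closed_cone k = {A. transpose A = A} \<inter> (\<Inter>j\<in>{1..k}. {A :: real ^ 'n ^ 'n. 0 \<le> msym j A})"
    by (auto simp: closed_cone_def)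
  also have "closed \<dots>"
    by (intro closed_Int closed_INT ballI closed_Collect_eq closed_Collect_le continuous_on_msym continuous_on_const continuous_on_id)
      (auto simp: transpose_def intro!: continuous_intros)
  finally show ?thesis .
qed

lemma matrix_vector_mult_minus: "A *v (- v) = - (A *v (v :: real ^ 'n))"
  using matrix_vector_mult_diff_distrib[of A 0 v] by simp

lemma open_cone_add_closed:
  fixes A B :: "real ^ 'n ^ 'n"
  assumes "A \<in> open_cone k" "B \<in> closed_cone k" "k \<le> CARD('n)"
  shows "A + B \<in> open_cone k"
proof -
  have "0 < msym j (A + B)" if "j \<in> {1..k}" for j
  proof -
    have "A \<in> closed_cone j" "B \<in> closed_cone j" "j \<le> CARD('n)"
      using assms that closed_cone_mono[of j k] open_cone_subset_closed[of k] by fastforce+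
    then have "msym j A \<le> msym j (A + B)" by (intro closed_cone_msym_add)
    then show ?thesis using assms(1) that by (force simp: open_cone_def)
  qed
  then show ?thesis using assms by (auto simp: open_cone_def closed_cone_def transpose_add)
qed

lemma mat_1_closed_cone: "mat 1 \<in> closed_cone k"
  by (rule psd_closed_cone) (auto simp: transpose_mat)

context defined_domain
begin

text \<open>A parabola with initial velocity \<open>v\<close> bends inwards with acceleration
  \<open>b\<close>. Since \<open>b\<close> exceeds the curvature of the boundary in the direction
  \<open>v\<close>, it enters \<open>D\<close>; the second bound on \<open>b\<close> makes
  \<open>u\<close> positive along it, contrary to \<open>u \<le> 0\<close>.\<close>

lemma tangential_hessian_bound_aux:
  assumes u: "adm k D u Gu Hu" and p: "p \<in> frontier D" and v: "v \<bullet> nu p = 0" "0 \<le> Gu p \<bullet> v"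
    and b: "(shape p *v v) \<bullet> v < b" "b * (Gu p \<bullet> nu p) < (Hu p *v v) \<bullet> v"
  shows False
proof -
  note U = admD[OF u]
  note np = nu[OF p]
  define c where "c s = p + (s *\<^sub>R v + (- b * s\<^sup>2 / 2) *\<^sub>R nu p)" for s
  define c1 where "c1 s = v + (- b * s) *\<^sub>R nu p" for s
  define c2 where "c2 = - b *\<^sub>R nu p"
  have dc: "(c has_vector_derivative c1 s) (at s)" for s
    unfolding c_def[abs_def] c1_def by (auto intro!: derivative_eq_intros)
  have dc1: "(c1 has_vector_derivative c2) (at s)" for s
    unfolding c1_def[abs_def] c2_def by (auto intro!: derivative_eq_intros)
  have cc: "continuous_on S c" "continuous_on S c1" for S
    unfolding c_def[abs_def] c1_def[abs_def] by (auto intro!: continuous_intros)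
  have Gv: "G p \<bullet> v = 0" by (subst np(2)) (simp add: v inner_commute)
  have GN: "G p \<bullet> nu p = norm (G p)" by (subst np(2)) (simp add: np(1) norm_eq_1[symmetric])
  have Hv: "(H p *v v) \<bullet> v = norm (G p) * ((shape p *v v) \<bullet> v)"
    using np(3) by (simp add: shape_def scaleR_matrix_vector_assoc[symmetric])
  have r: "(r has_derivative (\<lambda>h. G x \<bullet> h)) (at x)" "(G has_derivative (\<lambda>h. H x *v h)) (at x)" for x
    using C2D[OF C2r] by auto
  have cr: "continuous_on S r" "continuous_on S G" "continuous_on S H" for S
    using C2D[OF C2_subset[OF C2r subset_UNIV]] by auto
  have "\<exists>d>0. \<forall>s. 0 < s \<and> s < d \<longrightarrow> 0 < - r (c s)"
  proof (rule positive_second_derivative_right[where e = 1])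
    show "((\<lambda>s. - r (c s)) has_real_derivative - (G (c s) \<bullet> c1 s)) (at s)" for s
      by (intro DERIV_minus line_has_real_derivative[OF r(1) dc])
    show "((\<lambda>s. - (G (c s) \<bullet> c1 s)) has_real_derivative - ((H (c s) *v c1 s) \<bullet> c1 s + G (c s) \<bullet> c2)) (at s)" for s
      by (intro DERIV_minus line_gradient_has_real_derivative[OF r(2) dc dc1])
    show "- r (c 0) = 0" using frontier_D[OF p] by (simp add: c_def)
    show "0 \<le> - (G (c 0) \<bullet> c1 0)" by (simp add: c_def c1_def Gv)
    have "norm (G p) * ((shape p *v v) \<bullet> v) < norm (G p) * b" using b(1) np(3) by simp
    then show "0 < - ((H (c 0) *v c1 0) \<bullet> c1 0 + G (c 0) \<bullet> c2)"
      by (simp add: c_def c1_def c2_def Hv GN mult.commute)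
  qed (intro continuous_intros continuous_on_matrix_vector_mult continuous_on_compose2[OF cr(1)[of UNIV]]
      continuous_on_compose2[OF cr(2)[of UNIV]] continuous_on_compose2[OF cr(3)[of UNIV]] cc subset_UNIV | simp)+
  then obtain d where d: "0 < d" "\<And>s. 0 < s \<Longrightarrow> s < d \<Longrightarrow> c s \<in> D" by (auto simp: D_eq)
  have inC: "c s \<in> closure D" if "0 \<le> s" "s < d" for s
    using d(2)[of s] that p closure_subset by (cases "s = 0") (auto simp: c_def frontier_def)
  then have sub: "c ` {0..d / 2} \<subseteq> closure D" using d(1) by auto
  have "\<exists>d>0. \<forall>s. 0 < s \<and> s < d \<longrightarrow> 0 < u (c s)"
  proof (rule positive_second_derivative_right[where e = "d / 2"])
    show "((\<lambda>s. u (c s)) has_real_derivative Gu (c s) \<bullet> c1 s) (at s)" if "0 < s" "s < d / 2" for s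
      using that by (intro line_has_real_derivative[OF _ dc] C2D[OF U(1)] d) auto
    show "((\<lambda>s. Gu (c s) \<bullet> c1 s) has_real_derivative (Hu (c s) *v c1 s) \<bullet> c1 s + Gu (c s) \<bullet> c2) (at s)" if "0 < s" "s < d / 2" for s
      using that by (intro line_gradient_has_real_derivative[OF _ dc dc1] C2D(2)[OF U(1)] d) auto
    show "u (c 0) = 0" using U(5)[OF p] by (simp add: c_def)
    show "0 \<le> Gu (c 0) \<bullet> c1 0" using v(2) by (simp add: c_def c1_def)
    show "0 < (Hu (c 0) *v c1 0) \<bullet> c1 0 + Gu (c 0) \<bullet> c2"
      using b(2) by (simp add: c_def c1_def c2_def)
    show "0 < d / 2" using d(1) by simp
  qed (intro continuous_intros continuous_on_matrix_vector_mult continuous_on_compose2[OF U(2)]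
      continuous_on_compose2[OF U(3)] continuous_on_compose2[OF U(4)] cc sub)+
  then obtain d' where d': "0 < d'" "\<And>s. 0 < s \<Longrightarrow> s < d' \<Longrightarrow> 0 < u (c s)" by blast
  define s where "s = min d d' / 2"
  have s: "0 < s" "s < d" "s < d'" using d(1) d'(1) by (auto simp: s_def)
  show False using d'(2)[OF s(1,3)] U(6)[OF d(2)[OF s(1,2)]] by simp
qed

text \<open>If the bound failed, some \<open>b\<close> would fit the previous lemma. The sign
  condition on the tangential derivative holds for \<open>v\<close> or for \<open>- v\<close>, and
  the quadratic forms do not distinguish them.\<close>

lemma tangential_hessian_bound:
  assumes u: "adm k D u Gu Hu" and p: "p \<in> frontier D" and v: "v \<bullet> nu p = 0" and pos: "0 < Gu p \<bullet> nu p"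
  shows "(Hu p *v v) \<bullet> v \<le> (Gu p \<bullet> nu p) * ((shape p *v v) \<bullet> v)"
proof (rule ccontr)
  assume "\<not> ?thesis"
  then have "(shape p *v v) \<bullet> v < ((Hu p *v v) \<bullet> v) / (Gu p \<bullet> nu p)" using pos by (simp add: field_simps)
  then obtain b where b: "(shape p *v v) \<bullet> v < b" "b < ((Hu p *v v) \<bullet> v) / (Gu p \<bullet> nu p)" using dense by blast
  then have b': "b * (Gu p \<bullet> nu p) < (Hu p *v v) \<bullet> v" using pos by (simp add: pos_less_divide_eq)
  show False
  proof (cases "0 \<le> Gu p \<bullet> v")
    case True
    then show ?thesis using tangential_hessian_bound_aux[OF u p v _ b(1) b'] by simp
  next
    case False
    then show ?thesis using tangential_hessian_bound_aux[OF u p, of "- v" b] v b(1) b'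
      by (simp add: matrix_vector_mult_minus)
  qed
qed

lemma shape_in_cone:
  assumes u: "adm k D u Gu Hu" and k: "1 \<le> k" "k \<le> CARD('n)" and y: "y \<in> D" "u y \<noteq> 0" and p: "p \<in> frontier D"
    and pos: "0 < msym (k - 1) (compress (nu p) (shape p))"
  shows "compress (nu p) (shape p) \<in> open_cone (k - 1)"
proof -
  note U = admD[OF u]
  define a where "a = Gu p \<bullet> nu p"
  have a: "0 < a" unfolding a_def by (rule hopf[OF u k(1) y p])
  have "Hu ` closure D \<subseteq> closed_cone k"
    using U(7) by (intro image_closure_subset[OF U(4) closed_closed_cone]) auto
  then have Hp: "Hu p \<in> closed_cone k" using p by (auto simp: frontier_def)
  \<comment> \<open>On the tangent space this difference is positive semidefinite, so the
    compression of \<open>a *\<^sub>R shape p\<close> is a sum of two cone elements.\<close>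
  have "compress (nu p) (a *\<^sub>R shape p - Hu p) \<in> closed_cone (k - 1)"
  proof (rule compress_psd)
    show "transpose (a *\<^sub>R shape p - Hu p) = a *\<^sub>R shape p - Hu p"
      using Hp sym_shape by (simp add: closed_cone_def transpose_diff transpose_scalar)
    show "norm (nu p) = 1" by (rule nu(1)[OF p])
    show "0 \<le> ((a *\<^sub>R shape p - Hu p) *v v) \<bullet> v" if "v \<bullet> nu p = 0" for v
      using tangential_hessian_bound[OF u p that] a unfolding a_def
      by (simp add: matrix_vector_mult_diff_rdistrib inner_diff_left scaleR_matrix_vector_assoc[symmetric])
  qed
  with compress_closed_cone[OF Hp nu(1)[OF p] k]
  have "compress (nu p) (Hu p) + compress (nu p) (a *\<^sub>R shape p - Hu p) \<in> closed_cone (k - 1)"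
    using k by (intro closed_cone_add) auto
  then have "a *\<^sub>R compress (nu p) (shape p) \<in> closed_cone (k - 1)"
    by (simp add: compress_add[symmetric] compress_scale[symmetric])
  from closed_cone_scale[OF this, of "inverse a"] a
  have "compress (nu p) (shape p) \<in> closed_cone (k - 1)" by simp
  then show ?thesis by (rule closed_cone_open[OF _ pos]) (use k in simp)
qed

text \<open>By the rank-one formula each \<open>msym j\<close> is affine in the coefficient of the
  normal projection, with positive slope \<open>msym (j - 1)\<close> of the compressed shape matrix;
  \<open>T j\<close> is the threshold beyond which the slope term wins.\<close>

lemma eventually_convex_at:
  assumes k: "1 \<le> k" and p: "p \<in> frontier D" and sh: "compress (nu p) (shape p) \<in> open_cone (k - 1)"
  shows "\<exists>n::nat. H p + real n *\<^sub>R outer (G p) (G p) \<in> open_cone k"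
proof -
  note np = nu[OF p]
  define g where "g = norm (G p)"
  have g: "0 < g" using np by (simp add: g_def)
  define T where "T j = \<bar>msym j (shape p)\<bar> / (g * msym (j - 1) (compress (nu p) (shape p)))" for j
  obtain n :: nat where n: "sum T {1..k} < real n" using reals_Archimedean2 by blast
  have Hs: "H p + real n *\<^sub>R outer (G p) (G p) = g *\<^sub>R (shape p + (real n * g) *\<^sub>R outer (nu p) (nu p))"
  proof -
    have "outer (G p) (G p) = (g * g) *\<^sub>R outer (nu p) (nu p)"
      by (subst (1 2) np(2)) (simp add: outer_def vec_eq_iff g_def)
    moreover have "H p = g *\<^sub>R shape p" using g by (simp add: shape_def g_def)
    ultimately show ?thesis by (simp add: scaleR_add_right mult_ac)
  qed
  have m: "0 < msym (j - 1) (compress (nu p) (shape p))" if "j \<in> {1..k}" for j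
    using sh that by (cases "j - 1 \<in> {1..k - 1}") (auto simp: open_cone_def msym_0)
  have "0 < msym j (H p + real n *\<^sub>R outer (G p) (G p))" if j: "j \<in> {1..k}" for j
  proof -
    have "0 \<le> T i" if "i \<in> {1..k}" for i using m[OF that] g by (simp add: T_def)
    then have "T j \<le> sum T {1..k}" using j by (intro member_le_sum) auto
    then have "T j < real n" using n by simp
    then have "\<bar>msym j (shape p)\<bar> < real n * g * msym (j - 1) (compress (nu p) (shape p))"
      using m[OF j] g by (simp add: T_def pos_divide_less_eq mult.assoc)
    moreover have "msym (Suc (j - 1)) (shape p + (real n * g) *\<^sub>R outer (nu p) (nu p))
      = msym (Suc (j - 1)) (shape p) + real n * g * msym (j - 1) (compress (nu p) (shape p))"
      by (rule msym_add_rank_one[OF np(1)])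
    ultimately have "0 < msym j (shape p + (real n * g) *\<^sub>R outer (nu p) (nu p))" using j by simp
    then show ?thesis unfolding Hs msym_scaleR using g by simp
  qed
  then show ?thesis by (intro exI[of _ n]) (simp add: open_cone_def transpose_add transpose_scalar symH transpose_outer)
qed

text \<open>Open conditions indexed by natural numbers cover the compact boundary. Enlarging the
  coefficient is harmless, since nonnegative multiples of \<open>outer (G p) (G p)\<close> lie in
  the closed cone, so one \<open>t\<close> serves all points.\<close>

lemma convex_defining_function:
  assumes k: "1 \<le> k" "k \<le> CARD('n)" and sh: "\<And>p. p \<in> frontier D \<Longrightarrow> compress (nu p) (shape p) \<in> open_cone (k - 1)"
  obtains t where "0 < t" "\<And>p. p \<in> frontier D \<Longrightarrow> H p + t *\<^sub>R outer (G p) (G p) \<in> open_cone k"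
proof -
  define Q where "Q n = {p. \<forall>j\<in>{1..k}. 0 < msym j (H p + real n *\<^sub>R outer (G p) (G p))}" for n
  have cr: "continuous_on S G" "continuous_on S H" for S
    using C2D[OF C2_subset[OF C2r subset_UNIV]] by auto
  have Q: "p \<in> Q n \<longleftrightarrow> H p + real n *\<^sub>R outer (G p) (G p) \<in> open_cone k" for p n
    by (auto simp: Q_def open_cone_def transpose_add transpose_scalar symH transpose_outer)
  have "Q n = (\<Inter>j\<in>{1..k}. {p. 0 < msym j (H p + real n *\<^sub>R outer (G p) (G p))})" for n by (auto simp: Q_def)
  then have "open (Q n)" for n
    by (auto intro!: open_INT open_Collect_less continuous_on_msym continuous_intros continuous_on_outer cr)
  moreover have "frontier D \<subseteq> (\<Union>n\<in>UNIV. Q n)" using eventually_convex_at[OF k(1) _ sh] Q by blast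
  ultimately obtain N where N: "finite N" "frontier D \<subseteq> (\<Union>n\<in>N. Q n)"
    using compactE_image[OF compact_frontier_D, of UNIV Q] by (metis (no_types))
  define t where "t = real (Suc (\<Sum>N))"
  have "H p + t *\<^sub>R outer (G p) (G p) \<in> open_cone k" if p: "p \<in> frontier D" for p
  proof -
    obtain n where n: "n \<in> N" "p \<in> Q n" using N p by blast
    have "n \<le> \<Sum>N" using N(1) n(1) by (simp add: member_le_sum[of n N "\<lambda>x. x"])
    then have "0 \<le> t - real n" by (simp add: t_def del: of_nat_sum)
    then have "(H p + real n *\<^sub>R outer (G p) (G p)) + (t - real n) *\<^sub>R outer (G p) (G p) \<in> open_cone k"
      by (rule open_cone_add_closed[OF n(2)[unfolded Q] closed_cone_scale[OF outer_closed_cone] k(2)])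
    moreover have "(H p + real n *\<^sub>R outer (G p) (G p)) + (t - real n) *\<^sub>R outer (G p) (G p) = H p + t *\<^sub>R outer (G p) (G p)"
      by (simp add: algebra_simps)
    ultimately show ?thesis by simp
  qed
  moreover have "0 < t" by (simp add: t_def del: of_nat_sum)
  ultimately show ?thesis using that by blast
qed

text \<open>The Hessian of \<open>g\<close> is in the open cone near the boundary, that of the
  quadratic function \<open>h\<close> everywhere. The smooth maximum
  \<open>h + spline d (g - h)\<close> equals \<open>g\<close> where \<open>g - h \<ge> d\<close> and
  \<open>h\<close> where \<open>g - h \<le> - d\<close>; its Hessian is a convex combination of the
  two plus a nonnegative rank-one term.\<close>

lemma exists_barrier:
  assumes k: "1 \<le> k" "k \<le> CARD('n)" and sh: "\<And>p. p \<in> frontier D \<Longrightarrow> compress (nu p) (shape p) \<in> open_cone (k - 1)"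
  obtains rho Gr Hr c where "adm k D rho Gr Hr" "0 < c" "\<And>x. x \<in> D \<Longrightarrow> Hr x - c *\<^sub>R mat 1 \<in> closed_cone k"
proof -
  obtain t where t: "0 < t" "\<And>p. p \<in> frontier D \<Longrightarrow> H p + t *\<^sub>R outer (G p) (G p) \<in> open_cone k"
    using convex_defining_function[OF k sh] by metis
  define g where "g x = (exp (t * r x) - 1) / t" for x
  define Gg where "Gg x = exp (t * r x) *\<^sub>R G x" for x
  define Hg where "Hg x = exp (t * r x) *\<^sub>R H x + (t * exp (t * r x)) *\<^sub>R outer (G x) (G x)" for x
  have C2g: "C2 UNIV g Gg Hg" unfolding g_def[abs_def] Gg_def[abs_def] Hg_def[abs_def]
  proof (rule C2_compose[OF C2r, where q = "\<lambda>s. (exp (t * s) - 1) / t" and ?q1.0 = "\<lambda>s. exp (t * s)" and ?q2.0 = "\<lambda>s. t * exp (t * s)"])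
    show "((\<lambda>s. (exp (t * s) - 1) / t) has_real_derivative exp (t * s)) (at s)" for s
      using t(1) by (auto intro!: derivative_eq_intros)
    show "((\<lambda>s. exp (t * s)) has_real_derivative t * exp (t * s)) (at s)" for s
      by (auto intro!: derivative_eq_intros)
  qed (intro continuous_intros)
  have symHg: "transpose (Hg x) = Hg x" for x
    by (simp add: Hg_def transpose_add transpose_scalar symH transpose_outer)
  have cg: "continuous_on S g" "continuous_on S Hg" for S
    using C2D[OF C2_subset[OF C2g subset_UNIV]] by auto
  \<comment> \<open>The extra real coordinate lets one compactness argument provide both the
    neighbourhood of the boundary and the margin \<open>c0\<close>.\<close>
  define W where "W = {z :: (real ^ 'n) \<times> real. \<forall>j\<in>{1..k}. 0 < msym j (Hg (fst z) - snd z *\<^sub>R mat 1)}"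
  have "W = (\<Inter>j\<in>{1..k}. {z. 0 < msym j (Hg (fst z) - snd z *\<^sub>R mat 1)})" by (auto simp: W_def)
  then have "open W"
    by (auto intro!: open_INT open_Collect_less continuous_on_msym continuous_intros continuous_on_compose2[OF cg(2)[of UNIV]])
  moreover have "frontier D \<times> {0} \<subseteq> W"
  proof -
    have "Hg p \<in> open_cone k" if "p \<in> frontier D" for p using t(2)[OF that] frontier_D[OF that] by (simp add: Hg_def)
    then show ?thesis by (auto simp: W_def open_cone_def)
  qed
  moreover have "compact (frontier D \<times> {0 :: real})" using compact_frontier_D by (intro compact_Times) auto
  ultimately obtain e0 where e0: "0 < e0" "(\<Union>z\<in>frontier D \<times> {0}. ball z e0) \<subseteq> W"
    using compact_subset_open_imp_ball_epsilon_subset by metis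
  define c0 where "c0 = e0 / 2"
  have c0: "0 < c0" using e0 by (simp add: c0_def)
  define V where "V = (\<Union>p\<in>frontier D. ball p c0)"
  have V: "Hg x - c0 *\<^sub>R mat 1 \<in> closed_cone k" if x: "x \<in> V" for x
  proof -
    obtain p where p: "p \<in> frontier D" "dist p x < c0" using x by (auto simp: V_def)
    have "dist (p, 0) (x, c0) \<le> dist p x + dist 0 c0"
      unfolding dist_Pair_Pair by (intro sqrt_sum_squares_le_sum) auto
    then have "(x, c0) \<in> ball (p, 0) e0" using p(2) c0 by (simp add: dist_real_def c0_def)
    then have "(x, c0) \<in> W" using e0(2) p(1) by blast
    then show ?thesis
      by (auto simp: W_def closed_cone_def transpose_diff transpose_scaleR_mat symHg intro: less_imp_le)
  qed
  define K where "K = closure D - V"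
  have "open V" by (auto simp: V_def)
  then have cK: "compact K" unfolding K_def by (intro compact_diff compact_closure_D)
  have frV: "frontier D \<subseteq> V" using c0 by (auto simp: V_def)
  then have "g x < 0" if "x \<in> K" for x
    using that closure_D[of x] t(1) by (auto simp: K_def D_eq g_def divide_less_0_iff mult_less_0_iff)
  then obtain m where m: "0 < m" "\<And>x. x \<in> K \<Longrightarrow> g x \<le> - m" using negative_compact_bound[OF cK cg(1)] by metis
  \<comment> \<open>On \<open>K\<close>, away from the boundary, \<open>g \<le> - 3 * d\<close>,
    while \<open>h\<close> takes values between \<open>- 2 * d\<close> and \<open>- d\<close> on the
    closure. Hence \<open>g - h\<close> is at most \<open>- d\<close> on \<open>K\<close> and at
    least \<open>d\<close> on the boundary.\<close>
  define d where "d = m / 3"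
  have d: "0 < d" using m by (simp add: d_def)
  have "bounded ((\<lambda>x. x \<bullet> x) ` closure D)"
    by (intro compact_imp_bounded compact_continuous_image compact_closure_D continuous_intros)
  then obtain R where R: "\<And>x. x \<in> closure D \<Longrightarrow> \<bar>x \<bullet> x\<bar> \<le> R" by (auto simp: bounded_iff)
  define e where "e = d / (\<bar>R\<bar> + 1)"
  have e: "0 < e" using d by (simp add: e_def add_nonneg_pos)
  have eR: "e * (x \<bullet> x) \<le> d" if "x \<in> closure D" for x
  proof -
    have "e * (x \<bullet> x) \<le> e * (\<bar>R\<bar> + 1)" using R[OF that] e by (intro mult_left_mono) auto
    then show ?thesis by (simp add: e_def)
  qed
  define h where "h x = e * ((x - 0) \<bullet> (x - 0)) + - 2 * d" for x :: "real ^ 'n"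
  define Gh where "Gh x = e *\<^sub>R (2 *\<^sub>R (x - 0)) + 0" for x :: "real ^ 'n"
  define Hh where "Hh x = e *\<^sub>R (2 *\<^sub>R mat 1 :: real ^ 'n ^ 'n) + 0" for x :: "real ^ 'n"
  have C2h: "C2 UNIV h Gh Hh" unfolding h_def[abs_def] Gh_def[abs_def] Hh_def[abs_def]
    by (intro C2_add C2_scale C2_sq_dist C2_const)
  define w where "w x = g x + -1 * h x" for x
  define Gw where "Gw x = Gg x + -1 *\<^sub>R Gh x" for x
  define Hw where "Hw x = Hg x + -1 *\<^sub>R Hh x" for x
  have C2w: "C2 UNIV w Gw Hw" unfolding w_def[abs_def] Gw_def[abs_def] Hw_def[abs_def]
    by (intro C2_add C2_scale C2g C2h)
  define rho where "rho x = h x + spline d (w x)" for x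
  define Gr where "Gr x = Gh x + spline1 d (w x) *\<^sub>R Gw x" for x
  define Hr where "Hr x = Hh x + (spline1 d (w x) *\<^sub>R Hw x + spline2 d (w x) *\<^sub>R outer (Gw x) (Gw x))" for x
  have C2rho: "C2 UNIV rho Gr Hr" unfolding rho_def[abs_def] Gr_def[abs_def] Hr_def[abs_def]
    by (intro C2_add C2h C2_compose[OF C2w] has_real_derivative_spline has_real_derivative_spline1 d continuous_spline2)
  have crho: "continuous_on S rho" "continuous_on S Gr" "continuous_on S Hr" for S
    using C2D[OF C2_subset[OF C2rho subset_UNIV]] by auto
  define c where "c = min c0 (2 * e)"
  have c: "0 < c" "c \<le> c0" "c \<le> 2 * e" using c0 e by (auto simp: c_def)
  have strict: "Hr x - c *\<^sub>R mat 1 \<in> closed_cone k" if x: "x \<in> D" for x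
  proof -
    define s where "s = spline1 d (w x)"
    have s: "0 \<le> s" "s \<le> 1" unfolding s_def using spline1_bounds[OF d] by auto
    have part: "s *\<^sub>R (Hg x - c *\<^sub>R mat 1) \<in> closed_cone k"
    proof (cases "x \<in> V")
      case True
      have "(Hg x - c0 *\<^sub>R mat 1) + (c0 - c) *\<^sub>R mat 1 \<in> closed_cone k"
        using c by (intro closed_cone_add V[OF True] closed_cone_scale mat_1_closed_cone k) auto
      then show ?thesis using s by (intro closed_cone_scale) (auto simp: algebra_simps)
    next
      case False
      then have xK: "x \<in> K" using x closure_subset by (auto simp: K_def)
      have "w x \<le> - d" using m(2)[OF xK] mult_nonneg_nonneg[OF less_imp_le[OF e] inner_ge_zero[of x]] by (simp add: w_def h_def d_def)
      then have "s = 0" using spline_low[OF _ d] by (simp add: s_def)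
      then show ?thesis using closed_cone_scale[OF mat_1_closed_cone, of 0] by simp
    qed
    \<comment> \<open>The weights \<open>1 - s\<close> and \<open>s\<close> add up to
      \<open>1\<close>, so the margin \<open>c I\<close> can be subtracted from each Hessian
      separately.\<close>
    have "(1 - s) *\<^sub>R ((2 * e - c) *\<^sub>R mat 1) + (s *\<^sub>R (Hg x - c *\<^sub>R mat 1) + spline2 d (w x) *\<^sub>R outer (Gw x) (Gw x)) \<in> closed_cone k"
      by (rule closed_cone_add[OF closed_cone_scale[OF closed_cone_scale[OF mat_1_closed_cone]]
            closed_cone_add[OF part closed_cone_scale[OF outer_closed_cone] k(2)] k(2)])
        (use s c spline2_nonneg[OF d] in auto)
    moreover have "(1 - s) *\<^sub>R ((2 * e - c) *\<^sub>R mat 1) + (s *\<^sub>R (Hg x - c *\<^sub>R mat 1) + spline2 d (w x) *\<^sub>R outer (Gw x) (Gw x)) = Hr x - c *\<^sub>R mat 1"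
      by (simp add: Hr_def Hh_def Hw_def s_def[symmetric] algebra_simps)
    ultimately show ?thesis by simp
  qed
  have cone: "Hr x \<in> closed_cone k" if "x \<in> D" for x
  proof -
    have "(Hr x - c *\<^sub>R mat 1) + c *\<^sub>R mat 1 \<in> closed_cone k"
      using c by (intro closed_cone_add strict that closed_cone_scale mat_1_closed_cone k) auto
    then show ?thesis by simp
  qed
  have rho0: "rho x = 0" if x: "x \<in> frontier D" for x
  proof -
    have "x \<in> closure D" using x by (simp add: frontier_def)
    moreover have gx: "g x = 0" using frontier_D[OF x] by (simp add: g_def)
    ultimately have "d \<le> w x" using eR[of x] by (simp add: w_def h_def)
    then have "spline d (w x) = w x" using spline_high[OF _ d] by simp
    then show ?thesis by (simp add: rho_def w_def gx)
  qed
  have "rho x \<le> 0" if "x \<in> D" for x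
    using cone k(1) by (intro subharmonic_nonpos[OF open_D bounded_D C2_subset[OF C2rho subset_UNIV] crho(1) rho0 _ that])
      (auto simp: closed_cone_def)
  then have "adm k D rho Gr Hr"
    using rho0 cone crho C2_subset[OF C2rho subset_UNIV] by (auto simp: adm_def)
  then show ?thesis using that c(1) strict by blast
qed

end

section \<open>The inequality for k-convex functions\<close>

theorem theorem4:
  fixes D :: "(real ^ 'n) set" and m k :: nat
  assumes "m < k" and "k \<le> CARD('n)"
    and "smooth_bounded_domain D"
    and "\<forall>p\<in>frontier D. nsym (k - 1) (principal_curvatures D p) > 0"
  shows "\<exists>C::real. \<forall>u :: real ^ 'n \<Rightarrow> real.
           k_convex k D u \<longrightarrow> (\<forall>x\<in>frontier D. u x = 0) \<longrightarrow>
           hessian_integral m D u powr (1 / (real m + 1))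
             \<le> C * hessian_integral k D u powr (1 / (real k + 1))"
proof -
  obtain r G H where "C2 UNIV r G H" "D = {x. r x < 0}"
    "\<And>q. q \<in> frontier D \<Longrightarrow> r q = 0 \<and> G q \<noteq> 0 \<and> outer_normal D q = sgn (G q)"
    using global_defining_function[OF assms(3)] by metis
  then interpret defined_domain D r G H
    using assms(3) by unfold_locales (auto simp: smooth_bounded_domain_def)
  have k: "1 \<le> k" "k \<le> CARD('n)" using assms by auto
  show ?thesis
  proof (cases "\<exists>u y. k_convex k D u \<and> (\<forall>x\<in>frontier D. u x = 0) \<and> y \<in> D \<and> u y \<noteq> 0")
    \<comment> \<open>All integrals are \<open>0\<close> in this case, and \<open>0 powr x\<close>
      is \<open>0\<close>, so every \<open>C\<close> works.\<close>
    case False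
    have "hessian_integral j D u = 0" if "k_convex k D u" "\<forall>x\<in>frontier D. u x = 0" for j u
    proof -
      have "u x = 0" if "x \<in> D" for x using False that \<open>k_convex k D u\<close> \<open>\<forall>x\<in>frontier D. u x = 0\<close> by blast
      then have "(\<lambda>x. indicator D x *\<^sub>R (- u x * nsym j (matrix_eigenvalues (hessian u x)))) = (\<lambda>x. 0)"
        by (auto simp: indicator_def)
      then show ?thesis by (simp add: hessian_integral_def set_lebesgue_integral_def)
    qed
    then show ?thesis by simp
  next
    case True
    then obtain u0 y where u0: "k_convex k D u0" "\<And>x. x \<in> frontier D \<Longrightarrow> u0 x = 0" and y: "y \<in> D" "u0 y \<noteq> 0" by blast
    obtain G0 H0 where adm0: "adm k D u0 G0 H0" using adm_of_k_convex[OF open_D bounded_D k(1) u0] by metis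
    \<comment> \<open>The hypothesis concerns the normalized function of \<open>n - 1\<close>
      curvatures; dividing by \<open>a\<close> passes to \<open>msym\<close> of the compressed shape
      matrix.\<close>
    obtain a where a: "0 < a" "\<And>xs. length xs = CARD('n) - 1 \<Longrightarrow> nsym (k - 1) xs = a * esym (k - 1) xs"
      using nsym_esym[of "CARD('n) - 1" "k - 1"] by blast
    have "compress (nu p) (shape p) \<in> open_cone (k - 1)" if p: "p \<in> frontier D" for p
    proof (rule shape_in_cone[OF adm0 k y p])
      have "0 < a * msym (k - 1) (compress (nu p) (shape p))"
        using assms(4) p a(2) principal_curvatures_esym[OF p] by metis
      then show "0 < msym (k - 1) (compress (nu p) (shape p))" using a(1) by (simp add: zero_less_mult_iff)
    qed
    then obtain rho Gr Hr c where "adm k D rho Gr Hr" "0 < c" "\<And>x. x \<in> D \<Longrightarrow> Hr x - c *\<^sub>R mat 1 \<in> closed_cone k"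
      using exists_barrier[OF k] by metis
    from inequality_from_barrier[OF open_D bounded_D assms(1,2) this]
    obtain C where C: "0 < C" "\<And>u G H. adm k D u G H \<Longrightarrow>
      energy m D u H powr (1 / (real m + 1)) \<le> C * energy k D u H powr (1 / (real k + 1))" by blast
    obtain b where b: "0 < b" "\<And>u H. (\<forall>x\<in>D. H x = hessian u x \<and> transpose (hessian u x) = hessian u x) \<Longrightarrow>
      hessian_integral m D u = b * energy m D u H" using hessian_integral_energy[of D m] by blast
    obtain b' where b': "0 < b'" "\<And>u H. (\<forall>x\<in>D. H x = hessian u x \<and> transpose (hessian u x) = hessian u x) \<Longrightarrow>
      hessian_integral k D u = b' * energy k D u H" using hessian_integral_energy[of D k] by blast
    define s where "s = 1 / (real m + 1)"
    define s' where "s' = 1 / (real k + 1)"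
    \<comment> \<open>The factors \<open>b\<close> and \<open>b'\<close> convert between normalized
      and unnormalized integrals; their powers enter the constant.\<close>
    have "hessian_integral m D u powr s \<le> (b powr s * C / b' powr s') * hessian_integral k D u powr s'"
      if u: "k_convex k D u" "\<forall>x\<in>frontier D. u x = 0" for u
    proof -
      obtain Gu Hu where Gu: "adm k D u Gu Hu" "\<And>x. x \<in> D \<Longrightarrow> Hu x = hessian u x"
        "\<And>x. x \<in> D \<Longrightarrow> transpose (hessian u x) = hessian u x"
        using adm_of_k_convex[OF open_D bounded_D k(1) u(1)] u(2) by metis
      have "hessian_integral m D u powr s = b powr s * energy m D u Hu powr s"
        using b(1) b(2)[of Hu u] Gu(2,3) energy_nonneg[OF Gu(1), of m] assms(1) by (simp add: powr_mult)
      also have "\<dots> \<le> b powr s * (C * energy k D u Hu powr s')"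
        using C(2)[OF Gu(1)] unfolding s_def s'_def by (intro mult_left_mono) auto
      also have "\<dots> = (b powr s * C / b' powr s') * (b' powr s' * energy k D u Hu powr s')"
        using b'(1) by simp
      also have "b' powr s' * energy k D u Hu powr s' = hessian_integral k D u powr s'"
        using b'(1) b'(2)[of Hu u] Gu(2,3) energy_nonneg[OF Gu(1), of k] by (simp add: powr_mult)
      finally show ?thesis .
    qed
    then show ?thesis unfolding s_def s'_def by blast
  qed
qed

end
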